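(* Let $\mathcal{F}$ be a codimension one holomorphic foliation on $\mathbb{P}^n$ (over $\mathbb{C}$), $n>2$, and let $X\subset\mathbb{P}^n$ be a non-planar smooth hypersurface (i.e. $\deg(X)\ge 2$) transverse to $\mathcal{F}$. Then there is an automorphism $h\in\mathrm{Aut}(\mathbb{P}^n)$ such that the restriction $h^*\mathcal{F}|_X$ has an isolated singularity $p\notin\mathrm{sing}(h^*\mathcal{F})$.
   Context: A codimension one (singular holomorphic) foliation on a complex projective manifold $Y$ is determined by a line bundle $L$ and a nonzero section $\omega\in H^0(Y,\Omega^1_Y\otimes L)$ whose zero set has codimension at least $2$ and which is integrable: $\eta\wedge d\eta=0$ for any local representative $1$-form $\eta$ of $\omega$. Its singular set $\mathrm{sing}$ is the zero set of $\omega$; an isolated singularity is an isolated point of the singular set. Let $i:X\hookrightarrow\mathbb{P}^n$ be the inclusion. A foliation on $\mathbb{P}^n$ determined by $\omega\in H^0(\mathbb{P}^n,\Omega^1_{\mathbb{P}^n}(k))$ is transverse to $X$ if the zero set of $i^*\omega\in H^0(X,\Omega^1_X(k))$ has codimension at least two in $X$; in that case $i^*\omega$ determines a foliation on $X$, called the restriction to $X$. For $h\in\mathrm{Aut}(\mathbb{P}^n)$, $h^*\mathcal{F}$ is the foliation determined by $h^*\omega$, where $\omega$ determines $\mathcal{F}$. *)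

theory Defs
  imports "HOL-Analysis.Analysis"
begin

section \<open>Complex projective space\<close>

text \<open>If \<open>'n\<close> has \<open>n + 1\<close> elements, the type \<open>'n proj\<close> is complex projective \<open>n\<close>-space, with
  homogeneous coordinates indexed by \<open>'n\<close> and the quotient topology of \<open>\<complex>\<^sup>n\<^sup>+\<^sup>1 - {0}\<close>.\<close>

definition same_line :: "complex^'n \<Rightarrow> complex^'n \<Rightarrow> bool" where
  "same_line v w \<longleftrightarrow> v \<noteq> 0 \<and> w \<noteq> 0 \<and> (\<exists>c. w = c *s v)"

lemma part_equivp_same_line: "part_equivp (same_line :: complex^'n \<Rightarrow> complex^'n \<Rightarrow> bool)"
proof (rule part_equivpI)
  have "same_line (axis undefined 1) (axis undefined 1 :: complex^'n)"
    unfolding same_line_def by (auto simp: axis_eq_0_iff intro: exI[of _ 1])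
  then show "\<exists>x::complex^'n. same_line x x" by blast
  show "symp (same_line :: complex^'n \<Rightarrow> complex^'n \<Rightarrow> bool)"
  proof (rule sympI)
    fix x y :: "complex^'n"
    assume xy: "same_line x y"
    then obtain c where c: "x \<noteq> 0" "y \<noteq> 0" "y = c *s x" unfolding same_line_def by blast
    then have "c \<noteq> 0" by auto
    then have "x = inverse c *s y" using c by (simp add: vector_smult_assoc)
    with c show "same_line y x" unfolding same_line_def by blast
  qed
  show "transp (same_line :: complex^'n \<Rightarrow> complex^'n \<Rightarrow> bool)"
    by (rule transpI) (auto simp: same_line_def vector_smult_assoc)
qed

quotient_type 'n proj = "complex^'n" / partial: same_line
  morphisms rep_proj proj_point
  by (rule part_equivp_same_line)

lemma proj_point_eq_iff:
  assumes "v \<noteq> 0" "w \<noteq> 0"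
  shows "proj_point v = proj_point w \<longleftrightarrow> (\<exists>c. w = c *s v)"
proof -
  have refl: "same_line u u" if "u \<noteq> 0" for u :: "complex^'n"
    using that unfolding same_line_def by (auto intro: exI[of _ 1])
  show ?thesis
    using Quotient_rel[OF Quotient_proj, of v w] refl assms
    by (auto simp: same_line_def)
qed

text \<open>The punctured affine cone over a subset of projective space.\<close>

definition proj_cone :: "('n::finite) proj set \<Rightarrow> (complex^'n) set" where
  "proj_cone S = {v. v \<noteq> 0 \<and> proj_point v \<in> S}"

instantiation proj :: (finite) topological_space
begin

definition open_proj :: "'a proj set \<Rightarrow> bool" where
  "open_proj U \<longleftrightarrow> open (proj_cone U)"

instance
proof
  have "proj_cone (UNIV :: 'a proj set) = - {0}" by (auto simp: proj_cone_def)
  then show "open (UNIV :: 'a proj set)" by (simp add: open_proj_def open_Compl)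
next
  fix S T :: "'a proj set"
  have "proj_cone (S \<inter> T) = proj_cone S \<inter> proj_cone T" by (auto simp: proj_cone_def)
  then show "open S \<Longrightarrow> open T \<Longrightarrow> open (S \<inter> T)" by (auto simp: open_proj_def)
next
  fix K :: "'a proj set set"
  have "proj_cone (\<Union>K) = (\<Union>S\<in>K. proj_cone S)" by (auto simp: proj_cone_def)
  then show "\<forall>S\<in>K. open S \<Longrightarrow> open (\<Union>K)" by (auto simp: open_proj_def)
qed

end

section \<open>Holomorphic maps, submanifolds and codimension\<close>

definition holomorphic_map_on :: "(complex^'n \<Rightarrow> complex^'m) \<Rightarrow> (complex^'n) set \<Rightarrow> bool" where
  "holomorphic_map_on f S \<longleftrightarrow> (\<forall>x\<in>S. \<exists>J::complex^'n^'m. (f has_derivative (\<lambda>w. J *v w)) (at x))"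

definition complex_submanifold :: "nat \<Rightarrow> (complex^'n) set \<Rightarrow> bool" where
  "complex_submanifold k M \<longleftrightarrow>
    (\<forall>a\<in>M. \<exists>U (V :: (complex^'n) set) \<Phi> \<Psi> W. open U \<and> a \<in> U \<and> open V \<and>
       homeomorphism U V \<Phi> \<Psi> \<and> holomorphic_map_on \<Phi> U \<and> holomorphic_map_on \<Psi> V \<and>
       vec.subspace W \<and> vec.dim W = k \<and> \<Phi> ` (M \<inter> U) = W \<inter> V)"

text \<open>The quotient map from the punctured affine space onto projective space is a submersion with
  one-dimensional fibres, so \<open>M\<close> is a submanifold of dimension \<open>k\<close> if and only if the cone over
  it is one of dimension \<open>k + 1\<close>.\<close>

definition proj_submanifold :: "nat \<Rightarrow> ('n::finite) proj set \<Rightarrow> bool" where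
  "proj_submanifold k M \<longleftrightarrow> complex_submanifold (k + 1) (proj_cone M)"

text \<open>The dimension of an analytic set \<open>Z\<close> is the largest dimension of a submanifold contained in
  it (attained at its regular points). The predicate says that \<open>Z\<close> has codimension at least \<open>c\<close> in an
  ambient manifold of dimension \<open>m\<close>; it holds for the empty set.\<close>

definition codim_at_least :: "nat \<Rightarrow> nat \<Rightarrow> ('n::finite) proj set \<Rightarrow> bool" where
  "codim_at_least c m Z \<longleftrightarrow>
    (\<forall>k M. M \<noteq> {} \<and> M \<subseteq> Z \<and> proj_submanifold k M \<longrightarrow> k + c \<le> m)"

section \<open>Twisted one-forms and foliations on projective space\<close>

text \<open>A one-form \<open>\<Sum>\<^sub>i A\<^sub>i dz\<^sub>i\<close> on the punctured affine space is given by its coefficient vector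
  field \<open>A\<close>; \<open>form_at A v\<close> is the linear form at the point \<open>v\<close>.\<close>

definition form_at :: "(complex^'n \<Rightarrow> complex^'n) \<Rightarrow> complex^'n \<Rightarrow> complex^'n \<Rightarrow> complex" where
  "form_at A v w = (\<Sum>i\<in>UNIV. A v $ i * w $ i)"

text \<open>Global sections of \<open>\<Omega>\<^sup>1(k)\<close>. A section assigns to each line \<open>l\<close> a linear map from the tangent
  space \<open>Hom(l, \<complex>\<^sup>n\<^sup>+\<^sup>1/l)\<close> to the fibre \<open>Hom(l\<^sup>\<otimes>\<^sup>k, \<complex>)\<close> of \<open>O(k)\<close>. Evaluating at a nonzero \<open>v \<in> l\<close> turns it into
  a linear form on \<open>\<complex>\<^sup>n\<^sup>+\<^sup>1\<close> vanishing on \<open>v\<close>, and replacing \<open>v\<close> by \<open>c v\<close> multiplies this form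
  by \<open>c\<^sup>k\<^sup>-\<^sup>1\<close>. The values at \<open>0\<close> are irrelevant.\<close>

definition twisted_form :: "int \<Rightarrow> (complex^'n \<Rightarrow> complex^'n) \<Rightarrow> bool" where
  "twisted_form k A \<longleftrightarrow>
     holomorphic_map_on A (- {0}) \<and>
     (\<forall>v. v \<noteq> 0 \<longrightarrow> form_at A v v = 0) \<and>
     (\<forall>c v. c \<noteq> 0 \<and> v \<noteq> 0 \<longrightarrow> A (c *s v) = (c powi (k - 1)) *s A v)"

definition sing_set :: "(complex^'n \<Rightarrow> complex^'n) \<Rightarrow> 'n proj set" where
  "sing_set A = {proj_point v | v. v \<noteq> 0 \<and> A v = 0}"

definition ext_deriv :: "(complex^'n \<Rightarrow> complex^'n) \<Rightarrow> complex^'n \<Rightarrow> complex^'n \<Rightarrow> complex^'n \<Rightarrow> complex"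
  where
  "ext_deriv A v a b =
     form_at (\<lambda>x. frechet_derivative A (at x) a) v b - form_at (\<lambda>x. frechet_derivative A (at x) b) v a"

definition wedge_ext_deriv ::
  "(complex^'n \<Rightarrow> complex^'n) \<Rightarrow> complex^'n \<Rightarrow> complex^'n \<Rightarrow> complex^'n \<Rightarrow> complex^'n \<Rightarrow> complex" where
  "wedge_ext_deriv A v a b c =
     form_at A v a * ext_deriv A v b c + form_at A v b * ext_deriv A v c a
       + form_at A v c * ext_deriv A v a b"

text \<open>Over the chart \<open>z\<^sub>j \<noteq> 0\<close>, identified with the affine hyperplane \<open>z\<^sub>j = 1\<close>, the bundle \<open>O(k)\<close> is
  trivialised by \<open>z\<^sub>j\<^sup>k\<close> and the corresponding local representative \<open>\<eta>\<close> is the restriction of the form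
  to that hyperplane, with tangent vectors those having \<open>j\<close>-th coordinate \<open>0\<close>. Any other local
  representative is \<open>f \<eta>\<close> with \<open>f\<close> a unit, and \<open>f \<eta> \<and> d(f \<eta>) = f\<^sup>2 \<eta> \<and> d\<eta>\<close>.\<close>

definition integrable_form :: "(complex^'n \<Rightarrow> complex^'n) \<Rightarrow> bool" where
  "integrable_form A \<longleftrightarrow>
    (\<forall>j v a b c. v $ j = 1 \<and> a $ j = 0 \<and> b $ j = 0 \<and> c $ j = 0 \<longrightarrow> wedge_ext_deriv A v a b c = 0)"

definition foliation_form :: "int \<Rightarrow> (complex^'n \<Rightarrow> complex^'n) \<Rightarrow> bool" where
  "foliation_form k A \<longleftrightarrow>
     twisted_form k A \<and> (\<exists>v. v \<noteq> 0 \<and> A v \<noteq> 0) \<and>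
     codim_at_least 2 (CARD('n) - 1) (sing_set A) \<and> integrable_form A"

text \<open>Automorphisms of projective space are induced by invertible matrices. The pullback along
  \<open>v \<mapsto> H v\<close> has coefficients determined by
  \<open>form_at (pullback_form H A) v w = form_at A (H *v v) (H *v w)\<close>.\<close>

definition pullback_form :: "complex^'n^'n \<Rightarrow> (complex^'n \<Rightarrow> complex^'n) \<Rightarrow> complex^'n \<Rightarrow> complex^'n" where
  "pullback_form H A v = transpose H *v A (H *v v)"

lemma form_at_pullback: "form_at (pullback_form H A) v w = form_at A (H *v v) (H *v w)"
proof -
  have "form_at (pullback_form H A) v w = (\<Sum>i\<in>UNIV. \<Sum>j\<in>UNIV. H $ j $ i * A (H *v v) $ j * w $ i)"
    by (simp add: form_at_def pullback_form_def matrix_vector_mult_def transpose_def sum_distrib_right)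
  also have "\<dots> = (\<Sum>j\<in>UNIV. \<Sum>i\<in>UNIV. H $ j $ i * A (H *v v) $ j * w $ i)"
    by (rule sum.swap)
  also have "\<dots> = form_at A (H *v v) (H *v w)"
    unfolding form_at_def matrix_vector_mult_def[of H w]
    by (simp add: sum_distrib_left mult_ac)
  finally show ?thesis .
qed

section \<open>Hypersurfaces and restriction of foliations\<close>

definition homogeneous_polynomial :: "nat \<Rightarrow> (complex^'n \<Rightarrow> complex) \<Rightarrow> bool" where
  "homogeneous_polynomial d F \<longleftrightarrow>
    (\<exists>a. \<forall>v. F v = (\<Sum>\<alpha> | sum \<alpha> UNIV = d. a \<alpha> * (\<Prod>i\<in>UNIV. (v $ i) ^ \<alpha> i)))"

lemma finite_exponents: "finite {\<alpha> :: 'n::finite \<Rightarrow> nat. sum \<alpha> UNIV = d}"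
proof (rule finite_subset)
  show "{\<alpha> :: 'n \<Rightarrow> nat. sum \<alpha> UNIV = d} \<subseteq> PiE UNIV (\<lambda>_. {..d})"
    by (auto intro: member_le_sum)
  show "finite (PiE (UNIV :: 'n set) (\<lambda>_. {..d}))"
    by (rule finite_PiE) auto
qed

definition hypersurface :: "(complex^'n \<Rightarrow> complex) \<Rightarrow> 'n proj set" where
  "hypersurface F = {proj_point v | v. v \<noteq> 0 \<and> F v = 0}"

text \<open>\<open>hypersurface F\<close> is smooth of degree \<open>d\<close>: the differential condition makes \<open>F\<close> a nonzero
  reduced equation, so the degree of the hypersurface is that of \<open>F\<close>.\<close>

definition smooth_hypersurface_eq :: "nat \<Rightarrow> (complex^'n \<Rightarrow> complex) \<Rightarrow> bool" where
  "smooth_hypersurface_eq d F \<longleftrightarrow>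
     homogeneous_polynomial d F \<and>
     (\<forall>v. v \<noteq> 0 \<and> F v = 0 \<longrightarrow> frechet_derivative F (at v) \<noteq> (\<lambda>_. 0))"

text \<open>The zero set of the restriction \<open>i\<^sup>*A\<close> to \<open>hypersurface F\<close>, whose tangent space at the class of
  \<open>v\<close> is the image of the kernel of the differential of \<open>F\<close> at \<open>v\<close>.\<close>

definition restr_sing_set :: "(complex^'n \<Rightarrow> complex^'n) \<Rightarrow> (complex^'n \<Rightarrow> complex) \<Rightarrow> 'n proj set" where
  "restr_sing_set A F =
     {proj_point v | v. v \<noteq> 0 \<and> proj_point v \<in> hypersurface F \<and>
        (\<forall>w. frechet_derivative F (at v) w = 0 \<longrightarrow> form_at A v w = 0)}"

text \<open>Here \<open>CARD('n) - 2\<close> is the dimension of the hypersurface.\<close>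

definition transverse_to :: "(complex^'n \<Rightarrow> complex^'n) \<Rightarrow> (complex^'n \<Rightarrow> complex) \<Rightarrow> bool" where
  "transverse_to A F \<longleftrightarrow> codim_at_least 2 (CARD('n) - 2) (restr_sing_set A F)"

end

theory Submission
  imports Defs "HOL-Complex_Analysis.Conformal_Mappings"
begin

text \<open>Transversality of \<open>H\<^sup>*\<F>\<close> to \<open>X\<close> fails only for a Lebesgue null set of matrices \<open>H\<close>, while a nonempty
  open set of \<open>H\<close> produces an isolated tangency outside the singular set; a null set cannot cover it.

  For the first, a divisorial component of the tangency locus is a submanifold of codimension at most
  one in \<open>X\<close>, hence meets one of countably many holomorphic discs \<open>\<gamma>\<close> in \<open>X\<close>. For a fixed disc a
  parameter count, using only that differentiable maps preserve null sets, shows that the \<open>H\<close> with a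
  tangency on \<open>\<gamma>\<close> form a null set: being tangent at a given point outside the singular set is a
  condition of codimension \<open>n - 1 \<ge> 2\<close> on \<open>H\<close>, and so is being singular there, as the singular set is covered
  by countably many pieces of codimension \<open>2\<close>.

  For the second, let \<open>p\<close> minimise \<open>\<bar>\<nabla>F(p)\<bar> / \<bar>p\<bar>\<^sup>d\<^sup>-\<^sup>1\<close> on \<open>X\<close>. The maximum principle along a holomorphic disc
  through \<open>p\<close> in a direction of the kernel shows that the Hessian of \<open>F\<close> at \<open>p\<close> is invertible. Choose
  \<open>g\<close> mapping \<open>p\<close> to a nonsingular point of \<open>\<F>\<close> and the tangent space of \<open>X\<close> to that of \<open>\<F>\<close>, and compose with a
  strong contraction towards \<open>p\<close>. The resulting foliation is almost a pencil of hyperplanes near \<open>p\<close>,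
  so its tangency with \<open>X\<close> at \<open>p\<close> is nondegenerate and persists under small changes of \<open>H\<close>.\<close>

section \<open>Holomorphic functions of several variables\<close>

text \<open>Codimension is tested on submanifolds contained in a set, so the argument avoids
  components of analytic sets and works with regular zeros: a zero of a function that is not
  identically zero is a regular zero of one of its countably many iterated partial derivatives.

  Put N = n + 1. Matrices carrying a point of a disc into a hypersurface piece have (N^2 - N) + (N -
  1) + 1 = N^2 parameters, as many as all matrices; the second equation coming from codimension two
  makes them a null set. Tangency with a nonsingular image point leaves (N^2 - N) + 3 parameters,
  fewer than N^2 precisely when N is at least 4, that is, n > 2.

  Degree at least two enters through the Hessian, which vanishes identically for linear
  \<open>F\<close>. At the minimum, a kernel vector would keep the direction of the gradient fixed
  to first order along a disc, while the square of the norm of the suitably scaled point grows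
  quadratically. When the form is scaled around \<open>p\<close> by \<tau>, its derivative enters
  the linearised tangency equation with the square of \<tau>, the Hessian only with \<tau>, so the
  invertible Hessian dominates.\<close>

definition hol_on :: "(complex^'m \<Rightarrow> complex) \<Rightarrow> (complex^'m) set \<Rightarrow> bool" where
  "hol_on f S \<longleftrightarrow> (\<forall>x\<in>S. \<exists>D. (f has_derivative D) (at x) \<and> (\<forall>c w. D (c *s w) = c * D w))"

definition pd :: "'m \<Rightarrow> (complex^'m \<Rightarrow> complex) \<Rightarrow> complex^'m \<Rightarrow> complex" where
  "pd i f x = frechet_derivative f (at x) (axis i 1)"

definition setc :: "'m \<Rightarrow> 'a \<Rightarrow> 'a^'m \<Rightarrow> 'a^'m" where
  "setc i c x = (\<chi> a. if a = i then c else x $ a)"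

lemma setc_nth [simp]: "setc i c x $ a = (if a = i then c else x $ a)"
  by (simp add: setc_def)

lemma hol_on_subset: "hol_on f S \<Longrightarrow> T \<subseteq> S \<Longrightarrow> hol_on f T"
  unfolding hol_on_def by blast

lemma hol_onI:
  assumes "\<And>x. x \<in> S \<Longrightarrow> (f has_derivative D x) (at x)"
    and "\<And>x c w. x \<in> S \<Longrightarrow> D x (c *s w) = c * D x w"
  shows "hol_on f S"
  using assms unfolding hol_on_def by blast

lemma hol_on_has_derivative:
  fixes f :: "complex^'m \<Rightarrow> complex"
  assumes "hol_on f S" "x \<in> S"
  shows "(f has_derivative (\<lambda>w. \<Sum>i\<in>UNIV. pd i f x * w $ i)) (at x)"
proof -
  obtain D where D: "(f has_derivative D) (at x)" "\<And>c w. D (c *s w) = c * D w"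
    using assms unfolding hol_on_def by blast
  have eq: "frechet_derivative f (at x) = D"
    using frechet_derivative_at[OF D(1)] by simp
  have lin: "linear D" using D(1) has_derivative_linear by blast
  have "D = (\<lambda>w. \<Sum>i\<in>UNIV. pd i f x * w $ i)"
  proof
    fix w
    have "D w = D (\<Sum>i\<in>UNIV. (w $ i) *s axis i 1)" by (simp add: basis_expansion)
    also have "\<dots> = (\<Sum>i\<in>UNIV. D ((w $ i) *s axis i 1))" by (simp add: linear_sum[OF lin])
    also have "\<dots> = (\<Sum>i\<in>UNIV. pd i f x * w $ i)" by (simp add: D(2) pd_def eq mult.commute)
    finally show "D w = (\<Sum>i\<in>UNIV. pd i f x * w $ i)" .
  qed
  then show ?thesis using D(1) by simp
qed

lemma hol_on_continuous: "hol_on f S \<Longrightarrow> continuous_on S f"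
  by (intro continuous_at_imp_continuous_on ballI)
     (rule has_derivative_continuous[OF hol_on_has_derivative])

lemma hol_on_const [simp, intro]: "hol_on (\<lambda>x. c) S"
  by (rule hol_onI[where D = "\<lambda>x w. 0"]) auto

lemma hol_on_nth [simp, intro]: "hol_on (\<lambda>x. x $ i) S"
  by (rule hol_onI[where D = "\<lambda>x w. w $ i"]) (auto intro: bounded_linear_imp_has_derivative bounded_linear_vec_nth)

lemma hol_on_add [intro]:
  assumes "hol_on f S" "hol_on g S" shows "hol_on (\<lambda>x. f x + g x) S"
  unfolding hol_on_def
proof
  note f = assms(1)[unfolded hol_on_def] and g = assms(2)[unfolded hol_on_def]
  fix x assume x: "x \<in> S"
  obtain D E where "(f has_derivative D) (at x)" "\<And>c w. D (c *s w) = c * D w"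
     "(g has_derivative E) (at x)" "\<And>c w. E (c *s w) = c * E w"
    using f g x by blast
  then show "\<exists>D. ((\<lambda>x. f x + g x) has_derivative D) (at x) \<and> (\<forall>c w. D (c *s w) = c * D w)"
    by (intro exI[of _ "\<lambda>h. D h + E h"] conjI has_derivative_add)
      (auto simp: algebra_simps)
qed

lemma hol_on_mult [intro]:
  assumes "hol_on f S" "hol_on g S" shows "hol_on (\<lambda>x. f x * g x) S"
  unfolding hol_on_def
proof
  fix x assume x: "x \<in> S"
  obtain D E where "(f has_derivative D) (at x)" "\<And>c w. D (c *s w) = c * D w"
     "(g has_derivative E) (at x)" "\<And>c w. E (c *s w) = c * E w"
    using assms x unfolding hol_on_def by blast
  then show "\<exists>D. ((\<lambda>x. f x * g x) has_derivative D) (at x) \<and> (\<forall>c w. D (c *s w) = c * D w)"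
    by (intro exI[of _ "\<lambda>h. f x * E h + D h * g x"] conjI has_derivative_mult)
      (auto simp: algebra_simps)
qed

lemma hol_on_diff [intro]:
  assumes "hol_on f S" "hol_on g S" shows "hol_on (\<lambda>x. f x - g x) S"
  using hol_on_add[OF assms(1) hol_on_mult[OF hol_on_const[of "-1"] assms(2)]] by simp

lemma hol_on_sum [intro]: "(\<And>i. i \<in> I \<Longrightarrow> hol_on (f i) S) \<Longrightarrow> hol_on (\<lambda>x. \<Sum>i\<in>I. f i x) S"
  by (induction I rule: infinite_finite_induct) auto

lemma hol_on_power [intro]: "hol_on f S \<Longrightarrow> hol_on (\<lambda>x. f x ^ n) S"
  by (induction n) auto

lemma hol_on_prod [intro]: "(\<And>i. i \<in> I \<Longrightarrow> hol_on (f i) S) \<Longrightarrow> hol_on (\<lambda>x. \<Prod>i\<in>I. f i x) S"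
  by (induction I rule: infinite_finite_induct) auto

lemma has_derivative_vecI:
  fixes \<Phi> :: "'a::real_normed_vector \<Rightarrow> 'b::euclidean_space^'m"
  assumes "\<And>a. ((\<lambda>x. \<Phi> x $ a) has_derivative (\<lambda>w. D w $ a)) (at x within S)"
  shows "(\<Phi> has_derivative D) (at x within S)"
proof (subst has_derivative_componentwise_within, rule ballI)
  fix b :: "'b^'m" assume "b \<in> Basis"
  then obtain a u where b: "b = axis a u" unfolding Basis_vec_def by auto
  show "((\<lambda>x. \<Phi> x \<bullet> b) has_derivative (\<lambda>w. D w \<bullet> b)) (at x within S)"
    unfolding b inner_axis by (rule has_derivative_inner_left[OF assms])
qed

lemma hol_on_compose:
  fixes \<Phi> :: "complex^'k \<Rightarrow> complex^'m"
  assumes "hol_on g T" "\<And>a. hol_on (\<lambda>x. \<Phi> x $ a) S" "\<Phi> ` S \<subseteq> T"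
  shows "hol_on (\<lambda>x. g (\<Phi> x)) S"
proof (rule hol_onI)
  fix x assume x: "x \<in> S"
  have d: "(\<Phi> has_derivative (\<lambda>w. \<chi> a. \<Sum>i\<in>UNIV. pd i (\<lambda>x. \<Phi> x $ a) x * w $ i)) (at x)"
    by (rule has_derivative_vecI) (simp add: hol_on_has_derivative[OF assms(2) x])
  show "((\<lambda>x. g (\<Phi> x)) has_derivative
     (\<lambda>w. \<Sum>a\<in>UNIV. pd a g (\<Phi> x) * (\<Sum>i\<in>UNIV. pd i (\<lambda>x. \<Phi> x $ a) x * w $ i))) (at x)"
    using diff_chain_at[OF d hol_on_has_derivative[OF assms(1)], of ] x assms(3)
    by (auto simp: o_def)
qed (simp add: sum_distrib_left mult_ac)

lemma holomorphic_map_on_iff: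
  fixes \<Phi> :: "complex^'k \<Rightarrow> complex^'m"
  shows "holomorphic_map_on \<Phi> S \<longleftrightarrow> (\<forall>a. hol_on (\<lambda>x. \<Phi> x $ a) S)"
proof
  assume H: "holomorphic_map_on \<Phi> S"
  show "\<forall>a. hol_on (\<lambda>x. \<Phi> x $ a) S"
    unfolding hol_on_def
  proof (intro allI ballI)
    fix a x assume "x \<in> S"
    then obtain J :: "complex^'k^'m" where J: "(\<Phi> has_derivative (\<lambda>w. J *v w)) (at x)"
      using H unfolding holomorphic_map_on_def by blast
    have "((\<lambda>x. \<Phi> x $ a) has_derivative (\<lambda>w. (J *v w) $ a)) (at x)"
      using J by (rule bounded_linear.has_derivative[OF bounded_linear_vec_nth])
    then show "\<exists>D. ((\<lambda>x. \<Phi> x $ a) has_derivative D) (at x) \<and> (\<forall>c w. D (c *s w) = c * D w)"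
      by (intro exI[of _ "\<lambda>w. (J *v w) $ a"]) (auto simp: matrix_vector_mult_def sum_distrib_left mult_ac)
  qed
next
  assume H: "\<forall>a. hol_on (\<lambda>x. \<Phi> x $ a) S"
  show "holomorphic_map_on \<Phi> S"
    unfolding holomorphic_map_on_def
  proof
    fix x assume x: "x \<in> S"
    let ?J = "\<chi> a i. pd i (\<lambda>x. \<Phi> x $ a) x"
    have "(\<Phi> has_derivative (\<lambda>w. ?J *v w)) (at x)"
      by (rule has_derivative_vecI)
        (use hol_on_has_derivative H x in \<open>auto simp: matrix_vector_mult_def\<close>)
    then show "\<exists>J. (\<Phi> has_derivative (*v) J) (at x)" by blast
  qed
qed

lemma hol_on_chain_1:
  fixes \<gamma> :: "complex \<Rightarrow> complex^'m"
  assumes "hol_on g T" "\<And>a. ((\<lambda>s. \<gamma> s $ a) has_field_derivative \<gamma>' a) (at s)" "\<gamma> s \<in> T"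
  shows "((\<lambda>s. g (\<gamma> s)) has_field_derivative (\<Sum>a\<in>UNIV. pd a g (\<gamma> s) * \<gamma>' a)) (at s)"
proof -
  have d: "(\<gamma> has_derivative (\<lambda>w. \<chi> a. \<gamma>' a * w)) (at s)"
    by (rule has_derivative_vecI) (use assms(2) in \<open>auto simp: has_field_derivative_def\<close>)
  have "(\<lambda>w. \<Sum>a\<in>UNIV. pd a g (\<gamma> s) * (\<gamma>' a * w)) = (*) (\<Sum>a\<in>UNIV. pd a g (\<gamma> s) * \<gamma>' a)"
    by (rule ext) (simp add: sum_distrib_right mult.assoc)
  then show ?thesis
    using diff_chain_at[OF d hol_on_has_derivative[OF assms(1,3)]]
    by (simp add: has_field_derivative_def o_def)
qed

lemma hol_on_line:
  assumes "hol_on f S" "x + s *s u \<in> S"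
  shows "((\<lambda>s. f (x + s *s u)) has_field_derivative (\<Sum>a\<in>UNIV. pd a f (x + s *s u) * u $ a)) (at s)"
  by (rule hol_on_chain_1[OF assms(1)]) (auto intro!: derivative_eq_intros assms(2))

lemma pd_eq_deriv_line:
  assumes "hol_on f S" "x \<in> S"
  shows "((\<lambda>s. f (x + s *s axis i 1)) has_field_derivative pd i f x) (at 0)"
proof -
  have "(\<Sum>a\<in>UNIV. pd a f (x + 0 *s axis i 1) * axis i 1 $ a) = pd i f x"
    by (simp add: axis_def if_distrib cong: if_cong)
  then show ?thesis using hol_on_line[OF assms(1), of x 0 "axis i 1"] assms(2) by simp
qed

section \<open>Cauchy's formula and smoothness of holomorphic functions\<close>

lemma norm_axis_complex [simp]: "norm (axis i (1::complex)) = 1"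
  by (rule norm_Basis) (auto simp: Basis_complex_def intro!: axis_in_Basis_iff[THEN iffD2])

lemma norm_vector_smult [simp]: "norm (c *s (v :: complex^'m)) = norm c * norm v"
  by (simp add: norm_vec_def norm_mult L2_set_right_distrib)

lemma continuous_on_smult [continuous_intros]:
  fixes f :: "'a::topological_space \<Rightarrow> complex" and g :: "'a \<Rightarrow> complex^'m"
  assumes "continuous_on S f" "continuous_on S g"
  shows "continuous_on S (\<lambda>x. f x *s g x)"
  unfolding vector_scalar_mult_def
  by (intro continuous_on_vec_lambda continuous_intros assms)

text \<open>Cauchy's formula on the complex line through \<open>x\<close> in the \<open>i\<close>-th
  direction, written over [0, 1] so that the rules for integrals with parameters apply.\<close>

lemma pd_integral:
  fixes f :: "complex^'m \<Rightarrow> complex"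
  assumes "hol_on f S" "open S" "cball x r \<subseteq> S" "r > 0"
  shows "pd i f x = integral (cbox 0 1) (\<lambda>t. f (x + circlepath 0 r t *s axis i 1) *
     (vector_derivative (circlepath 0 r) (at t) / (circlepath 0 r t)\<^sup>2) / (2 * of_real pi * \<i>))"
proof -
  let ?g = "\<lambda>s. f (x + s *s axis i 1)"
  have sub: "x + s *s axis i 1 \<in> S" if "s \<in> cball 0 r" for s
    using that assms(3) by (auto simp: subset_iff dist_norm)
  have der: "(?g has_field_derivative (\<Sum>a\<in>UNIV. pd a f (x + s *s axis i 1) * axis i 1 $ a)) (at s)"
    if "s \<in> cball 0 r" for s
    by (rule hol_on_line[OF assms(1) sub[OF that]])
  have c: "continuous_on (cball 0 r) ?g"
    by (intro continuous_at_imp_continuous_on ballI) (rule DERIV_isCont[OF der])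
  have h: "?g holomorphic_on ball 0 r"
    unfolding holomorphic_on_def field_differentiable_def
  proof
    fix s assume "s \<in> ball (0::complex) r"
    then show "\<exists>f'. (?g has_field_derivative f') (at s within ball 0 r)"
      using der[of s] by (intro exI) (rule has_field_derivative_at_within, auto)
  qed
  have *: "(?g has_field_derivative
       (1 / (2 * of_real pi * \<i>) * contour_integral (circlepath 0 r) (\<lambda>u. ?g u / (u - 0)\<^sup>2))) (at 0)"
    by (rule Cauchy_derivative_integral_circlepath(2)[OF c h]) (use assms(4) in auto)
  have "x \<in> S" using assms(3,4) by auto
  have "pd i f x = 1 / (2 * of_real pi * \<i>) * contour_integral (circlepath 0 r) (\<lambda>u. ?g u / (u - 0)\<^sup>2)"
    by (rule DERIV_unique[OF pd_eq_deriv_line[OF assms(1) \<open>x \<in> S\<close>] *])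
  also have "\<dots> = 1 / (2 * of_real pi * \<i>) * integral (cbox 0 1) (\<lambda>t. ?g (circlepath 0 r t) / (circlepath 0 r t)\<^sup>2 *
       vector_derivative (circlepath 0 r) (at t))"
    by (simp only: contour_integral_integral box_real diff_zero)
  also have "\<dots> = integral (cbox 0 1) (\<lambda>t. 1 / (2 * of_real pi * \<i>) * (?g (circlepath 0 r t) / (circlepath 0 r t)\<^sup>2 *
       vector_derivative (circlepath 0 r) (at t)))"
    by (simp only: integral_mult_right)
  finally show ?thesis by (simp only: divide_inverse mult_ac mult_1_left)
qed

lemma apply_Blinfun_finite:
  fixes D :: "'a::euclidean_space \<Rightarrow> 'b::real_normed_vector"
  assumes "linear D" shows "blinfun_apply (Blinfun D) = D"
  using assms by (simp add: linear_conv_bounded_linear bounded_linear_Blinfun_apply)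

lemma linear_form: "linear (\<lambda>w :: complex^'m. \<Sum>k\<in>UNIV. a k * w $ k)"
  by (rule linearI) (auto simp: algebra_simps sum.distrib scaleR_sum_right)

text \<open>One circle serves all centres in a ball: \<open>c\<close> and \<open>k\<close> do not
  depend on \<open>x\<close>, which enters the integrand only through \<open>f\<close>. Regularity
  in \<open>x\<close> thus passes from \<open>f\<close> to its partial derivative.\<close>

lemma pd_local_integral:
  fixes f :: "complex^'m \<Rightarrow> complex"
  assumes f: "hol_on f S" and S: "open S" and x0: "x0 \<in> S"
  shows "\<exists>r > 0. \<exists>c k :: real \<Rightarrow> complex. ball x0 r \<subseteq> S \<and> continuous_on UNIV c \<and> continuous_on {0..1} k \<and>
    (\<forall>x\<in>ball x0 r. (\<forall>t. x + c t *s axis i 1 \<in> S) \<and>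
       pd i f x = integral (cbox 0 1) (\<lambda>t. f (x + c t *s axis i 1) * k t))"
proof -
  obtain r0 where r0: "r0 > 0" "cball x0 r0 \<subseteq> S"
    using x0 S open_contains_cball by blast
  \<comment> \<open>Half of \<open>r0\<close>, so that the closed ball of radius \<open>r\<close>
    about any point of \<open>ball x0 r\<close> stays in \<open>cball x0 r0\<close>.\<close>
  define r where "r = r0 / 2"
  have r: "r > 0" using r0 by (simp add: r_def)
  have cb: "cball x r \<subseteq> S" if "x \<in> ball x0 r" for x
  proof
    fix y assume "y \<in> cball x r"
    then have "dist x0 y \<le> dist x0 x + dist x y" "dist x y \<le> r" by (auto intro: dist_triangle)
    then have "y \<in> cball x0 r0" using that by (auto simp: r_def)
    then show "y \<in> S" using r0 by blast
  qed
  define c where "c = circlepath 0 r"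
  define k where "k t = vector_derivative c (at t) / (c t)\<^sup>2 / (2 * of_real pi * \<i>)" for t :: real
  have c_cont: "continuous_on T c" for T
    unfolding c_def circlepath by (intro continuous_intros)
  have c_norm: "norm (c t) = r" for t
    using r by (simp add: c_def circlepath norm_mult)
  have c0: "c t \<noteq> 0" for t using r c_norm[of t] by auto
  have kcont: "continuous_on {0..1} k"
  proof -
    have "continuous_on {0..1} (\<lambda>t. 2 * pi * \<i> * r * exp (2 * of_real pi * \<i> * t) / (c t)\<^sup>2 / (2 * of_real pi * \<i>))"
      by (intro continuous_intros c_cont) (auto simp: c0)
    moreover have "2 * pi * \<i> * r * exp (2 * of_real pi * \<i> * t) / (c t)\<^sup>2 / (2 * of_real pi * \<i>) = k t" if "t \<in> {0..1}" for t
      using that unfolding k_def c_def by (simp add: vector_derivative_circlepath)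
    ultimately show ?thesis by (rule continuous_on_eq)
  qed
  have mem: "x + c t *s axis i 1 \<in> S" if "x \<in> ball x0 r" for x t
  proof -
    have "x + c t *s axis i 1 \<in> cball x r" using r c_norm by (simp add: dist_norm)
    then show ?thesis using cb that by blast
  qed
  have eq: "pd i f x = integral (cbox 0 1) (\<lambda>t. f (x + c t *s axis i 1) * k t)" if "x \<in> ball x0 r" for x
    using pd_integral[OF f S cb[OF that] r, of i] by (simp add: c_def k_def)
  have "ball x0 r \<subseteq> S" using r0 by (auto simp: r_def subset_iff)
  then show ?thesis
    by (intro exI[of _ r] conjI exI[of _ c] exI[of _ k] ballI allI r c_cont kcont mem eq)
qed

lemma continuous_on_line_pair:
  assumes "continuous_on UNIV c"
  shows "continuous_on T (\<lambda>p :: (complex^'m) \<times> real. fst p + c (snd p) *s u)"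
  by (intro continuous_intros continuous_on_compose2[OF assms]) auto

lemma continuous_on_pd:
  fixes f :: "complex^'m \<Rightarrow> complex"
  assumes f: "hol_on f S" and S: "open S"
  shows "continuous_on S (pd i f)"
proof (rule continuous_at_imp_continuous_on, rule ballI)
  fix y assume y: "y \<in> S"
  obtain r and c k :: "real \<Rightarrow> complex" where *: "r > 0" "ball y r \<subseteq> S" "continuous_on UNIV c" "continuous_on {0..1} k"
    "\<forall>x\<in>ball y r. (\<forall>t. x + c t *s axis i 1 \<in> S) \<and>
       pd i f x = integral (cbox 0 1) (\<lambda>t. f (x + c t *s axis i 1) * k t)"
    using pd_local_integral[OF f S y, of i] by (elim exE conjE) (rule that)
  have "continuous_on (ball y r) (\<lambda>x. integral (cbox 0 1) (\<lambda>t. f (x + c t *s axis i 1) * k t))"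
  proof (rule integral_continuous_on_param)
    have "continuous_on (ball y r \<times> cbox 0 1) (\<lambda>p. f (fst p + c (snd p) *s axis i 1))"
      by (rule continuous_on_compose2[OF hol_on_continuous[OF f] continuous_on_line_pair[OF *(3)]])
         (use *(5) in auto)
    moreover have "continuous_on (ball y r \<times> cbox 0 1) (\<lambda>p. k (snd p))"
      by (rule continuous_on_compose2[OF *(4)]) (auto intro!: continuous_intros)
    ultimately show "continuous_on (ball y r \<times> cbox 0 1) (\<lambda>(x, t). f (x + c t *s axis i 1) * k t)"
      unfolding case_prod_unfold by (rule continuous_on_mult)
  qed
  then have "continuous_on (ball y r) (pd i f)" by (rule continuous_on_eq) (simp add: *(5))
  then show "isCont (pd i f) y"
    using *(1) by (simp add: continuous_on_eq_continuous_at)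
qed

text \<open>Differentiation under the integral sign in \<open>pd_local_integral\<close>; the Leibniz
  rule asks for a jointly continuous derivative, which \<open>continuous_on_pd\<close> provides. The
  derivative is an integral of complex homogeneous maps, so the statement can be iterated to all
  orders.\<close>

lemma hol_on_pd:
  fixes f :: "complex^'m \<Rightarrow> complex"
  assumes f: "hol_on f S" and S: "open S"
  shows "hol_on (pd i f) S"
  unfolding hol_on_def
proof
  fix x0 assume x0S: "x0 \<in> S"
  obtain r and c k :: "real \<Rightarrow> complex" where r: "r > 0" and "ball x0 r \<subseteq> S" and c: "continuous_on UNIV c" and k: "continuous_on {0..1} k"
    and mem_eq: "\<forall>x\<in>ball x0 r. (\<forall>t. x + c t *s axis i 1 \<in> S) \<and>
       pd i f x = integral (cbox 0 1) (\<lambda>t. f (x + c t *s axis i 1) * k t)"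
    using pd_local_integral[OF f S x0S, of i] by (elim exE conjE) (rule that)
  define U where "U = ball x0 r"
  have mem: "x + c t *s axis i 1 \<in> S" if "x \<in> U" for x t
    using bspec[OF mem_eq that[unfolded U_def]] by blast
  have line: "continuous_on (U \<times> cbox 0 1) (\<lambda>p. g (fst p + c (snd p) *s axis i 1))"
    if "continuous_on S g" for g :: "complex^'m \<Rightarrow> complex"
    by (rule continuous_on_compose2[OF that continuous_on_line_pair[OF c]]) (auto intro: mem)
  have kcont: "continuous_on (U \<times> cbox 0 1) (\<lambda>p. k (snd p))"
    by (rule continuous_on_compose2[OF k]) (auto intro!: continuous_intros)
  define B where "B x t = Blinfun (\<lambda>w. (\<Sum>j\<in>UNIV. (pd j f (x + c t *s axis i 1) * k t) * w $ j))" for x and t :: real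
  have B: "blinfun_apply (B x t) w = (\<Sum>j\<in>UNIV. (pd j f (x + c t *s axis i 1) * k t) * w $ j)" for x t w
    unfolding B_def by (simp add: apply_Blinfun_finite[OF linear_form])
  have Bcont: "continuous_on (U \<times> cbox 0 1) (\<lambda>p. B (fst p) (snd p))"
  proof (rule continuous_on_blinfun_componentwise)
    fix b :: "complex^'m"
    have "continuous_on (U \<times> cbox 0 1) (\<lambda>p. (pd j f (fst p + c (snd p) *s axis i 1) * k (snd p)) * b $ j)" for j
      by (rule continuous_on_mult[OF continuous_on_mult[OF line[OF continuous_on_pd[OF f S]] kcont] continuous_on_const])
    then show "continuous_on (U \<times> cbox 0 1) (\<lambda>p. blinfun_apply (B (fst p) (snd p)) b)"
      unfolding B by (rule continuous_on_sum)
  qed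
  have slice: "continuous_on (cbox 0 1) (\<lambda>t. h (x, t))" if "x \<in> U" "continuous_on (U \<times> cbox 0 1) h"
    for h :: "_ \<Rightarrow> 'z::topological_space" and x
    by (rule continuous_on_compose2[OF that(2) continuous_on_Pair[OF continuous_on_const continuous_on_id]])
       (use that(1) in auto)
  have x0: "x0 \<in> U" using r by (simp add: U_def)
  have "((\<lambda>x. integral (cbox 0 1) (\<lambda>t. f (x + c t *s axis i 1) * k t)) has_derivative
      blinfun_apply (integral (cbox 0 1) (B x0))) (at x0 within U)"
  proof (rule leibniz_rule[where fx = B and U = U and f = "\<lambda>x t. f (x + c t *s axis i 1) * k t"])
    show "x0 \<in> U" by (rule x0)
    show "continuous_on (U \<times> cbox 0 1) (\<lambda>(x, t). B x t)"
      using Bcont by (simp add: case_prod_unfold)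
    show "convex U" by (simp add: U_def)
    fix x assume x: "x \<in> U"
    show "(\<lambda>t. f (x + c t *s axis i 1) * k t) integrable_on cbox 0 1"
      using slice[OF x continuous_on_mult[OF line[OF hol_on_continuous[OF f]] kcont]]
      by (intro integrable_continuous) simp
    fix t :: real
    have "((\<lambda>x. f (x + c t *s axis i 1)) has_derivative
       (\<lambda>w. \<Sum>j\<in>UNIV. pd j f (x + c t *s axis i 1) * w $ j)) (at x within U)"
    proof (rule has_derivative_at_withinI)
      have "((\<lambda>x. x + c t *s axis i 1) has_derivative (\<lambda>w. w)) (at x)"
        by (intro has_derivative_add_const has_derivative_ident)
      moreover have "(f has_derivative (\<lambda>w. \<Sum>j\<in>UNIV. pd j f (x + c t *s axis i 1) * w $ j)) (at (x + c t *s axis i 1))"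
        by (rule hol_on_has_derivative[OF f mem[OF x]])
      ultimately show "((\<lambda>x. f (x + c t *s axis i 1)) has_derivative
         (\<lambda>w. \<Sum>j\<in>UNIV. pd j f (x + c t *s axis i 1) * w $ j)) (at x)"
        by (rule has_derivative_compose)
    qed
    then have "((\<lambda>x. f (x + c t *s axis i 1) * k t) has_derivative
       (\<lambda>w. (\<Sum>j\<in>UNIV. pd j f (x + c t *s axis i 1) * w $ j) * k t)) (at x within U)"
      by (rule has_derivative_mult_left)
    moreover have "(\<lambda>w. (\<Sum>j\<in>UNIV. pd j f (x + c t *s axis i 1) * w $ j) * k t) = blinfun_apply (B x t)"
      by (rule ext) (simp add: B sum_distrib_left sum_distrib_right mult_ac)
    ultimately show "((\<lambda>x. f (x + c t *s axis i 1) * k t) has_derivative blinfun_apply (B x t)) (at x within U)"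
      by simp
  qed
  then have "((\<lambda>x. integral (cbox 0 1) (\<lambda>t. f (x + c t *s axis i 1) * k t)) has_derivative
      blinfun_apply (integral (cbox 0 1) (B x0))) (at x0)"
    by (simp only: at_within_open[OF x0, unfolded U_def] U_def open_ball)
  then have D: "(pd i f has_derivative blinfun_apply (integral (cbox 0 1) (B x0))) (at x0)"
  proof (rule has_derivative_transform_within_open[OF _ open_ball x0[unfolded U_def]])
    fix x assume "x \<in> ball x0 r"
    then show "integral (cbox 0 1) (\<lambda>t. f (x + c t *s axis i 1) * k t) = pd i f x"
      by (rule bspec[OF mem_eq, THEN conjunct2, symmetric])
  qed
  have Bi: "B x0 integrable_on cbox 0 1"
    using slice[OF x0 Bcont] by (intro integrable_continuous) simp
  have ap: "blinfun_apply (integral (cbox 0 1) (B x0)) w = integral (cbox 0 1) (\<lambda>t. blinfun_apply (B x0 t) w)" for w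
    using integral_linear[OF Bi blinfun.bounded_linear_left[of w]] by (simp add: o_def)
  have "blinfun_apply (integral (cbox 0 1) (B x0)) (e *s w) = e * blinfun_apply (integral (cbox 0 1) (B x0)) w" for e w
  proof -
    have "blinfun_apply (B x0 t) (e *s w) = e * blinfun_apply (B x0 t) w" for t
      by (simp add: B sum_distrib_left mult_ac)
    then show ?thesis unfolding ap by simp
  qed
  then show "\<exists>D. (pd i f has_derivative D) (at x0) \<and> (\<forall>c w. D (c *s w) = c * D w)"
    using D by (intro exI[of _ "blinfun_apply (integral (cbox 0 1) (B x0))"]) simp
qed

text \<open>This chart straightens the level sets of \<open>g\<close>.\<close>

lemma level_set_chart:
  fixes g :: "complex^'m \<Rightarrow> complex"
  assumes g: "hol_on g S" and S: "open S" and z: "z \<in> S" and nz: "pd i g z \<noteq> 0"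
  obtains U V \<Psi> where "open U" "z \<in> U" "U \<subseteq> S" "open V"
    "homeomorphism U V (\<lambda>x. setc i (g x) x) \<Psi>"
    "holomorphic_map_on (\<lambda>x. setc i (g x) x) U" "holomorphic_map_on \<Psi> V"
proof -
  let ?\<Phi> = "\<lambda>x. setc i (g x) x"
  define L where "L x w = setc i (\<Sum>k\<in>UNIV. pd k g x * w $ k) w" for x w :: "complex^'m"
  have linL: "linear (L x)" for x
    by (rule linearI) (auto simp: L_def vec_eq_iff algebra_simps sum.distrib scaleR_sum_right)
  define f' where "f' x = Blinfun (L x)" for x
  have f': "blinfun_apply (f' x) = L x" for x
    unfolding f'_def by (rule apply_Blinfun_finite[OF linL])
  have der: "(?\<Phi> has_derivative blinfun_apply (f' x)) (at x)" if "x \<in> S" for x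
  proof (rule has_derivative_vecI)
    fix a
    show "((\<lambda>x. setc i (g x) x $ a) has_derivative (\<lambda>w. blinfun_apply (f' x) w $ a)) (at x)"
      using hol_on_has_derivative[OF g that]
      by (cases "a = i") (auto simp: f' L_def intro: bounded_linear_imp_has_derivative bounded_linear_vec_nth)
  qed
  have cont: "continuous_on S f'"
  proof (rule continuous_on_blinfun_componentwise)
    fix b :: "complex^'m"
    show "continuous_on S (\<lambda>x. blinfun_apply (f' x) b)"
      unfolding f' L_def setc_def
    proof (rule continuous_on_vec_lambda)
      fix a show "continuous_on S (\<lambda>x. if a = i then \<Sum>k\<in>UNIV. pd k g x * b $ k else b $ a)"
        by (cases "a = i") (auto intro!: continuous_intros hol_on_continuous[OF hol_on_pd[OF g S]])
    qed
  qed
  \<comment> \<open>\<open>L z\<close> replaces \<open>w $ i\<close> by the differential of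
    \<open>g\<close> at \<open>w\<close>; solving for \<open>w $ i\<close>, possible as
    \<open>pd i g z\<close> is nonzero, gives the left inverse \<open>R\<close>.\<close>
  define R where "R w = setc i (w $ i / pd i g z - (\<Sum>k\<in>UNIV-{i}. (pd k g z / pd i g z) * w $ k)) w" for w :: "complex^'m"
  have linR: "linear R"
  proof (rule linearI)
    fix u v :: "complex^'m" and r :: real
    show "R (u + v) = R u + R v"
      by (auto simp: R_def vec_eq_iff algebra_simps sum.distrib add_divide_distrib)
    show "R (r *\<^sub>R u) = r *\<^sub>R R u"
      by (auto simp: R_def vec_eq_iff scaleR_right_diff_distrib scaleR_sum_right divide_inverse)
  qed
  have RL: "R (L z w) = w" for w
  proof -
    have "(\<Sum>k\<in>UNIV. pd k g z * w $ k) = pd i g z * w $ i + (\<Sum>k\<in>UNIV-{i}. pd k g z * w $ k)"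
      by (simp add: sum.remove)
    then show ?thesis using nz
      by (auto simp: R_def L_def vec_eq_iff add_divide_distrib sum_divide_distrib)
  qed
  have inv: "Blinfun R o\<^sub>L f' z = id_blinfun"
    by (rule blinfun_eqI) (simp add: f' apply_Blinfun_finite[OF linR] RL)
  obtain U V \<Psi> \<Psi>' where U: "open U" "U \<subseteq> S" "z \<in> U" "open V" "homeomorphism U V ?\<Phi> \<Psi>"
    and \<Psi>: "\<And>y. y \<in> V \<Longrightarrow> (\<Psi> has_derivative (\<Psi>' y)) (at y)"
      "\<And>y. y \<in> V \<Longrightarrow> \<Psi>' y = Hilbert_Choice.inv (blinfun_apply (f' (\<Psi> y)))"
      "\<And>y. y \<in> V \<Longrightarrow> bij (blinfun_apply (f' (\<Psi> y)))"
    by (rule inverse_function_theorem[OF S _ cont z inv], erule der, rule that)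
  have "hol_on (\<lambda>x. \<Psi> x $ a) V" for a
  proof (rule hol_onI)
    fix y assume y: "y \<in> V"
    show "((\<lambda>x. \<Psi> x $ a) has_derivative (\<lambda>w. \<Psi>' y w $ a)) (at y)"
      by (rule bounded_linear.has_derivative[OF bounded_linear_vec_nth \<Psi>(1)[OF y]])
    fix c w
    have b: "bij (L (\<Psi> y))" using \<Psi>(3)[OF y] by (simp add: f')
    \<comment> \<open>The inverse of a complex homogeneous bijection is complex homogeneous; this
      makes \<open>\<Psi>\<close> holomorphic and not merely real differentiable.\<close>
    have "L (\<Psi> y) (c *s v) = c *s L (\<Psi> y) v" for v
      by (auto simp: L_def vec_eq_iff sum_distrib_left mult_ac)
    then have "\<Psi>' y (c *s w) = c *s \<Psi>' y w"
      unfolding \<Psi>(2)[OF y] f' using b by (metis bij_inv_eq_iff)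
    then show "\<Psi>' y (c *s w) $ a = c * \<Psi>' y w $ a" by simp
  qed
  then have "holomorphic_map_on \<Psi> V" by (simp add: holomorphic_map_on_iff)
  moreover have "holomorphic_map_on ?\<Phi> U"
    unfolding holomorphic_map_on_iff
  proof
    fix a show "hol_on (\<lambda>x. setc i (g x) x $ a) U"
      using hol_on_subset[OF g U(2)] by (cases "a = i") auto
  qed
  ultimately show ?thesis using that U by blast
qed

section \<open>Zero sets of holomorphic functions are null sets\<close>

definition pds :: "'m list \<Rightarrow> (complex^'m \<Rightarrow> complex) \<Rightarrow> complex^'m \<Rightarrow> complex" where
  "pds l f = foldr pd l f"

lemma pds_Nil [simp]: "pds [] f = f" and pds_Cons [simp]: "pds (i # l) f = pd i (pds l f)"
  by (simp_all add: pds_def)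

lemma hol_on_pds: "hol_on f S \<Longrightarrow> open S \<Longrightarrow> hol_on (pds l f) S"
  by (induction l) (auto intro: hol_on_pd)

text \<open>The \<open>k\<close>-th derivative in \<open>s\<close> of
  \<open>pds l f (x + s *s u)\<close>, expanded by the chain rule. With the list as an argument each
  differentiation prepends an index, and all values at \<open>s = 0\<close> visibly vanish when all
  \<open>pds l f x\<close> do.\<close>

fun line_deriv :: "complex^'m \<Rightarrow> complex^'m \<Rightarrow> (complex^'m \<Rightarrow> complex) \<Rightarrow> nat \<Rightarrow> 'm list \<Rightarrow> complex \<Rightarrow> complex"
  where
  "line_deriv x u f 0 l s = pds l f (x + s *s u)"
| "line_deriv x u f (Suc k) l s = (\<Sum>a\<in>UNIV. line_deriv x u f k (a # l) s * u $ a)"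

lemma line_deriv_has_derivative:
  assumes "hol_on f S" "open S" "x + s *s u \<in> S"
  shows "(line_deriv x u f k l has_field_derivative line_deriv x u f (Suc k) l s) (at s)"
proof (induction k arbitrary: l)
  case 0
  have "((\<lambda>s. pds l f (x + s *s u)) has_field_derivative
     (\<Sum>a\<in>UNIV. pd a (pds l f) (x + s *s u) * u $ a)) (at s)"
    by (rule hol_on_line[OF hol_on_pds[OF assms(1,2)] assms(3)])
  moreover have "line_deriv x u f 0 l = (\<lambda>s. pds l f (x + s *s u))" by (rule ext) simp
  ultimately show ?case by simp
next
  case (Suc k)
  have "((\<lambda>s. \<Sum>a\<in>UNIV. line_deriv x u f k (a # l) s * u $ a) has_field_derivative
     (\<Sum>a\<in>UNIV. line_deriv x u f (Suc k) (a # l) s * u $ a)) (at s)"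
    by (intro DERIV_sum DERIV_cmult_right Suc)
  moreover have "line_deriv x u f (Suc k) l = (\<lambda>s. \<Sum>a\<in>UNIV. line_deriv x u f k (a # l) s * u $ a)"
    by (rule ext) simp
  ultimately show ?case by simp
qed

text \<open>The derivatives at 0 of the restriction to the line are combinations of iterated partial
  derivatives at \<open>x\<close>, hence zero; the identity theorem on the connected set
  \<open>T\<close> concludes.\<close>

lemma flat_point_line:
  assumes f: "hol_on f S" and S: "open S" and flat: "\<And>l. pds l f x = 0"
    and T: "open T" "connected T" "0 \<in> T" "t \<in> T" and TS: "\<And>s. s \<in> T \<Longrightarrow> x + s *s u \<in> S"
  shows "f (x + t *s u) = 0"
proof -
  have eq: "(deriv ^^ k) (line_deriv x u f 0 []) s = line_deriv x u f k [] s" if "s \<in> T" for k s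
    using that
  proof (induction k arbitrary: s)
    case (Suc k)
    have "((deriv ^^ k) (line_deriv x u f 0 []) has_field_derivative line_deriv x u f (Suc k) [] s) (at s)"
      by (rule has_field_derivative_transform_within_open[OF
            line_deriv_has_derivative[OF f S TS[OF Suc.prems]] T(1) Suc.prems])
        (simp add: Suc.IH)
    then show ?case by (simp only: funpow.simps o_apply DERIV_imp_deriv)
  qed simp
  have zero: "line_deriv x u f k l 0 = 0" for k l
    by (induction k arbitrary: l) (auto simp: flat)
  have hol: "line_deriv x u f 0 [] holomorphic_on T"
    unfolding holomorphic_on_open[OF T(1)]
    using line_deriv_has_derivative[OF f S TS] by blast
  have "line_deriv x u f 0 [] t = 0"
    by (rule holomorphic_fun_eq_0_on_connected[OF hol T(1,2) _ T(3,4)])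
      (simp only: eq[OF T(3)] zero)
  then show ?thesis by simp
qed

text \<open>By \<open>flat_point_line\<close> some index list has a nonzero derivative at
  \<open>x\<close>, while the empty list gives \<open>f x = 0\<close>. The longest suffix of that
  list with zero derivative and the index preceding it are the required pair.\<close>

lemma exists_regular_derivative:
  assumes f: "hol_on f S" and S: "open S" and z: "f x = 0" and nz: "f (x + t *s u) \<noteq> 0"
    and T: "open T" "connected T" "0 \<in> T" "t \<in> T" and TS: "\<And>s. s \<in> T \<Longrightarrow> x + s *s u \<in> S"
  shows "\<exists>l i. pds l f x = 0 \<and> pd i (pds l f) x \<noteq> 0"
proof -
  have "\<exists>l. pds l f x \<noteq> 0"
    using flat_point_line[OF f S _ T TS] nz by blast
  then obtain l where l: "pds l f x \<noteq> 0" by blast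
  from l z show ?thesis
  proof (induction l)
    case (Cons i l)
    then show ?case by (cases "pds l f x = 0") auto
  qed simp
qed

text \<open>Convexity of \<open>S\<close> makes the set of parameters for which the line stays in
  \<open>S\<close> convex, hence connected.\<close>

lemma exists_regular_derivative_convex:
  assumes f: "hol_on f S" and S: "open S" "convex S" and x: "x \<in> S" "f x = 0" and y: "y \<in> S" "f y \<noteq> 0"
  shows "\<exists>l i. pds l f x = 0 \<and> pd i (pds l f) x \<noteq> 0"
proof -
  define T where "T = (\<lambda>s. x + s *s (y - x)) -` S"
  have "open T"
    unfolding T_def by (rule open_vimage[OF S(1)]) (intro continuous_intros)
  moreover have "convex T"
  proof (rule convexI)
    fix a b :: complex and u v :: real
    assume *: "a \<in> T" "b \<in> T" "0 \<le> u" "0 \<le> v" "u + v = 1"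
    have "x + (u *\<^sub>R a + v *\<^sub>R b) *s (y - x) = u *\<^sub>R (x + a *s (y - x)) + v *\<^sub>R (x + b *s (y - x))"
    proof -
      have "u *\<^sub>R x + v *\<^sub>R x = x" using *(5) by (metis scaleR_add_left scaleR_one)
      moreover have "u *\<^sub>R (x + a *s (y - x)) + v *\<^sub>R (x + b *s (y - x)) =
          (u *\<^sub>R x + v *\<^sub>R x) + (u *\<^sub>R a + v *\<^sub>R b) *s (y - x)"
        by (simp add: vec_eq_iff algebra_simps)
      ultimately show ?thesis by simp
    qed
    then show "u *\<^sub>R a + v *\<^sub>R b \<in> T"
      using convexD[OF S(2), of "x + a *s (y - x)" "x + b *s (y - x)" u v] * by (simp add: T_def)
  qed
  ultimately show ?thesis
    using x y by (intro exists_regular_derivative[OF f S(1) x(2), of 1 "y - x" T])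
      (auto simp: T_def convex_connected)
qed

lemma negligible_UN_countable:
  assumes "countable I" "\<And>i. i \<in> I \<Longrightarrow> negligible (A i)"
  shows "negligible (\<Union>i\<in>I. A i)"
  by (rule negligible_countable_Union) (use assms in auto)

lemma countable_UNIV_lists: "countable (UNIV :: ('m::finite) list set)"
  using countable_lists[of "UNIV :: 'm set"] by (simp add: countable_finite)

lemma negligible_coordinate_hyperplane: "negligible {y :: complex^'m. y $ i = 0}"
proof (rule negligible_subset)
  show "negligible {y :: complex^'m. axis i 1 \<bullet> y = 0}"
    by (rule negligible_hyperplane) (simp add: axis_eq_0_iff)
  show "{y :: complex^'m. y $ i = 0} \<subseteq> {y. axis i 1 \<bullet> y = 0}"
    by (auto simp: inner_axis')
qed

lemma holomorphic_map_on_differentiable: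
  assumes "holomorphic_map_on \<Psi> V" "S \<subseteq> V" shows "\<Psi> differentiable_on S"
  unfolding differentiable_on_def
proof
  fix x assume "x \<in> S"
  then obtain J where "(\<Psi> has_derivative (\<lambda>w. J *v w)) (at x)"
    using assms unfolding holomorphic_map_on_def by blast
  then show "\<Psi> differentiable at x within S"
    using differentiable_def has_derivative_at_withinI by blast
qed

text \<open>A straightening chart carries the zeros near \<open>z\<close> into a coordinate
  hyperplane, and its differentiable inverse preserves null sets.\<close>

lemma negligible_regular_zeros:
  fixes g :: "complex^'m \<Rightarrow> complex"
  assumes g: "hol_on g S" and S: "open S"
  shows "negligible {x \<in> S. g x = 0 \<and> pd i g x \<noteq> 0}" (is "negligible ?Z")
  unfolding locally_negligible_alt[of ?Z]
proof
  fix z assume z: "z \<in> ?Z"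
  then have "z \<in> S" "pd i g z \<noteq> 0" by auto
  then obtain U V \<Psi> where *: "open U" "z \<in> U" "U \<subseteq> S" "open V"
    "homeomorphism U V (\<lambda>x. setc i (g x) x) \<Psi>" "holomorphic_map_on \<Psi> V"
    by (rule level_set_chart[OF g S]) (rule that)
  have "negligible (\<Psi> ` ({y. y $ i = 0} \<inter> V))"
    by (rule negligible_differentiable_image_negligible)
      (auto intro: negligible_coordinate_hyperplane negligible_Int holomorphic_map_on_differentiable[OF *(6)])
  moreover have "?Z \<inter> U \<subseteq> \<Psi> ` ({y. y $ i = 0} \<inter> V)"
  proof
    fix x assume x: "x \<in> ?Z \<inter> U"
    have xU: "x \<in> U" using x by simp
    have "x = \<Psi> (setc i (g x) x)" "setc i (g x) x \<in> V"
      using homeomorphism_apply1[OF *(5) xU] homeomorphism_image1[OF *(5)] xU by auto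
    moreover have "setc i (g x) x \<in> {y. y $ i = 0}" using x by simp
    ultimately show "x \<in> \<Psi> ` ({y. y $ i = 0} \<inter> V)" by blast
  qed
  ultimately have "negligible (?Z \<inter> U)" by (rule negligible_subset)
  moreover have "openin (top_of_set ?Z) (?Z \<inter> U)"
    by (rule openin_open_Int[OF *(1)])
  ultimately show "\<exists>U. openin (top_of_set ?Z) U \<and> z \<in> U \<and> negligible U"
    using z *(2) by blast
qed

lemma negligible_zeros:
  fixes f :: "complex^'m \<Rightarrow> complex"
  assumes f: "hol_on f S" and S: "open S" "convex S" and y: "y \<in> S" "f y \<noteq> 0"
  shows "negligible {x \<in> S. f x = 0}"
proof (rule negligible_subset)
  show "negligible (\<Union>p\<in>UNIV. {x \<in> S. pds (fst p) f x = 0 \<and> pd (snd p) (pds (fst p) f) x \<noteq> 0})"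
  proof (rule negligible_UN_countable)
    show "countable (UNIV :: ('m list \<times> 'm) set)"
      unfolding UNIV_Times_UNIV[symmetric]
      by (intro countable_SIGMA countable_UNIV_lists countable_finite) simp
  qed (intro negligible_regular_zeros hol_on_pds f S)
  show "{x \<in> S. f x = 0} \<subseteq> (\<Union>p\<in>UNIV. {x \<in> S. pds (fst p) f x = 0 \<and> pd (snd p) (pds (fst p) f) x \<noteq> 0})"
  proof
    fix x assume x: "x \<in> {x \<in> S. f x = 0}"
    then obtain l i where "pds l f x = 0" "pd i (pds l f) x \<noteq> 0"
      using exists_regular_derivative_convex[OF f S _ _ y] by blast
    then show "x \<in> (\<Union>p\<in>UNIV. {x \<in> S. pds (fst p) f x = 0 \<and> pd (snd p) (pds (fst p) f) x \<noteq> 0})"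
      using x by (intro UN_I[of "(l, i)"]) auto
  qed
qed

section \<open>Null sets of matrices\<close>

lemma hol_on_field_compose:
  assumes f: "hol_on f S" and g: "\<And>x. x \<in> S \<Longrightarrow> g field_differentiable (at (f x))"
  shows "hol_on (\<lambda>x. g (f x)) S"
  unfolding hol_on_def
proof
  fix x assume x: "x \<in> S"
  obtain D where D: "(f has_derivative D) (at x)" "\<And>c w. D (c *s w) = c * D w"
    using f x unfolding hol_on_def by blast
  obtain g' where "(g has_field_derivative g') (at (f x))"
    using g[OF x] unfolding field_differentiable_def by blast
  then have "(g has_derivative (\<lambda>h. g' * h)) (at (f x))"
    by (simp add: has_field_derivative_def)
  from has_derivative_compose[OF D(1) this]
  show "\<exists>D. ((\<lambda>x. g (f x)) has_derivative D) (at x) \<and> (\<forall>c w. D (c *s w) = c * D w)"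
    by (intro exI[of _ "\<lambda>w. g' * D w"] conjI) (auto simp: D(2))
qed

lemma hol_on_divide:
  assumes "hol_on f S" "hol_on g S" "\<And>x. x \<in> S \<Longrightarrow> g x \<noteq> 0"
  shows "hol_on (\<lambda>x. f x / g x) S"
proof -
  have "hol_on (\<lambda>x. inverse (g x)) S"
    by (rule hol_on_field_compose[OF assms(2)])
       (auto intro!: field_differentiable_inverse field_differentiable_ident assms(3))
  from hol_on_mult[OF assms(1) this] show ?thesis by (simp add: divide_inverse)
qed

lemma differentiable_on_matrixI:
  fixes f :: "complex^'m \<Rightarrow> complex^'k^'l"
  assumes "\<And>r c. hol_on (\<lambda>x. f x $ r $ c) S"
  shows "f differentiable_on S"
  unfolding differentiable_on_def
proof
  fix x assume x: "x \<in> S"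
  let ?D = "\<lambda>w. \<chi> r c. \<Sum>i\<in>UNIV. pd i (\<lambda>x. f x $ r $ c) x * w $ i"
  have "(f has_derivative ?D) (at x within S)"
  proof (rule has_derivative_vecI)
    fix r
    show "((\<lambda>x. f x $ r) has_derivative (\<lambda>w. ?D w $ r)) (at x within S)"
    proof (rule has_derivative_vecI)
      fix c
      show "((\<lambda>x. f x $ r $ c) has_derivative (\<lambda>w. ?D w $ r $ c)) (at x within S)"
        using has_derivative_at_withinI[OF hol_on_has_derivative[OF assms x]] by simp
    qed
  qed
  then show "f differentiable at x within S" unfolding differentiable_def by blast
qed

text \<open>Parameter matrices are stored as vectors indexed by pairs, so that \<open>hol_on\<close>
  applies to functions of them; equality of dimensions is the condition under which differentiable
  images of null sets are null.\<close>

lemma DIM_matrix_pairs: "DIM(complex^('n \<times> 'n)) = DIM(complex^'n^'n)"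
  by (simp add: DIM_cart card_cartesian_product UNIV_Times_UNIV[symmetric] del: UNIV_Times_UNIV)

text \<open>A matrix sending \<open>\<gamma> s\<close> to \<open>\<Psi> y\<close> is determined by \<open>s\<close>, \<open>y\<close> and its columns other than the \<open>j\<close>-th.
  The parameters \<open>(s, y)\<close> with \<open>y $ i = 0\<close> are stored in the \<open>j\<close>-th column of the parameter matrix.\<close>

lemma negligible_matrices_hitting:
  fixes \<gamma> :: "complex \<Rightarrow> complex^'n" and \<Psi> :: "complex^'n \<Rightarrow> complex^'n"
  assumes \<gamma>: "\<And>s c. s \<in> D \<Longrightarrow> (\<lambda>s. \<gamma> s $ c) field_differentiable (at s)"
    and \<Psi>: "holomorphic_map_on \<Psi> B" and B: "open B" "convex B" and h: "hol_on h B"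
    and y0: "y0 \<in> B" "y0 $ i = 0" "h y0 \<noteq> 0"
  shows "negligible {H :: complex^'n^'n. \<exists>s\<in>D. \<gamma> s $ j \<noteq> 0 \<and>
    (\<exists>y\<in>B. y $ i = 0 \<and> h y = 0 \<and> H *v \<gamma> s = \<Psi> y)}" (is "negligible ?E")
proof -
  define Y where "Y M = (\<chi> r. if r = i then 0 else M $ (r, j))" for M :: "complex^('n \<times> 'n)"
  \<comment> \<open>Without \<open>h (Y M) = 0\<close> there would be as many parameters as
    matrices; this equation makes \<open>Z\<close> a null set.\<close>
  define Z where "Z = {M. Y M \<in> B \<and> h (Y M) = 0 \<and> M $ (i, j) \<in> D \<and> \<gamma> (M $ (i, j)) $ j \<noteq> 0}"
  \<comment> \<open>The \<open>j\<close>-th column is recovered by solving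
    \<open>H *v \<gamma> s = \<Psi> y\<close>, which requires division by
    \<open>\<gamma> s $ j\<close>.\<close>
  define f :: "complex^('n \<times> 'n) \<Rightarrow> complex^'n^'n" where
    "f M = (\<chi> r c. if c = j then (\<Psi> (Y M) $ r - (\<Sum>c\<in>UNIV-{j}. M $ (r, c) * \<gamma> (M $ (i, j)) $ c)) / \<gamma> (M $ (i, j)) $ j
       else M $ (r, c))" for M
  have Ynth: "Y M $ r = (if r = i then 0 else M $ (r, j))" for M r by (simp add: Y_def)
  have Yhol: "hol_on (\<lambda>M. Y M $ r) T" for r T
    unfolding Ynth by (cases "r = i") auto
  have Ylin: "linear Y"
    by (rule linearI) (auto simp: Y_def vec_eq_iff)
  have neg: "negligible {M \<in> Y -` B. h (Y M) = 0}"
  proof (rule negligible_zeros)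
    show "hol_on (\<lambda>M. h (Y M)) (Y -` B)"
      by (rule hol_on_compose[OF h Yhol]) auto
    show "open (Y -` B)"
      by (rule open_vimage[OF B(1) linear_continuous_on[OF linear_conv_bounded_linear[THEN iffD1, OF Ylin]]])
    show "convex (Y -` B)" by (rule convex_linear_vimage[OF Ylin B(2)])
    have "Y (\<chi> p. y0 $ fst p) = y0" using y0(2) by (auto simp: Y_def vec_eq_iff)
    then show "(\<chi> p. y0 $ fst p) \<in> Y -` B" "h (Y (\<chi> p. y0 $ fst p)) \<noteq> 0" using y0 by auto
  qed
  have "negligible Z"
    by (rule negligible_subset[OF neg]) (auto simp: Z_def)
  moreover have "f differentiable_on Z"
  proof (rule differentiable_on_matrixI)
    fix r c
    have 1: "hol_on (\<lambda>M. \<gamma> (M $ (i, j)) $ c) Z" for c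
      by (rule hol_on_field_compose[OF hol_on_nth, of Z "\<lambda>s. \<gamma> s $ c"]) (auto simp: Z_def intro: \<gamma>)
    have 2: "hol_on (\<lambda>M. \<Psi> (Y M) $ r) Z"
      by (rule hol_on_compose[OF _ Yhol, of "\<lambda>y. \<Psi> y $ r" B]) (use \<Psi> in \<open>auto simp: holomorphic_map_on_iff Z_def\<close>)
    show "hol_on (\<lambda>M. f M $ r $ c) Z"
    proof (cases "c = j")
      case True
      have "hol_on (\<lambda>M. (\<Psi> (Y M) $ r - (\<Sum>c\<in>UNIV-{j}. M $ (r, c) * \<gamma> (M $ (i, j)) $ c)) / \<gamma> (M $ (i, j)) $ j) Z"
        by (rule hol_on_divide[OF hol_on_diff[OF 2 hol_on_sum[OF hol_on_mult[OF hol_on_nth 1]]] 1]) (auto simp: Z_def)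
      then show ?thesis using True by (simp add: f_def)
    qed (simp add: f_def)
  qed
  ultimately have "negligible (f ` Z)"
    by (intro negligible_differentiable_image_negligible) (simp_all only: DIM_matrix_pairs order_refl)
  moreover have "?E \<subseteq> f ` Z"
  proof
    fix H assume "H \<in> ?E"
    then obtain s y where *: "s \<in> D" "\<gamma> s $ j \<noteq> 0" "y \<in> B" "y $ i = 0" "h y = 0" "H *v \<gamma> s = \<Psi> y"
      by blast
    define M :: "complex^('n \<times> 'n)" where
      "M = (\<chi> p. if snd p = j then (if fst p = i then s else y $ fst p) else H $ fst p $ snd p)"
    have Y: "Y M = y" using *(4) by (auto simp: Y_def M_def vec_eq_iff)
    have s: "M $ (i, j) = s" by (simp add: M_def)
    have "M \<in> Z" using * by (simp add: Z_def Y s)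
    moreover have "f M = H"
    proof -
      have "\<Psi> y $ r = H $ r $ j * \<gamma> s $ j + (\<Sum>c\<in>UNIV-{j}. H $ r $ c * \<gamma> s $ c)" for r
        unfolding *(6)[symmetric] matrix_vector_mult_def by (simp add: sum.remove[of _ j])
      moreover have "(\<Sum>c\<in>UNIV-{j}. M $ (r, c) * \<gamma> s $ c) = (\<Sum>c\<in>UNIV-{j}. H $ r $ c * \<gamma> s $ c)" for r
        by (rule sum.cong) (auto simp: M_def)
      ultimately show ?thesis
        using *(2) by (auto simp: f_def Y s vec_eq_iff) (auto simp: M_def)
    qed
    ultimately show "H \<in> f ` Z" by blast
  qed
  ultimately show ?thesis by (rule negligible_subset)
qed

text \<open>A matrix \<open>H\<close> with \<open>H\<^sup>T A(H p) = c G(p)\<close> and \<open>A(H p)\<^sub>i \<noteq> 0\<close> is determined by \<open>p = \<gamma> s\<close>, \<open>c\<close>, the \<open>i\<close>-th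
  coordinate of \<open>H p\<close> and its rows other than the \<open>i\<close>-th. These three numbers are stored in three of
  the at least four entries of the \<open>i\<close>-th row of the parameter matrix.\<close>

lemma negligible_matrices_tangent:
  fixes \<gamma> :: "complex \<Rightarrow> complex^'n" and A G :: "complex^'n \<Rightarrow> complex^'n"
  assumes card: "CARD('n) \<ge> 4"
    and \<gamma>: "\<And>s c. s \<in> D \<Longrightarrow> (\<lambda>s. \<gamma> s $ c) field_differentiable (at s)"
    and A: "\<And>a. hol_on (\<lambda>v. A v $ a) (- {0})" and G: "\<And>a. hol_on (\<lambda>v. G v $ a) UNIV"
  shows "negligible {H :: complex^'n^'n. \<exists>s\<in>D. H *v \<gamma> s \<noteq> 0 \<and> A (H *v \<gamma> s) $ i \<noteq> 0 \<and>
    (\<exists>c. transpose H *v A (H *v \<gamma> s) = c *s G (\<gamma> s))}" (is "negligible ?E")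
proof -
  obtain J :: "'n set" where J: "card J = 4" "finite J"
    using card obtain_subset_with_card_n[of 4 "UNIV :: 'n set"] by (metis finite_subset subset_UNIV finite)
  then obtain j1 j2 j3 j4 :: 'n where j: "distinct [j1, j2, j3, j4]"
    by (auto simp: card_Suc_eq numeral_eq_Suc)
  define s where "s M = M $ (i, j1)" for M :: "complex^('n \<times> 'n)"
  \<comment> \<open>The image point \<open>H *v \<gamma> s\<close>. Its \<open>i\<close>-th
    coordinate would involve the row still to be found, so it is a parameter of its own.\<close>
  define q where "q M = (\<chi> a. if a = i then M $ (i, j3) else \<Sum>b\<in>UNIV. M $ (a, b) * \<gamma> (s M) $ b)" for M :: "complex^('n \<times> 'n)"
  \<comment> \<open>A fourth entry of the \<open>i\<close>-th row is left over; fixing it at 0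
    confines the parameters to a hyperplane. This is where \<open>CARD('n) \<ge> 4\<close>
    enters.\<close>
  define Z where "Z = {M. s M \<in> D \<and> q M \<noteq> 0 \<and> A (q M) $ i \<noteq> 0 \<and> M $ (i, j4) = 0}"
  \<comment> \<open>The \<open>i\<close>-th row is recovered from the transposed equation, dividing
    by the \<open>i\<close>-th coefficient of \<open>A\<close> at the image point.\<close>
  define f :: "complex^('n \<times> 'n) \<Rightarrow> complex^'n^'n" where
    "f M = (\<chi> r b. if r = i then (M $ (i, j2) * G (\<gamma> (s M)) $ b - (\<Sum>a\<in>UNIV-{i}. M $ (a, b) * A (q M) $ a)) / A (q M) $ i
       else M $ (r, b))" for M
  have "negligible Z"
    by (rule negligible_subset[OF negligible_coordinate_hyperplane[of "(i, j4)"]]) (auto simp: Z_def)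
  moreover have "f differentiable_on Z"
  proof (rule differentiable_on_matrixI)
    fix r b
    have 1: "hol_on (\<lambda>M. \<gamma> (s M) $ c) Z" for c
      unfolding s_def
      by (rule hol_on_field_compose[OF hol_on_nth, of Z "\<lambda>s. \<gamma> s $ c"]) (auto simp: Z_def s_def intro: \<gamma>)
    have 2: "hol_on (\<lambda>M. q M $ a) Z" for a
    proof (cases "a = i")
      case False
      have "hol_on (\<lambda>M. \<Sum>b\<in>UNIV. M $ (a, b) * \<gamma> (s M) $ b) Z"
        by (intro hol_on_sum hol_on_mult hol_on_nth 1)
      then show ?thesis using False by (simp add: q_def)
    qed (simp add: q_def)
    have 3: "hol_on (\<lambda>M. A (q M) $ a) Z" for a
      by (rule hol_on_compose[OF A 2]) (auto simp: Z_def)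
    have 4: "hol_on (\<lambda>M. G (\<gamma> (s M)) $ b) Z"
      by (rule hol_on_compose[OF G 1]) auto
    show "hol_on (\<lambda>M. f M $ r $ b) Z"
    proof (cases "r = i")
      case True
      have "hol_on (\<lambda>M. (M $ (i, j2) * G (\<gamma> (s M)) $ b - (\<Sum>a\<in>UNIV-{i}. M $ (a, b) * A (q M) $ a)) / A (q M) $ i) Z"
        by (rule hol_on_divide[OF hol_on_diff[OF hol_on_mult[OF hol_on_nth 4] hol_on_sum[OF hol_on_mult[OF hol_on_nth 3]]] 3])
           (auto simp: Z_def)
      then show ?thesis using True by (simp add: f_def)
    qed (simp add: f_def)
  qed
  ultimately have "negligible (f ` Z)"
    by (intro negligible_differentiable_image_negligible) (simp_all only: DIM_matrix_pairs order_refl)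
  moreover have "?E \<subseteq> f ` Z"
  proof
    fix H assume "H \<in> ?E"
    then obtain t c where *: "t \<in> D" "H *v \<gamma> t \<noteq> 0" "A (H *v \<gamma> t) $ i \<noteq> 0"
       "transpose H *v A (H *v \<gamma> t) = c *s G (\<gamma> t)"
      by blast
    define M :: "complex^('n \<times> 'n)" where
      "M = (\<chi> p. if fst p = i then (if snd p = j1 then t else if snd p = j2 then c else if snd p = j3 then (H *v \<gamma> t) $ i else 0)
        else H $ fst p $ snd p)"
    have s: "s M = t" by (simp add: s_def M_def)
    have q: "q M = H *v \<gamma> t"
      using j by (auto simp: q_def s vec_eq_iff) (auto simp: M_def matrix_vector_mult_def)
    have M2: "M $ (i, j2) = c" "M $ (i, j4) = 0" using j by (auto simp: M_def)
    have "M \<in> Z" using * by (simp add: Z_def q s M2)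
    moreover have "f M = H"
    proof -
      have "c * G (\<gamma> t) $ b = H $ i $ b * A (q M) $ i + (\<Sum>a\<in>UNIV-{i}. H $ a $ b * A (q M) $ a)" for b
      proof -
        have "c * G (\<gamma> t) $ b = (transpose H *v A (H *v \<gamma> t)) $ b" unfolding *(4) by simp
        also have "\<dots> = (\<Sum>a\<in>UNIV. H $ a $ b * A (q M) $ a)"
          by (simp add: matrix_vector_mult_def transpose_def q[unfolded matrix_vector_mult_def])
        finally show ?thesis by (simp add: sum.remove[of _ i])
      qed
      moreover have "(\<Sum>a\<in>UNIV-{i}. M $ (a, b) * A (q M) $ a) = (\<Sum>a\<in>UNIV-{i}. H $ a $ b * A (q M) $ a)" for b
        by (rule sum.cong) (auto simp: M_def)
      moreover have "A (q M) $ i \<noteq> 0" using *(3) by (simp add: q)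
      ultimately show ?thesis
        by (auto simp: f_def s M2 vec_eq_iff) (auto simp: M_def)
    qed
    ultimately show "H \<in> f ` Z" by blast
  qed
  ultimately show ?thesis by (rule negligible_subset)
qed

section \<open>Regular hypersurfaces and the singular set\<close>

lemma proj_cone_of_cone:
  assumes "\<And>c v. v \<in> C \<Longrightarrow> c \<noteq> 0 \<Longrightarrow> c *s v \<in> C" "0 \<notin> C"
  shows "proj_cone {proj_point v | v. v \<in> C} = C"
proof
  show "C \<subseteq> proj_cone {proj_point v | v. v \<in> C}"
    using assms(2) by (auto simp: proj_cone_def)
  show "proj_cone {proj_point v | v. v \<in> C} \<subseteq> C"
  proof
    fix v assume "v \<in> proj_cone {proj_point v | v. v \<in> C}"
    then obtain u where u: "v \<noteq> 0" "u \<in> C" "proj_point v = proj_point u"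
      by (auto simp: proj_cone_def)
    then have "u \<noteq> 0" using assms(2) by auto
    then obtain c where "v = c *s u"
      using u proj_point_eq_iff[of u v] by auto
    then show "v \<in> C" using u assms(1) by auto
  qed
qed

lemma open_punctured: "open (- {0 :: complex^'n})"
  by (simp add: open_Compl)

lemma vec_dim_coordinate_hyperplane: "vec.dim {x :: complex^'n. x $ i = 0} = CARD('n) - 1"
proof -
  have "{x :: complex^'n. \<forall>j. j \<notin> UNIV - {i} \<longrightarrow> x $ j = 0} = {x. x $ i = 0}" by auto
  with dim_substandard_cart[of "UNIV - {i}", where 'a = complex] show ?thesis by simp
qed

lemma vec_subspace_coordinate_hyperplane: "vec.subspace {x :: complex^'n. x $ i = 0}"
  by (rule vec.subspaceI) auto

text \<open>Supplies the submanifolds of codimension one on which \<open>codim_at_least 2\<close> is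
  tested. As \<open>C\<close> is a cone, the zero set is invariant under scaling and is the full
  punctured cone over its image; the level set chart straightens it.\<close>

lemma regular_cone_submanifold:
  fixes g :: "complex^'n \<Rightarrow> complex"
  assumes C: "open C" "0 \<notin> C" "\<And>c v. v \<in> C \<Longrightarrow> c \<noteq> 0 \<Longrightarrow> c *s v \<in> C"
    and g: "hol_on g C" "\<And>c v. v \<in> C \<Longrightarrow> c \<noteq> 0 \<Longrightarrow> g v = 0 \<Longrightarrow> g (c *s v) = 0"
    and reg: "\<And>v. v \<in> C \<Longrightarrow> g v = 0 \<Longrightarrow> pd i g v \<noteq> 0" and card: "CARD('n) \<ge> 2"
  shows "proj_submanifold (CARD('n) - 2) {proj_point v | v. v \<in> {v \<in> C. g v = 0}}"
proof -
  have cone: "proj_cone {proj_point v | v. v \<in> {v \<in> C. g v = 0}} = {v \<in> C. g v = 0}"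
    by (rule proj_cone_of_cone) (use C g in auto)
  have dims: "CARD('n) - 2 + 1 = CARD('n) - 1" using card by simp
  show ?thesis
    unfolding proj_submanifold_def cone complex_submanifold_def dims
  proof
    fix a assume a: "a \<in> {v \<in> C. g v = 0}"
    then have "a \<in> C" "pd i g a \<noteq> 0" using reg by auto
    then obtain U V \<Psi> where *: "open U" "a \<in> U" "U \<subseteq> C" "open V"
      "homeomorphism U V (\<lambda>x. setc i (g x) x) \<Psi>"
      "holomorphic_map_on (\<lambda>x. setc i (g x) x) U" "holomorphic_map_on \<Psi> V"
      by (rule level_set_chart[OF g(1) C(1)]) (rule that)
    have im: "(\<lambda>x. setc i (g x) x) ` ({v \<in> C. g v = 0} \<inter> U) = {x. x $ i = 0} \<inter> V"
    proof
      show "(\<lambda>x. setc i (g x) x) ` ({v \<in> C. g v = 0} \<inter> U) \<subseteq> {x. x $ i = 0} \<inter> V"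
      proof
        fix y assume "y \<in> (\<lambda>x. setc i (g x) x) ` ({v \<in> C. g v = 0} \<inter> U)"
        then obtain x where x: "x \<in> C" "g x = 0" "x \<in> U" "y = setc i (g x) x" by blast
        have "y \<in> V" unfolding x(4) homeomorphism_image1[OF *(5), symmetric] using x(3) by blast
        then show "y \<in> {x. x $ i = 0} \<inter> V" using x(2,4) by simp
      qed
      show "{x. x $ i = 0} \<inter> V \<subseteq> (\<lambda>x. setc i (g x) x) ` ({v \<in> C. g v = 0} \<inter> U)"
      proof
        fix y assume y: "y \<in> {x. x $ i = 0} \<inter> V"
        then have yV: "y \<in> V" by simp
        have e: "setc i (g (\<Psi> y)) (\<Psi> y) = y" by (rule homeomorphism_apply2[OF *(5) yV])
        have u: "\<Psi> y \<in> U" using homeomorphism_image2[OF *(5)] yV by blast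
        have "g (\<Psi> y) = setc i (g (\<Psi> y)) (\<Psi> y) $ i" by (simp only: setc_nth if_True simp_thms)
        then have "g (\<Psi> y) = 0" using y e by simp
        then have "\<Psi> y \<in> {v \<in> C. g v = 0} \<inter> U" using u *(3) by auto
        then show "y \<in> (\<lambda>x. setc i (g x) x) ` ({v \<in> C. g v = 0} \<inter> U)"
          by (rule rev_image_eqI) (rule e[symmetric])
      qed
    qed
    show "\<exists>U (V :: (complex^'n) set) \<Phi> \<Psi> W. open U \<and> a \<in> U \<and> open V \<and> homeomorphism U V \<Phi> \<Psi> \<and>
      holomorphic_map_on \<Phi> U \<and> holomorphic_map_on \<Psi> V \<and> vec.subspace W \<and> vec.dim W = CARD('n) - 1 \<and>
      \<Phi> ` ({v \<in> C. g v = 0} \<inter> U) = W \<inter> V"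
      by (rule exI[of _ U], rule exI[of _ V], rule exI[of _ "\<lambda>x. setc i (g x) x"], rule exI[of _ \<Psi>],
          rule exI[of _ "{x. x $ i = 0}"])
        (intro conjI * im vec_subspace_coordinate_hyperplane vec_dim_coordinate_hyperplane)
  qed
qed

text \<open>Differentiate \<open>g (c *s (v + s *s axis i 1))\<close> at \<open>s = 0\<close> in two
  ways. Degrees are integers because repeated differentiation may make them negative.\<close>

lemma pd_homogeneous:
  fixes g :: "complex^'n \<Rightarrow> complex"
  assumes g: "hol_on g (- {0})"
    and hom: "\<And>c v. c \<noteq> 0 \<Longrightarrow> v \<noteq> 0 \<Longrightarrow> g (c *s v) = c powi e * g v"
    and c: "c \<noteq> 0" and v: "v \<noteq> 0"
  shows "pd i g (c *s v) = c powi (e - 1) * pd i g v"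
proof -
  have "((\<lambda>s. g (c *s (v + s *s axis i 1))) has_field_derivative
      (\<Sum>a\<in>UNIV. pd a g (c *s (v + 0 *s axis i 1)) * (c * axis i 1 $ a))) (at 0)"
    by (rule hol_on_chain_1[OF g]) (use c v in \<open>auto intro!: derivative_eq_intros simp: vec_eq_iff\<close>)
  moreover have "(\<Sum>a\<in>UNIV. pd a g (c *s (v + 0 *s axis i 1)) * (c * axis i 1 $ a)) = c * pd i g (c *s v)"
  proof -
    have "(\<Sum>a\<in>UNIV. pd a g (c *s (v + 0 *s axis i 1)) * (c * axis i 1 $ a))
      = (\<Sum>a\<in>UNIV. if a = i then c * pd i g (c *s v) else 0)"
      by (rule sum.cong) (auto simp: axis_def)
    then show ?thesis by simp
  qed
  ultimately have 1: "((\<lambda>s. g (c *s (v + s *s axis i 1))) has_field_derivative c * pd i g (c *s v)) (at 0)"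
    by simp
  have 2: "((\<lambda>s. c powi e * g (v + s *s axis i 1)) has_field_derivative c powi e * pd i g v) (at 0)"
    by (rule DERIV_cmult[OF pd_eq_deriv_line[OF g]]) (use v in simp)
  let ?T = "(\<lambda>s. v + s *s axis i 1) -` (- {0})"
  have T: "open ?T" by (rule open_vimage) (auto intro!: continuous_intros)
  have "((\<lambda>s. g (c *s (v + s *s axis i 1))) has_field_derivative c powi e * pd i g v) (at 0)"
  proof (rule has_field_derivative_transform_within_open[OF 2 T])
    show "0 \<in> ?T" using v by simp
    fix s assume "s \<in> ?T"
    then have "v + s *s axis i 1 \<noteq> 0" by simp
    then show "c powi e * g (v + s *s axis i 1) = g (c *s (v + s *s axis i 1))"
      by (rule hom[OF c, symmetric])
  qed
  from DERIV_unique[OF 1 this] have "c * pd i g (c *s v) = c powi e * pd i g v" .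
  then have "c * pd i g (c *s v) = c * (c powi (e - 1) * pd i g v)"
    using c by (simp add: power_int_diff)
  then show ?thesis using c by simp
qed

lemma pds_homogeneous:
  fixes g :: "complex^'n \<Rightarrow> complex"
  assumes g: "hol_on g (- {0})"
    and hom: "\<And>c v. c \<noteq> 0 \<Longrightarrow> v \<noteq> 0 \<Longrightarrow> g (c *s v) = c powi e * g v"
    and "c \<noteq> 0" "v \<noteq> 0"
  shows "pds l g (c *s v) = c powi (e - int (length l)) * pds l g v"
  using assms(3,4)
proof (induction l arbitrary: c v)
  case (Cons i l)
  show ?case
    using pd_homogeneous[OF hol_on_pds[OF g] _ Cons.prems, of l "e - int (length l)" i] Cons.IH
    by (simp add: algebra_simps open_Compl)
qed (simp add: hom)

text \<open>If \<open>A\<close> vanished at all these zeros near \<open>z\<close>, their saturation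
  under scaling would contain a hypersurface inside the singular set. So some coefficient of
  \<open>A\<close> yields a second equation that is not identically satisfied on the
  hypersurface.\<close>

lemma sing_set_no_regular_hypersurface:
  fixes A :: "complex^'n \<Rightarrow> complex^'n"
  assumes A: "twisted_form k A" and codim: "codim_at_least 2 (CARD('n) - 1) (sing_set A)"
    and card: "CARD('n) \<ge> 2" and N: "open N" "z \<in> N" and z: "z \<noteq> 0"
    and reg: "pds l (\<lambda>v. A v $ a) z = 0" "pd i (pds l (\<lambda>v. A v $ a)) z \<noteq> 0"
  shows "\<exists>x\<in>N. x \<noteq> 0 \<and> pds l (\<lambda>v. A v $ a) x = 0 \<and> A x \<noteq> 0"
proof (rule ccontr)
  assume "\<not> ?thesis"
  then have contr: "A x = 0" if "x \<in> N" "x \<noteq> 0" "pds l (\<lambda>v. A v $ a) x = 0" for x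
    using that by blast
  define g where "g = pds l (\<lambda>v. A v $ a)"
  define e where "e = k - 1 - int (length l)"
  have Ahol: "hol_on (\<lambda>v. A v $ a) (- {0})"
    using A by (simp add: twisted_form_def holomorphic_map_on_iff)
  have Ahom: "A (c *s v) = (c powi (k - 1)) *s A v" if "c \<noteq> 0" "v \<noteq> 0" for c v
    using A that by (simp add: twisted_form_def)
  have ghol: "hol_on g (- {0})" unfolding g_def by (rule hol_on_pds[OF Ahol]) (simp add: open_Compl)
  have ghom: "g (c *s v) = c powi e * g v" if "c \<noteq> 0" "v \<noteq> 0" for c v
    unfolding g_def e_def by (rule pds_homogeneous[OF Ahol _ that]) (simp add: Ahom)
  have pghom: "pd i g (c *s v) = c powi (e - 1) * pd i g v" if "c \<noteq> 0" "v \<noteq> 0" for c v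
    by (rule pd_homogeneous[OF ghol ghom that])
  define N' where "N' = {x \<in> N - {0}. pd i g x \<noteq> 0}"
  have N'eq: "N' = (N - {0}) \<inter> pd i g -` (- {0})" by (auto simp: N'_def)
  have "open N'"
    unfolding N'eq
    by (rule continuous_open_preimage[OF continuous_on_subset[OF continuous_on_pd[OF ghol]]])
       (use N in \<open>auto simp: open_Compl open_Diff\<close>)
  \<comment> \<open>The saturation of \<open>N'\<close> under scaling; homogeneity of
    \<open>g\<close> and of its derivative carries what holds on \<open>N'\<close> to all of
    \<open>C\<close>.\<close>
  define C where "C = (\<Union>c\<in>-{0}. (\<lambda>y. c *s y) -` N')"
  have "open C"
    unfolding C_def
  proof (intro open_UN ballI open_vimage[OF \<open>open N'\<close>])
    show "continuous_on UNIV (\<lambda>y :: complex^'n. c *s y)" for c :: complex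
      by (intro continuous_intros)
  qed
  have CD: "\<exists>d. d \<noteq> 0 \<and> d *s v \<in> N'" if "v \<in> C" for v
    using that unfolding C_def by blast
  have C0: "0 \<notin> C" by (auto simp: C_def N'_def)
  have Cinv: "c *s v \<in> C" if "v \<in> C" "c \<noteq> 0" for c v
  proof -
    from CD[OF that(1)] obtain d where "d \<noteq> 0" "d *s v \<in> N'" by blast
    then have "d / c \<noteq> 0" "(d / c) *s (c *s v) \<in> N'"
      using that(2) by (simp_all add: vector_smult_assoc)
    then show ?thesis unfolding C_def by (intro UN_I[of "d / c"]) simp_all
  qed
  have sub: "proj_submanifold (CARD('n) - 2) {proj_point v | v. v \<in> {v \<in> C. g v = 0}}"
  proof (rule regular_cone_submanifold[where i = i, OF \<open>open C\<close> C0 Cinv _ _ _ card])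
    show "hol_on g C" using C0 by (intro hol_on_subset[OF ghol]) blast
    show "g (c *s v) = 0" if "v \<in> C" "c \<noteq> 0" "g v = 0" for c v
      using that ghom[of c v] C0 by auto
    show "pd i g v \<noteq> 0" if v: "v \<in> C" "g v = 0" for v
    proof -
      from CD[OF v(1)] obtain d where "d \<noteq> 0" "d *s v \<in> N'" by blast
      moreover have "v \<noteq> 0" using v C0 by auto
      ultimately show ?thesis using pghom[of d v] by (auto simp: N'_def)
    qed
  qed
  have "z \<in> C" using N z reg
    unfolding C_def by (intro UN_I[of 1]) (auto simp: N'_def g_def)
  moreover have "g z = 0" using reg by (simp add: g_def)
  ultimately have ne: "{proj_point v | v. v \<in> {v \<in> C. g v = 0}} \<noteq> {}" by blast
  have "{proj_point v | v. v \<in> {v \<in> C. g v = 0}} \<subseteq> sing_set A"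
  proof
    fix p assume "p \<in> {proj_point v | v. v \<in> {v \<in> C. g v = 0}}"
    then obtain v where v: "p = proj_point v" "v \<in> C" "g v = 0" by blast
    from CD[OF v(2)] obtain d where d: "d \<noteq> 0" "d *s v \<in> N'" by blast
    have v0: "v \<noteq> 0" using v C0 by auto
    have "g (d *s v) = 0" using ghom[OF d(1) v0] v by simp
    then have "A (d *s v) = 0" using contr d by (auto simp: N'_def g_def)
    then have "A v = 0" using Ahom[OF d(1) v0] d(1) by simp
    then show "p \<in> sing_set A" using v v0 by (auto simp: sing_set_def)
  qed
  then have "CARD('n) - 2 + 2 \<le> CARD('n) - 1"
    using codim[unfolded codim_at_least_def, rule_format, OF conjI[OF ne conjI[OF _ sub]]] by simp
  then show False using card by simp
qed

text \<open>Every singular point lies in a piece \<open>R l i\<close> of a regular hypersurface. In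
  a chart the piece satisfies a second, not identically valid equation, so
  \<open>negligible_matrices_hitting\<close> applies locally; Lindelof and the countability of index
  lists do the rest.\<close>

lemma negligible_matrices_hitting_sing:
  fixes A :: "complex^'n \<Rightarrow> complex^'n" and \<gamma> :: "complex \<Rightarrow> complex^'n"
  assumes A: "twisted_form k A" and codim: "codim_at_least 2 (CARD('n) - 1) (sing_set A)"
    and card: "CARD('n) \<ge> 2" and v0: "v0 \<noteq> 0" "A v0 \<noteq> 0"
    and \<gamma>: "\<And>s c. s \<in> D \<Longrightarrow> (\<lambda>s. \<gamma> s $ c) field_differentiable (at s)" "\<And>s. s \<in> D \<Longrightarrow> \<gamma> s \<noteq> 0"
  shows "negligible {H :: complex^'n^'n. \<exists>s\<in>D. H *v \<gamma> s \<noteq> 0 \<and> A (H *v \<gamma> s) = 0}" (is "negligible ?E")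
proof -
  obtain a where a: "A v0 $ a \<noteq> 0" using v0(2) by (auto simp: vec_eq_iff)
  have Ahol: "hol_on (\<lambda>v. A v $ b) (- {0})" for b
    using A by (simp add: twisted_form_def holomorphic_map_on_iff)
  define G where "G l = pds l (\<lambda>v. A v $ a)" for l
  have Ghol: "hol_on (G l) (- {0})" for l
    unfolding G_def by (rule hol_on_pds[OF Ahol]) (simp add: open_Compl)
  define R where "R l i = {v. v \<noteq> 0 \<and> A v = 0 \<and> G l v = 0 \<and> pd i (G l) v \<noteq> 0}" for l i
  define E where "E Q = {H :: complex^'n^'n. \<exists>s\<in>D. H *v \<gamma> s \<in> Q}" for Q
  have loc: "\<exists>N. open N \<and> z \<in> N \<and> negligible (E (R l i \<inter> N))" if z: "z \<in> R l i" for z l i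
  proof -
    have "z \<in> -{0}" "pd i (G l) z \<noteq> 0" using z by (auto simp: R_def)
    then obtain U V \<Psi> where *: "open U" "z \<in> U" "U \<subseteq> -{0}" "open V"
      "homeomorphism U V (\<lambda>x. setc i (G l x) x) \<Psi>"
      "holomorphic_map_on (\<lambda>x. setc i (G l x) x) U" "holomorphic_map_on \<Psi> V"
      by (rule level_set_chart[OF Ghol open_punctured]) (rule that)
    let ?\<Phi> = "\<lambda>x. setc i (G l x) x"
    have "?\<Phi> z \<in> V" using homeomorphism_image1[OF *(5)] *(2) by blast
    then obtain \<rho> where \<rho>: "\<rho> > 0" "ball (?\<Phi> z) \<rho> \<subseteq> V"
      using *(4) open_contains_ball by blast
    \<comment> \<open>A ball, since \<open>negligible_matrices_hitting\<close> asks for a convex set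
      in the chart.\<close>
    define B where "B = ball (?\<Phi> z) \<rho>"
    define N where "N = U \<inter> ?\<Phi> -` B"
    have N: "open N"
      unfolding N_def B_def by (rule continuous_open_preimage[OF homeomorphism_cont1[OF *(5)] *(1) open_ball])
    have zN: "z \<in> N" using *(2) \<rho> by (simp add: N_def B_def)
    have "z \<noteq> 0" "pds l (\<lambda>v. A v $ a) z = 0" "pd i (pds l (\<lambda>v. A v $ a)) z \<noteq> 0"
      using z by (auto simp: R_def G_def)
    from sing_set_no_regular_hypersurface[OF A codim card N zN this]
    obtain x where x: "x \<in> N" "G l x = 0" "A x \<noteq> 0" by (auto simp: G_def)
    then obtain b where b: "A x $ b \<noteq> 0" by (auto simp: vec_eq_iff)
    have xU: "x \<in> U" using x by (simp add: N_def)
    have \<Psi>B: "holomorphic_map_on \<Psi> B"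
      using *(7) \<rho>(2) unfolding B_def holomorphic_map_on_def by blast
    have "\<Psi> ` B \<subseteq> U" using homeomorphism_image2[OF *(5)] \<rho>(2) unfolding B_def by blast
    then have h: "hol_on (\<lambda>y. A (\<Psi> y) $ b) B"
      using \<Psi>B *(3) by (intro hol_on_compose[OF Ahol]) (auto simp: holomorphic_map_on_iff)
    have y0: "?\<Phi> x \<in> B" "?\<Phi> x $ i = 0" "A (\<Psi> (?\<Phi> x)) $ b \<noteq> 0"
    proof -
      show "?\<Phi> x \<in> B" using x by (simp add: N_def)
      show "?\<Phi> x $ i = 0" using x by simp
      show "A (\<Psi> (?\<Phi> x)) $ b \<noteq> 0" using homeomorphism_apply1[OF *(5) xU] b by simp
    qed
    have "negligible (\<Union>j\<in>UNIV. {H :: complex^'n^'n. \<exists>s\<in>D. \<gamma> s $ j \<noteq> 0 \<and>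
       (\<exists>y\<in>B. y $ i = 0 \<and> A (\<Psi> y) $ b = 0 \<and> H *v \<gamma> s = \<Psi> y)})"
      by (rule negligible_UN_countable, simp add: countable_finite,
          rule negligible_matrices_hitting[OF \<gamma>(1) \<Psi>B _ _ h y0]) (simp_all add: B_def)
    moreover have "E (R l i \<inter> N) \<subseteq> (\<Union>j\<in>UNIV. {H :: complex^'n^'n. \<exists>s\<in>D. \<gamma> s $ j \<noteq> 0 \<and>
       (\<exists>y\<in>B. y $ i = 0 \<and> A (\<Psi> y) $ b = 0 \<and> H *v \<gamma> s = \<Psi> y)})"
    proof
      fix H assume "H \<in> E (R l i \<inter> N)"
      then obtain s where s: "s \<in> D" "H *v \<gamma> s \<in> R l i" "H *v \<gamma> s \<in> N" by (auto simp: E_def)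
      obtain j where j: "\<gamma> s $ j \<noteq> 0" using \<gamma>(2)[OF s(1)] by (auto simp: vec_eq_iff)
      have U: "H *v \<gamma> s \<in> U" using s(3) by (simp add: N_def)
      have e: "\<Psi> (?\<Phi> (H *v \<gamma> s)) = H *v \<gamma> s" by (rule homeomorphism_apply1[OF *(5) U])
      have "?\<Phi> (H *v \<gamma> s) \<in> B" using s(3) by (simp add: N_def)
      moreover have "?\<Phi> (H *v \<gamma> s) $ i = 0" using s(2) by (simp add: R_def)
      moreover have "A (\<Psi> (?\<Phi> (H *v \<gamma> s))) $ b = 0" unfolding e using s(2) by (simp add: R_def)
      ultimately show "H \<in> (\<Union>j\<in>UNIV. {H :: complex^'n^'n. \<exists>s\<in>D. \<gamma> s $ j \<noteq> 0 \<and>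
       (\<exists>y\<in>B. y $ i = 0 \<and> A (\<Psi> y) $ b = 0 \<and> H *v \<gamma> s = \<Psi> y)})"
        using s(1) j e[symmetric] by blast
    qed
    ultimately have "negligible (E (R l i \<inter> N))" by (rule negligible_subset)
    then show ?thesis using N zN by blast
  qed
  have R: "negligible (E (R l i))" for l i
  proof -
    obtain N where N: "\<And>z. z \<in> R l i \<Longrightarrow> open (N z) \<and> z \<in> N z \<and> negligible (E (R l i \<inter> N z))"
      using loc[of _ l i] by metis
    obtain F where F: "F \<subseteq> N ` R l i" "countable F" "\<Union>F = \<Union>(N ` R l i)"
      using Lindelof[of "N ` R l i"] N by blast
    have "negligible (\<Union>Q\<in>F. E (R l i \<inter> Q))"
      by (rule negligible_UN_countable[OF F(2)]) (use F(1) N in auto)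
    moreover have "E (R l i) \<subseteq> (\<Union>Q\<in>F. E (R l i \<inter> Q))"
    proof
      fix H assume "H \<in> E (R l i)"
      then obtain s where s: "s \<in> D" "H *v \<gamma> s \<in> R l i" by (auto simp: E_def)
      then have "H *v \<gamma> s \<in> \<Union>F" using N F(3) by blast
      then show "H \<in> (\<Union>Q\<in>F. E (R l i \<inter> Q))" using s by (auto simp: E_def)
    qed
    ultimately show ?thesis by (rule negligible_subset)
  qed
  have "negligible (\<Union>p\<in>UNIV. E (R (fst p) (snd p)))"
  proof (rule negligible_UN_countable)
    show "countable (UNIV :: ('n list \<times> 'n) set)"
      unfolding UNIV_Times_UNIV[symmetric]
      by (intro countable_SIGMA countable_UNIV_lists countable_finite) simp
  qed (rule R)
  moreover have "?E \<subseteq> (\<Union>p\<in>UNIV. E (R (fst p) (snd p)))"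
  proof
    fix H assume "H \<in> ?E"
    then obtain s where s: "s \<in> D" "H *v \<gamma> s \<noteq> 0" "A (H *v \<gamma> s) = 0" by blast
    define z where "z = H *v \<gamma> s"
    define u where "u = v0 - z"
    have u: "u \<noteq> 0" using s v0 by (auto simp: u_def z_def)
    \<comment> \<open>The coefficients are holomorphic only off the origin. The complex line from
      \<open>z\<close> to \<open>v0\<close> meets it for at most one parameter, and the plane minus
      a finite set is connected.\<close>
    let ?P = "{t. z + t *s u = 0}"
    have "finite ?P"
    proof -
      obtain j where j: "u $ j \<noteq> 0" using u by (auto simp: vec_eq_iff)
      have "?P \<subseteq> {- z $ j / u $ j}"
      proof
        fix t assume "t \<in> ?P"
        then have "(z + t *s u) $ j = 0" by simp
        then show "t \<in> {- z $ j / u $ j}" using j by (simp add: field_simps eq_neg_iff_add_eq_0)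
      qed
      then show ?thesis using finite_subset by blast
    qed
    then have "open (- ?P)" "connected (- ?P)"
      by (auto intro!: finite_imp_closed open_Compl path_connected_imp_connected
            path_connected_complement_countable countable_finite)
    then have "\<exists>l i. pds l (\<lambda>v. A v $ a) z = 0 \<and> pd i (pds l (\<lambda>v. A v $ a)) z \<noteq> 0"
      by (intro exists_regular_derivative[OF Ahol, of z a 1 u "- ?P"])
         (use s v0 a in \<open>auto simp: z_def u_def open_Compl\<close>)
    then obtain l i where "z \<in> R l i" using s by (auto simp: R_def G_def z_def)
    then show "H \<in> (\<Union>p\<in>UNIV. E (R (fst p) (snd p)))"
      using s(1) by (intro UN_I[of "(l, i)"]) (auto simp: E_def z_def)
  qed
  ultimately show ?thesis by (rule negligible_subset)
qed

section \<open>Generic transversality\<close>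

lemma vec_linear_imp_linear:
  fixes f :: "complex^'m \<Rightarrow> complex^'k"
  assumes l: "Vector_Spaces.linear (*s) (*s) f" shows "linear f"
proof (rule linearI)
  interpret l: Vector_Spaces.linear "(*s)" "(*s)" f by (rule l)
  show "f (x + y) = f x + f y" for x y by (rule l.add)
  have sc: "r *\<^sub>R z = of_real r *s z" for r and z :: "complex^'q"
    by (simp add: vec_eq_iff scaleR_conv_of_real[where 'a=complex])
  show "f (r *\<^sub>R x) = r *\<^sub>R f x" for r x unfolding sc by (rule l.scale)
qed

lemma vec_span_full:
  fixes S :: "(complex^'n) set"
  assumes "vec.dim S \<ge> CARD('n)" shows "vec.span S = UNIV"
  using vec.dim_eq_span[OF subset_UNIV, of S] assms unfolding vec_dim_card by (simp only: vec.span_UNIV)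

lemma derivative_left_inverse:
  fixes f :: "'a::real_normed_vector \<Rightarrow> 'b::real_normed_vector" and g :: "'b \<Rightarrow> 'a"
  assumes f: "(f has_derivative f') (at x)" and g: "(g has_derivative g') (at (f x))"
    and U: "open U" "x \<in> U" "\<And>y. y \<in> U \<Longrightarrow> g (f y) = y"
  shows "g' (f' w) = w"
proof -
  have "((\<lambda>y. g (f y)) has_derivative (\<lambda>w. g' (f' w))) (at x)"
    by (rule has_derivative_compose[OF f g])
  then have "((\<lambda>y. y) has_derivative (\<lambda>w. g' (f' w))) (at x)"
    by (rule has_derivative_transform_within_open[OF _ U])
  from has_derivative_unique[OF this has_derivative_ident] show ?thesis by metis
qed

lemma vec_span_subspace_insert2:
  assumes T: "vec.subspace T" and full: "vec.span (insert b (insert a T)) = (UNIV :: (complex^'n) set)"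
  shows "\<exists>t r s. t \<in> T \<and> y = t + r *s a + s *s b"
proof -
  have "y \<in> vec.span (insert b (insert a T))" using full by simp
  then obtain s r where "y - s *s b - r *s a \<in> vec.span T"
    unfolding vec.span_breakdown_eq by blast
  then have "y - s *s b - r *s a \<in> T" using T by (simp add: vec.span_eq_iff[THEN iffD2])
  then show ?thesis by (intro exI[of _ "y - s *s b - r *s a"] exI[of _ r] exI[of _ s]) simp
qed

text \<open>\<open>axis i 1\<close> is independent of \<open>T\<close>, so adding it leaves
  codimension at most one. If the span is not yet everything, a standard vector outside it completes
  it.\<close>

lemma exists_complementary_axis:
  fixes T :: "(complex^'n) set"
  assumes T: "vec.subspace T" "vec.dim T + 2 \<ge> CARD('n)" "\<And>t. t \<in> T \<Longrightarrow> t $ i = 0"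
    and card: "CARD('n) \<ge> 2"
  shows "\<exists>j. j \<noteq> i \<and> vec.span (insert (axis j 1) (insert (axis i 1) T)) = UNIV"
proof -
  let ?S = "insert (axis i 1) T"
  have "axis i 1 \<notin> T" using T(3)[of "axis i 1"] by (auto simp: axis_def)
  then have dS: "vec.dim ?S = vec.dim T + 1"
    using T(1) by (simp add: vec.dim_insert vec.span_eq_iff[THEN iffD2])
  show ?thesis
  proof (cases "vec.span ?S = UNIV")
    case True
    have "\<exists>j. j \<noteq> i"
    proof (rule ccontr)
      assume "\<not> (\<exists>j. j \<noteq> i)"
      then have "(UNIV :: 'n set) = {i}" by auto
      then have "CARD('n) = 1" by (metis card_1_singleton_iff One_nat_def)
      then show False using card by simp
    qed
    then obtain j where "j \<noteq> i" by blast
    moreover have "vec.span (insert (axis j 1) ?S) = UNIV"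
      using True vec.span_mono[of ?S "insert (axis j 1) ?S"] by blast
    ultimately show ?thesis by blast
  next
    case False
    have "\<exists>j. axis j 1 \<notin> vec.span ?S"
    proof (rule ccontr)
      assume "\<not> ?thesis"
      then have *: "axis j 1 \<in> vec.span ?S" for j by blast
      have "x \<in> vec.span ?S" for x
      proof -
        have "(\<Sum>j\<in>UNIV. (x $ j) *s axis j 1) \<in> vec.span ?S"
          by (intro vec.span_sum vec.span_scale *)
        then show ?thesis by (simp add: basis_expansion)
      qed
      then show False using False by blast
    qed
    then obtain j where j: "axis j 1 \<notin> vec.span ?S" by blast
    then have "j \<noteq> i" using vec.span_base[of "axis i 1" ?S] by auto
    moreover have "vec.dim (insert (axis j 1) ?S) \<ge> CARD('n)"
      using j dS T(2) by (simp add: vec.dim_insert[of _ ?S])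
    ultimately show ?thesis using vec_span_full by blast
  qed
qed

text \<open>In a chart straightening the hypersurface, some coordinate direction is complementary to the
  tangent space of the submanifold, so translating the submanifold in this direction sweeps out an
  open subset of the hypersurface.\<close>

lemma submanifold_meets_curve:
  fixes F :: "complex^'n \<Rightarrow> complex"
  assumes card: "CARD('n) \<ge> 2" and M: "complex_submanifold m M" "m + 2 \<ge> CARD('n)" "a \<in> M"
    and U: "open U" "a \<in> U" and V: "open V" and hom: "homeomorphism U V (\<lambda>x. setc i (F x) x) \<Psi>"
    and hol: "holomorphic_map_on (\<lambda>x. setc i (F x) x) U" "holomorphic_map_on \<Psi> V"
    and zero: "\<And>x. x \<in> M \<Longrightarrow> x \<in> U \<Longrightarrow> F x = 0"
    and Q: "\<And>X :: (complex^'n) set. open X \<Longrightarrow> X \<noteq> {} \<Longrightarrow> \<exists>d\<in>Q. d \<in> X"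
  shows "\<exists>j d s. d \<in> Q \<and> j \<noteq> i \<and> setc i 0 d + s *s axis j 1 \<in> V \<and> \<Psi> (setc i 0 d + s *s axis j 1) \<in> M"
proof -
  let ?\<Phi> = "\<lambda>x. setc i (F x) x"
  have "\<exists>U1 (V1 :: (complex^'n) set) \<Phi>1 \<Psi>1 W. open U1 \<and> a \<in> U1 \<and> open V1 \<and> homeomorphism U1 V1 \<Phi>1 \<Psi>1 \<and>
      holomorphic_map_on \<Phi>1 U1 \<and> holomorphic_map_on \<Psi>1 V1 \<and> vec.subspace W \<and> vec.dim W = m \<and>
      \<Phi>1 ` (M \<inter> U1) = W \<inter> V1"
    using M(1,3) unfolding complex_submanifold_def by blast
  then obtain U1 V1 W :: "(complex^'n) set" and \<Phi>1 \<Psi>1 where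
    1: "open U1" "a \<in> U1" "open V1" "homeomorphism U1 V1 \<Phi>1 \<Psi>1" "holomorphic_map_on \<Phi>1 U1"
      "holomorphic_map_on \<Psi>1 V1" and W: "vec.subspace W" "vec.dim W = m" "\<Phi>1 ` (M \<inter> U1) = W \<inter> V1"
    by (elim exE conjE) (rule that)
  define w0 where "w0 = \<Phi>1 a"
  have w0: "w0 \<in> W" "w0 \<in> V1" using W(3) M(3) 1(2) by (auto simp: w0_def)
  have \<Psi>w0: "\<Psi>1 w0 = a" unfolding w0_def by (rule homeomorphism_apply1[OF 1(4,2)])
  have inM: "\<Psi>1 w \<in> M" if "w \<in> W" "w \<in> V1" for w
  proof -
    from that W(3) obtain x where "x \<in> M" "x \<in> U1" "w = \<Phi>1 x" by blast
    then show ?thesis using homeomorphism_apply1[OF 1(4), of x] by simp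
  qed
  obtain J\<Phi> :: "complex^'n^'n" where J\<Phi>: "(?\<Phi> has_derivative (*v) J\<Phi>) (at a)"
    using hol(1) U(2) unfolding holomorphic_map_on_def by blast
  have av: "?\<Phi> a \<in> V" using homeomorphism_image1[OF hom] U(2) by blast
  obtain J\<Psi> :: "complex^'n^'n" where J\<Psi>: "(\<Psi> has_derivative (*v) J\<Psi>) (at (?\<Phi> a))"
    using hol(2) av unfolding holomorphic_map_on_def by blast
  obtain J1 :: "complex^'n^'n" where J1: "(\<Psi>1 has_derivative (*v) J1) (at w0)"
    using 1(6) w0(2) unfolding holomorphic_map_on_def by blast
  obtain I1 :: "complex^'n^'n" where I1: "(\<Phi>1 has_derivative (*v) I1) (at (\<Psi>1 w0))"
    using 1(5,2) \<Psi>w0 unfolding holomorphic_map_on_def by metis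
  have inv1: "I1 *v (J1 *v w) = w" for w
    by (rule derivative_left_inverse[OF J1 I1 1(3) w0(2)]) (rule homeomorphism_apply2[OF 1(4)])
  have inv2: "J\<Psi> *v (J\<Phi> *v w) = w" for w
    by (rule derivative_left_inverse[OF J\<Phi> J\<Psi> U]) (rule homeomorphism_apply1[OF hom])
  \<comment> \<open>The differential at \<open>w0\<close> of the parametrised submanifold, seen in
    the chart of the hypersurface; \<open>T\<close> below is the tangent space.\<close>
  define K where "K w = J\<Phi> *v (J1 *v w)" for w
  have Kvl: "Vector_Spaces.linear (*s) (*s) K"
    unfolding K_def using matrix_vector_mul_linear_gen[of "J\<Phi> ** J1"] by (simp add: matrix_vector_mul_assoc)
  have Kinj: "inj K" by (rule inj_on_inverseI[of _ "\<lambda>y. I1 *v (J\<Psi> *v y)"]) (simp add: K_def inv1 inv2)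
  have derK: "((\<lambda>w. ?\<Phi> (\<Psi>1 w)) has_derivative K) (at w0)"
    unfolding K_def using has_derivative_compose[OF J1, of ?\<Phi> "(*v) J\<Phi>"] J\<Phi> \<Psi>w0 by simp
  define O1 where "O1 = V1 \<inter> \<Psi>1 -` U"
  have O1: "open O1"
    unfolding O1_def by (rule continuous_open_preimage[OF homeomorphism_cont2[OF 1(4)] 1(3) U(1)])
  have w0O: "w0 \<in> O1" using w0 \<Psi>w0 U(2) by (simp add: O1_def)
  have contO: "continuous_on O1 (\<lambda>w. ?\<Phi> (\<Psi>1 w))"
    by (rule continuous_on_compose2[OF homeomorphism_cont1[OF hom]
          continuous_on_subset[OF homeomorphism_cont2[OF 1(4)]]]) (auto simp: O1_def)
  define T where "T = K ` W"
  have T: "vec.subspace T" unfolding T_def by (rule vec.linear_subspace_image[OF Kvl W(1)])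
  have "vec.dim T = m"
    unfolding T_def using vec.dim_image_eq[OF Kvl, of W] Kinj W by (auto intro: inj_on_subset)
  \<comment> \<open>The \<open>i\<close>-th chart coordinate is \<open>F\<close>, which vanishes
    along \<open>M\<close>.\<close>
  have Ti: "t $ i = 0" if "t \<in> T" for t
  proof -
    from that[unfolded T_def] obtain w where w: "w \<in> W" "t = K w" by blast
    have line: "((\<lambda>r. w0 + r *\<^sub>R w) has_derivative (\<lambda>r. r *\<^sub>R w)) (at (0::real))"
      by (auto intro!: derivative_eq_intros)
    have d1: "((\<lambda>r. ?\<Phi> (\<Psi>1 (w0 + r *\<^sub>R w)) $ i) has_derivative (\<lambda>r. K (r *\<^sub>R w) $ i)) (at (0::real))"
      by (rule bounded_linear.has_derivative[OF bounded_linear_vec_nth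
            has_derivative_compose[OF line, of "\<lambda>w. ?\<Phi> (\<Psi>1 w)" K]]) (simp add: derK)
    have d2: "open ((\<lambda>r. w0 + r *\<^sub>R w) -` O1)"
      by (rule open_vimage[OF O1]) (intro continuous_intros)
    have d3: "?\<Phi> (\<Psi>1 (w0 + r *\<^sub>R w)) $ i = 0" if "r \<in> (\<lambda>r. w0 + r *\<^sub>R w) -` O1" for r
    proof -
      have "r *\<^sub>R w = of_real r *s w" by (simp add: vec_eq_iff scaleR_conv_of_real[where 'a=complex])
      then have "w0 + r *\<^sub>R w \<in> W" using w(1) w0(1) W(1) by (simp add: vec.subspace_add vec.subspace_scale)
      then have "\<Psi>1 (w0 + r *\<^sub>R w) \<in> M" "\<Psi>1 (w0 + r *\<^sub>R w) \<in> U" using inM that by (auto simp: O1_def)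
      then show ?thesis using zero by simp
    qed
    have d4: "0 \<in> (\<lambda>r. w0 + r *\<^sub>R w) -` O1" using w0O by simp
    have "((\<lambda>r. 0) has_derivative (\<lambda>r. K (r *\<^sub>R w) $ i)) (at (0::real))"
      by (rule has_derivative_transform_within_open[OF d1 d2 d4 d3])
    from has_derivative_unique[OF this has_derivative_const] have "K (1 *\<^sub>R w) $ i = 0" by (rule fun_cong)
    then show ?thesis using w(2) by simp
  qed
  obtain j where j: "j \<noteq> i" "vec.span (insert (axis j 1) (insert (axis i 1) T)) = UNIV"
    using exists_complementary_axis[OF T _ Ti card] M(2) \<open>vec.dim T = m\<close> by blast
  \<comment> \<open>A projection onto \<open>W\<close>, so that the map \<open>f\<close> below is
    defined on an open set of a full vector space.\<close>
  have "Vector_Spaces.linear (*s) (*s) (\<lambda>x :: complex^'n. x)" by (rule vec.linear_ident)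
  from vec.linear_exists_left_inverse_on[OF this W(1)]
  obtain \<pi> :: "complex^'n \<Rightarrow> complex^'n" where \<pi>: "range \<pi> \<subseteq> W" "Vector_Spaces.linear (*s) (*s) \<pi>" "\<And>v. v \<in> W \<Longrightarrow> \<pi> v = v"
    by (auto simp: inj_on_def)
  have \<pi>l: "linear \<pi>" and Kl: "linear K" using \<pi>(2) Kvl by (auto intro: vec_linear_imp_linear)
  \<comment> \<open>Besides translating along \<open>axis j 1\<close> the map moves along
    \<open>axis i 1\<close>, out of the hypersurface. Its image then contains an open set of the
    whole space and meets the dense set \<open>Q\<close>; \<open>setc i 0\<close> later discards the
    extra coordinate.\<close>
  define f where "f p = ?\<Phi> (\<Psi>1 (w0 + \<pi> (fst p))) - fst (snd p) *s axis j 1 + snd (snd p) *s axis i 1"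
    for p :: "(complex^'n) \<times> complex \<times> complex"
  define f' where "f' p = K (\<pi> (fst p)) - fst (snd p) *s axis j 1 + snd (snd p) *s axis i 1"
    for p :: "(complex^'n) \<times> complex \<times> complex"
  define S where "S = (\<lambda>p :: (complex^'n) \<times> complex \<times> complex. w0 + \<pi> (fst p)) -` O1"
  have \<pi>c: "continuous_on X (\<lambda>p :: (complex^'n) \<times> complex \<times> complex. w0 + \<pi> (fst p))" for X
  proof -
    have "continuous_on UNIV \<pi>"
      by (rule linear_continuous_on[OF linear_conv_bounded_linear[THEN iffD1, OF \<pi>l]])
    from continuous_on_add[OF continuous_on_const continuous_on_compose2[OF this continuous_on_fst[OF continuous_on_id]]]
    show ?thesis by simp
  qed
  have S: "open S" unfolding S_def by (rule open_vimage[OF O1 \<pi>c])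
  have S0: "0 \<in> S" using w0O linear_0[OF \<pi>l] by (simp add: S_def)
  have smul: "continuous_on X (\<lambda>p. g p *s (v :: complex^'n))" if "continuous_on X g" for X v and g :: "'z::topological_space \<Rightarrow> complex"
    by (intro continuous_intros that)
  have contf: "continuous_on S f"
  proof -
    have "continuous_on S (\<lambda>p. ?\<Phi> (\<Psi>1 (w0 + \<pi> (fst p))))"
      by (rule continuous_on_compose2[OF contO \<pi>c]) (auto simp: S_def)
    from continuous_on_add[OF continuous_on_diff[OF this smul[OF continuous_on_fst[OF continuous_on_snd[OF continuous_on_id]]]]
        smul[OF continuous_on_snd[OF continuous_on_snd[OF continuous_on_id]]]]
    show ?thesis unfolding f_def .
  qed
  have sd: "((\<lambda>p. g p *s (v :: complex^'n)) has_derivative (\<lambda>p. g p *s v)) (at x)"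
    if "bounded_linear g" for x v and g :: "(complex^'n) \<times> complex \<times> complex \<Rightarrow> complex"
  proof (rule has_derivative_vecI)
    fix c show "((\<lambda>p. (g p *s v) $ c) has_derivative (\<lambda>w. (g w *s v) $ c)) (at x)"
      using has_derivative_mult_left[OF bounded_linear_imp_has_derivative[OF that], of "v $ c" "at x"] by simp
  qed
  have derf: "(f has_derivative f') (at 0)"
  proof -
    have "linear (\<lambda>p :: (complex^'n) \<times> complex \<times> complex. \<pi> (fst p))"
      by (rule linearI) (auto simp: linear_add[OF \<pi>l] linear_scale[OF \<pi>l])
    then have b: "bounded_linear (\<lambda>p :: (complex^'n) \<times> complex \<times> complex. \<pi> (fst p))"
      by (simp add: linear_conv_bounded_linear)
    have "((\<lambda>p :: (complex^'n) \<times> complex \<times> complex. w0 + \<pi> (fst p)) has_derivative (\<lambda>p. \<pi> (fst p))) (at 0)"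
      using has_derivative_add[OF has_derivative_const[of w0] bounded_linear_imp_has_derivative[OF b]] by simp
    from has_derivative_compose[OF this, of "\<lambda>w. ?\<Phi> (\<Psi>1 w)" K] derK
    have "((\<lambda>p :: (complex^'n) \<times> complex \<times> complex. ?\<Phi> (\<Psi>1 (w0 + \<pi> (fst p)))) has_derivative (\<lambda>p. K (\<pi> (fst p)))) (at 0)"
      by (simp add: linear_0[OF \<pi>l])
    from has_derivative_add[OF has_derivative_diff[OF this sd[of "\<lambda>p. fst (snd p)"]] sd[of "\<lambda>p. snd (snd p)"]]
    show ?thesis
      unfolding f_def f'_def
      by (simp add: bounded_linear_fst_comp bounded_linear_snd_comp bounded_linear_fst bounded_linear_snd)
  qed
  have "linear f'" using derf has_derivative_linear by blast
  moreover have "surj f'"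
  proof (rule surjI)
    fix y
    obtain t r s where t: "t \<in> T" "y = t + r *s axis i 1 + s *s axis j 1"
      using vec_span_subspace_insert2[OF T j(2), of y] by blast
    then obtain w where w: "w \<in> W" "t = K w" by (auto simp: T_def)
    show "f' (SOME p. f' p = y) = y"
    proof (rule someI)
      show "f' (w, - s, r) = y"
        using t(2) w \<pi>(3) by (simp add: f'_def)
    qed
  qed
  ultimately obtain g' where g': "linear g'" "f' \<circ> g' = id"
    using linear_surjective_right_inverse by blast
  have "f 0 \<in> interior (f ` S)"
    by (rule sussmann_open_mapping[OF S contf S0 derf _ g'(2) order_refl])
       (use g'(1) S S0 in \<open>simp_all add: linear_conv_bounded_linear interior_open\<close>)
  then obtain d where d: "d \<in> Q" "d \<in> interior (f ` S)"
    using Q[OF open_interior] by blast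
  then obtain p where p: "p \<in> S" "d = f p" using interior_subset by blast
  define x where "x = \<Psi>1 (w0 + \<pi> (fst p))"
  have wW: "w0 + \<pi> (fst p) \<in> W" using w0(1) \<pi>(1) W(1) by (auto intro: vec.subspace_add)
  have "w0 + \<pi> (fst p) \<in> V1" "x \<in> U" using p(1) by (auto simp: S_def O1_def x_def)
  then have x: "x \<in> M" "x \<in> U" using inM[OF wW] by (auto simp: x_def)
  have d_eq: "d = ?\<Phi> x - fst (snd p) *s axis j 1 + snd (snd p) *s axis i 1"
    using p(2) by (simp add: f_def x_def)
  have eq: "setc i 0 d + fst (snd p) *s axis j 1 = ?\<Phi> x"
    using zero[OF x] j(1) unfolding d_eq by (auto simp: vec_eq_iff axis_def)
  have "?\<Phi> x \<in> V" using homeomorphism_image1[OF hom] x(2) by blast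
  moreover have "\<Psi> (?\<Phi> x) = x" by (rule homeomorphism_apply1[OF hom x(2)])
  ultimately show ?thesis
    using x(1) j(1) d(1) by (intro exI[of _ j] exI[of _ d] exI[of _ "fst (snd p)"] conjI) (simp_all only: eq simp_thms)
qed

section \<open>Tangency as a multiplier equation\<close>

definition grad :: "(complex^'n \<Rightarrow> complex) \<Rightarrow> complex^'n \<Rightarrow> complex^'n" where
  "grad F v = (\<chi> b. pd b F v)"

lemma grad_nth [simp]: "grad F v $ b = pd b F v"
  by (simp add: grad_def)

lemma homogeneous_polynomial_hol_on:
  assumes "homogeneous_polynomial d F" shows "hol_on F S"
proof -
  obtain a where "F = (\<lambda>v. \<Sum>\<alpha> | sum \<alpha> UNIV = d. a \<alpha> * (\<Prod>i\<in>UNIV. (v $ i) ^ \<alpha> i))"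
    using assms unfolding homogeneous_polynomial_def by blast
  then show ?thesis
    by (simp only:) (intro hol_on_sum hol_on_mult hol_on_prod hol_on_power hol_on_const hol_on_nth)
qed

lemma homogeneous_polynomial_scale:
  assumes "homogeneous_polynomial d F" shows "F (c *s v) = c ^ d * F v"
proof -
  obtain a where F: "F = (\<lambda>v. \<Sum>\<alpha> | sum \<alpha> UNIV = d. a \<alpha> * (\<Prod>i\<in>UNIV. (v $ i) ^ \<alpha> i))"
    using assms unfolding homogeneous_polynomial_def by blast
  have "a \<alpha> * (\<Prod>i\<in>UNIV. ((c *s v) $ i) ^ \<alpha> i) = c ^ d * (a \<alpha> * (\<Prod>i\<in>UNIV. (v $ i) ^ \<alpha> i))"
    if "sum \<alpha> UNIV = d" for \<alpha>
  proof -
    have "(\<Prod>i\<in>UNIV. ((c *s v) $ i) ^ \<alpha> i) = (\<Prod>i\<in>UNIV. c ^ \<alpha> i) * (\<Prod>i\<in>UNIV. (v $ i) ^ \<alpha> i)"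
      by (simp add: power_mult_distrib prod.distrib)
    also have "(\<Prod>i\<in>UNIV. c ^ \<alpha> i) = c ^ d" unfolding that[symmetric] by (rule power_sum[symmetric])
    finally show ?thesis by simp
  qed
  then show ?thesis unfolding F sum_distrib_left by (intro sum.cong) auto
qed

lemma frechet_derivative_hol_on:
  assumes "hol_on F S" "v \<in> S"
  shows "frechet_derivative F (at v) = (\<lambda>w. \<Sum>i\<in>UNIV. pd i F v * w $ i)"
  by (rule frechet_derivative_at[OF hol_on_has_derivative[OF assms], symmetric])

lemma grad_nonzero:
  assumes "smooth_hypersurface_eq d F" "v \<noteq> 0" "F v = 0" shows "grad F v \<noteq> 0"
proof
  assume "grad F v = 0"
  then have "\<And>i. pd i F v = 0" by (simp add: vec_eq_iff)
  moreover have "hol_on F UNIV"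
    using assms(1) homogeneous_polynomial_hol_on by (auto simp: smooth_hypersurface_eq_def)
  ultimately have "frechet_derivative F (at v) = (\<lambda>_. 0)"
    using frechet_derivative_hol_on[of F UNIV v] by simp
  then show False using assms by (simp add: smooth_hypersurface_eq_def)
qed

lemma grad_scale:
  assumes F: "homogeneous_polynomial d F" and d: "d \<ge> 1" and "c \<noteq> 0" "v \<noteq> 0"
  shows "grad F (c *s v) = c ^ (d - 1) *s grad F v"
proof -
  have "pd b F (c *s v) = c ^ (d - 1) * pd b F v" for b
  proof -
    have "pd b F (c *s v) = c powi (int d - 1) * pd b F v"
      by (rule pd_homogeneous[OF homogeneous_polynomial_hol_on[OF F] _ assms(3,4)])
         (simp add: homogeneous_polynomial_scale[OF F])
    moreover have "int d - 1 = int (d - 1)" using d by simp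
    ultimately show ?thesis by (simp only: power_int_of_nat)
  qed
  then show ?thesis by (simp add: vec_eq_iff)
qed

text \<open>For one direction, pick \<open>j\<close> with \<open>G $ j\<close> nonzero and test on
  the kernel vectors \<open>G $ j *s axis i 1 - G $ i *s axis j 1\<close>.\<close>

lemma covector_multiple_iff:
  fixes B G :: "complex^'n"
  assumes "G \<noteq> 0"
  shows "(\<forall>w. (\<Sum>i\<in>UNIV. G $ i * w $ i) = 0 \<longrightarrow> (\<Sum>i\<in>UNIV. B $ i * w $ i) = 0) \<longleftrightarrow> (\<exists>c. B = c *s G)"
proof
  assume *: "\<forall>w. (\<Sum>i\<in>UNIV. G $ i * w $ i) = 0 \<longrightarrow> (\<Sum>i\<in>UNIV. B $ i * w $ i) = 0"
  obtain j where j: "G $ j \<noteq> 0" using assms by (auto simp: vec_eq_iff)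
  have sums: "(\<Sum>a\<in>UNIV. C $ a * (x *s axis i 1 - y *s axis j 1) $ a) = C $ i * x - C $ j * y"
    for C :: "complex^'n" and x y i
  proof -
    have "(\<Sum>a\<in>UNIV. C $ a * (x *s axis i 1 - y *s axis j 1) $ a) =
      (\<Sum>a\<in>UNIV. (if a = i then C $ i * x else 0) - (if a = j then C $ j * y else 0))"
      by (rule sum.cong) (auto simp: axis_def algebra_simps)
    then show ?thesis by (simp add: sum_subtractf)
  qed
  have eq: "B $ i = (B $ j / G $ j) * G $ i" for i
    using *[rule_format, of "G $ j *s axis i 1 - G $ i *s axis j 1"] j
    unfolding sums by (simp add: field_simps)
  have "B = (B $ j / G $ j) *s G"
    unfolding vec_eq_iff vector_smult_component using eq by blast
  then show "\<exists>c. B = c *s G" by blast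
next
  assume "\<exists>c. B = c *s G"
  then obtain c where "B = c *s G" ..
  then have "(\<Sum>i\<in>UNIV. B $ i * w $ i) = c * (\<Sum>i\<in>UNIV. G $ i * w $ i)" for w
    by (simp add: sum_distrib_left mult_ac)
  then show "\<forall>w. (\<Sum>i\<in>UNIV. G $ i * w $ i) = 0 \<longrightarrow> (\<Sum>i\<in>UNIV. B $ i * w $ i) = 0" by simp
qed

lemma pullback_form_scale:
  fixes A :: "complex^'n \<Rightarrow> complex^'n"
  assumes A: "twisted_form k A" and H: "invertible H" and "c \<noteq> 0" "v \<noteq> 0"
  shows "pullback_form H A (c *s v) = (c powi (k - 1)) *s pullback_form H A v"
proof -
  have "H *v v \<noteq> 0" using H assms(4) by (metis matrix_left_invertible_ker invertible_def)
  then have "A (c *s (H *v v)) = (c powi (k - 1)) *s A (H *v v)"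
    using A assms(3) by (simp add: twisted_form_def)
  then show ?thesis by (simp add: pullback_form_def matrix_vector_mult_scaleR vector_scalar_commute)
qed

text \<open>Turns tangency into a Lagrange multiplier equation at any representative; the choice is
  immaterial because \<open>pullback_form H A\<close> and \<open>grad F\<close> are both
  homogeneous.\<close>

lemma restr_sing_set_iff:
  fixes A :: "complex^'n \<Rightarrow> complex^'n"
  assumes F: "smooth_hypersurface_eq d F" and d: "d \<ge> 1" and A: "twisted_form k A"
    and H: "invertible H" and v: "v \<noteq> 0"
  shows "proj_point v \<in> restr_sing_set (pullback_form H A) F \<longleftrightarrow>
    F v = 0 \<and> (\<exists>c. pullback_form H A v = c *s grad F v)"
proof -
  let ?B = "pullback_form H A"
  have Fp: "homogeneous_polynomial d F" using F by (simp add: smooth_hypersurface_eq_def)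
  have hyp: "proj_point u \<in> hypersurface F \<longleftrightarrow> F u = 0" if u: "u \<noteq> 0" for u
  proof
    assume "proj_point u \<in> hypersurface F"
    then obtain x where x: "proj_point u = proj_point x" "x \<noteq> 0" "F x = 0"
      by (auto simp: hypersurface_def)
    then obtain c where "u = c *s x" using proj_point_eq_iff[of x u] u by auto
    then show "F u = 0" using x homogeneous_polynomial_scale[OF Fp] by simp
  qed (use u in \<open>auto simp: hypersurface_def\<close>)
  have tan: "(\<forall>w. frechet_derivative F (at u) w = 0 \<longrightarrow> form_at ?B u w = 0) \<longleftrightarrow> (\<exists>c. ?B u = c *s grad F u)"
    if "u \<noteq> 0" "F u = 0" for u
    using covector_multiple_iff[OF grad_nonzero[OF F that], of "?B u"]
    by (simp add: frechet_derivative_hol_on[OF homogeneous_polynomial_hol_on[OF Fp] UNIV_I] form_at_def)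
  show ?thesis
  proof
    assume "proj_point v \<in> restr_sing_set ?B F"
    then obtain u where u: "proj_point v = proj_point u" "u \<noteq> 0" "proj_point u \<in> hypersurface F"
      "\<forall>w. frechet_derivative F (at u) w = 0 \<longrightarrow> form_at ?B u w = 0"
      unfolding restr_sing_set_def by blast
    have Fu: "F u = 0" using u hyp by blast
    obtain c where c: "?B u = c *s grad F u" using tan[OF u(2) Fu] u(4) by blast
    obtain e where e: "v = e *s u" using proj_point_eq_iff[of u v] u v by auto
    then have e0: "e \<noteq> 0" using v by auto
    have "F v = 0" using e Fu homogeneous_polynomial_scale[OF Fp] by simp
    moreover have "?B v = (e powi (k - 1) * c / e ^ (d - 1)) *s grad F v"
      unfolding e grad_scale[OF Fp d e0 u(2)] pullback_form_scale[OF A H e0 u(2)] c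
      using e0 by (simp add: vector_smult_assoc)
    ultimately show "F v = 0 \<and> (\<exists>c. ?B v = c *s grad F v)" by blast
  next
    assume *: "F v = 0 \<and> (\<exists>c. ?B v = c *s grad F v)"
    then have "proj_point v \<in> hypersurface F" "\<forall>w. frechet_derivative F (at v) w = 0 \<longrightarrow> form_at ?B v w = 0"
      using hyp[OF v] tan[OF v] by blast+
    then show "proj_point v \<in> restr_sing_set ?B F"
      using v unfolding restr_sing_set_def by blast
  qed
qed

text \<open>At a tangency either the image point is singular or one of the finitely many
  coefficients of \<open>A\<close> is nonzero there; the two parameter counts treat these
  cases.\<close>

lemma negligible_tangent_along_curve:
  fixes A G :: "complex^'n \<Rightarrow> complex^'n" and \<gamma> :: "complex \<Rightarrow> complex^'n"
  assumes A: "twisted_form k A" and codim: "codim_at_least 2 (CARD('n) - 1) (sing_set A)"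
    and card: "CARD('n) \<ge> 4" and v0: "v0 \<noteq> 0" "A v0 \<noteq> 0" and G: "\<And>a. hol_on (\<lambda>v. G v $ a) UNIV"
    and \<gamma>: "\<And>s c. s \<in> D \<Longrightarrow> (\<lambda>s. \<gamma> s $ c) field_differentiable (at s)" "\<And>s. s \<in> D \<Longrightarrow> \<gamma> s \<noteq> 0"
  shows "negligible {H :: complex^'n^'n. \<exists>s\<in>D. H *v \<gamma> s \<noteq> 0 \<and> (\<exists>c. pullback_form H A (\<gamma> s) = c *s G (\<gamma> s))}"
    (is "negligible ?E")
proof -
  have Ahol: "hol_on (\<lambda>v. A v $ a) (- {0})" for a
    using A by (simp add: twisted_form_def holomorphic_map_on_iff)
  let ?S = "{H :: complex^'n^'n. \<exists>s\<in>D. H *v \<gamma> s \<noteq> 0 \<and> A (H *v \<gamma> s) = 0}"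
  let ?T = "\<lambda>i. {H :: complex^'n^'n. \<exists>s\<in>D. H *v \<gamma> s \<noteq> 0 \<and> A (H *v \<gamma> s) $ i \<noteq> 0 \<and>
    (\<exists>c. transpose H *v A (H *v \<gamma> s) = c *s G (\<gamma> s))}"
  have "negligible ?S"
    by (rule negligible_matrices_hitting_sing[OF A codim _ v0 \<gamma>]) (use card in auto)
  moreover have "negligible (\<Union>i\<in>UNIV. ?T i)"
    by (rule negligible_UN_countable, simp add: countable_finite,
        rule negligible_matrices_tangent[OF card \<gamma>(1) Ahol G])
  ultimately have "negligible (?S \<union> (\<Union>i\<in>UNIV. ?T i))" by (rule negligible_Un)
  moreover have "?E \<subseteq> ?S \<union> (\<Union>i\<in>UNIV. ?T i)"
  proof
    fix H assume "H \<in> ?E"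
    then obtain s c where s: "s \<in> D" "H *v \<gamma> s \<noteq> 0" "transpose H *v A (H *v \<gamma> s) = c *s G (\<gamma> s)"
      unfolding pullback_form_def by blast
    show "H \<in> ?S \<union> (\<Union>i\<in>UNIV. ?T i)"
    proof (cases "A (H *v \<gamma> s) = 0")
      case False
      then obtain i where "A (H *v \<gamma> s) $ i \<noteq> 0" by (auto simp: vec_eq_iff)
      then have "H \<in> ?T i" using s by blast
      then show ?thesis by blast
    qed (use s in blast)
  qed
  ultimately show ?thesis by (rule negligible_subset)
qed

lemma negligible_nontransverse:
  fixes A :: "complex^'n \<Rightarrow> complex^'n"
  assumes A: "twisted_form k A" and codim: "codim_at_least 2 (CARD('n) - 1) (sing_set A)"
    and card: "CARD('n) \<ge> 4" and v0: "v0 \<noteq> 0" "A v0 \<noteq> 0"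
    and F: "smooth_hypersurface_eq d F" and d: "d \<ge> 1"
  shows "negligible {H. invertible H \<and> \<not> transverse_to (pullback_form H A) F}" (is "negligible ?Bad")
proof -
  have Fp: "homogeneous_polynomial d F" using F by (simp add: smooth_hypersurface_eq_def)
  have Fhol: "hol_on F S" for S by (rule homogeneous_polynomial_hol_on[OF Fp])
  have Ghol: "hol_on (\<lambda>v. grad F v $ a) UNIV" for a
    using hol_on_pd[OF Fhol open_UNIV] by simp
  define X where "X = {v. v \<noteq> 0 \<and> F v = 0}"
  define chart where "chart c \<longleftrightarrow> (case c of (i, U, V, \<Psi>) \<Rightarrow> open U \<and> U \<subseteq> -{0} \<and> open V \<and>
     homeomorphism U V (\<lambda>x. setc i (F x) x) \<Psi> \<and>
     holomorphic_map_on (\<lambda>x. setc i (F x) x) U \<and> holomorphic_map_on \<Psi> V)"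
    for c :: "'n \<times> (complex^'n) set \<times> (complex^'n) set \<times> (complex^'n \<Rightarrow> complex^'n)"
  have "\<exists>c. chart c \<and> a \<in> fst (snd c)" if a: "a \<in> X" for a
  proof -
    have "grad F a \<noteq> 0" using grad_nonzero[OF F] a by (simp add: X_def)
    then obtain i where i: "pd i F a \<noteq> 0" by (auto simp: vec_eq_iff)
    have a0: "a \<in> -{0}" using a by (simp add: X_def)
    obtain U V \<Psi> where "open U" "a \<in> U" "U \<subseteq> -{0}" "open V"
      "homeomorphism U V (\<lambda>x. setc i (F x) x) \<Psi>"
      "holomorphic_map_on (\<lambda>x. setc i (F x) x) U" "holomorphic_map_on \<Psi> V"
      by (rule level_set_chart[OF Fhol open_punctured a0 i]) (rule that)
    then have "chart (i, U, V, \<Psi>) \<and> a \<in> fst (snd (i, U, V, \<Psi>))" by (simp add: chart_def)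
    then show ?thesis by blast
  qed
  then obtain c where c: "\<And>a. a \<in> X \<Longrightarrow> chart (c a) \<and> a \<in> fst (snd (c a))" by metis
  define U where "U a = fst (snd (c a))" for a
  define V where "V a = fst (snd (snd (c a)))" for a
  define \<Psi> where "\<Psi> a = snd (snd (snd (c a)))" for a
  define i where "i a = fst (c a)" for a
  have ch: "open (U a)" "a \<in> U a" "U a \<subseteq> -{0}" "open (V a)"
     "homeomorphism (U a) (V a) (\<lambda>x. setc (i a) (F x) x) (\<Psi> a)"
     "holomorphic_map_on (\<lambda>x. setc (i a) (F x) x) (U a)" "holomorphic_map_on (\<Psi> a) (V a)" if "a \<in> X" for a
    using c[OF that] by (auto simp: chart_def case_prod_unfold U_def V_def \<Psi>_def i_def)
  \<comment> \<open>Countably many charts suffice; with a countable dense set of base points and the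
    finitely many axes they give a countable family of curves.\<close>
  obtain Fam where Fam: "Fam \<subseteq> U ` X" "countable Fam" "\<Union>Fam = \<Union>(U ` X)"
    using Lindelof[of "U ` X"] ch(1) by blast
  then obtain P where P: "countable P" "P \<subseteq> X" "Fam = U ` P"
    using countable_subset_image[of Fam U X] by blast
  obtain Q :: "(complex^'n) set" where Q: "countable Q" "\<And>Y. open Y \<Longrightarrow> Y \<noteq> {} \<Longrightarrow> \<exists>d\<in>Q. d \<in> Y"
    by (rule countable_dense_setE) (rule that)
  \<comment> \<open>For \<open>j\<close> other than \<open>i a\<close> this line lies in the
    coordinate hyperplane that represents the hypersurface in the chart.\<close>
  define line where "line a j q s = setc (i a) 0 q + s *s axis j 1" for a j q and s :: complex
  define D where "D a j q = {s. line a j q s \<in> V a}" for a j q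
  define E where "E a j q = {H :: complex^'n^'n. \<exists>s\<in>D a j q. H *v \<Psi> a (line a j q s) \<noteq> 0 \<and>
     (\<exists>c. pullback_form H A (\<Psi> a (line a j q s)) = c *s grad F (\<Psi> a (line a j q s)))}" for a j q
  have negE: "negligible (E a j q)" if a: "a \<in> X" for a j q
    unfolding E_def
  proof (rule negligible_tangent_along_curve[OF A codim card v0 Ghol])
    fix s assume "s \<in> D a j q"
    then have s: "line a j q s \<in> V a" by (simp add: D_def)
    show "\<Psi> a (line a j q s) \<noteq> 0"
      using homeomorphism_image2[OF ch(5)[OF a]] ch(3)[OF a] s by blast
    fix b
    have "hol_on (\<lambda>x. \<Psi> a x $ b) (V a)" using ch(7)[OF a] by (simp add: holomorphic_map_on_iff)
    from hol_on_line[OF this s[unfolded line_def]]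
    show "(\<lambda>s. \<Psi> a (line a j q s) $ b) field_differentiable (at s)"
      unfolding field_differentiable_def line_def by blast
  qed
  have "negligible (\<Union>t\<in>P \<times> (UNIV \<times> Q). E (fst t) (fst (snd t)) (snd (snd t)))"
    by (rule negligible_UN_countable)
       (use P Q(1) negE in \<open>auto intro!: countable_SIGMA countable_finite\<close>)
  moreover have "?Bad \<subseteq> (\<Union>t\<in>P \<times> (UNIV \<times> Q). E (fst t) (fst (snd t)) (snd (snd t)))"
  proof
    fix H assume "H \<in> ?Bad"
    then have H: "invertible H" and nt: "\<not> codim_at_least 2 (CARD('n) - 2) (restr_sing_set (pullback_form H A) F)"
      by (auto simp: transverse_to_def)
    from nt obtain m M where M: "M \<noteq> {}" "M \<subseteq> restr_sing_set (pullback_form H A) F"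
      "proj_submanifold m M" "\<not> m + 2 \<le> CARD('n) - 2"
      unfolding codim_at_least_def by blast
    define C where "C = proj_cone M"
    have CX: "v \<noteq> 0 \<and> F v = 0 \<and> (\<exists>c. pullback_form H A v = c *s grad F v)" if v: "v \<in> C" for v
    proof -
      have "v \<noteq> 0" "proj_point v \<in> restr_sing_set (pullback_form H A) F"
        using v M(2) by (auto simp: C_def proj_cone_def)
      then show ?thesis using restr_sing_set_iff[OF F d A H] by blast
    qed
    obtain p where p: "p \<in> M" using M(1) by blast
    then obtain v where v: "p = proj_point v" "v \<noteq> 0" using M(2) unfolding restr_sing_set_def by blast
    have vC: "v \<in> C" using p v by (simp add: C_def proj_cone_def)
    then have "v \<in> X" using CX by (simp add: X_def)
    then have "v \<in> \<Union>Fam" using Fam(3) ch(2) by blast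
    then obtain a where a: "a \<in> P" "v \<in> U a" using P(3) by blast
    have aX: "a \<in> X" using a P by blast
    have Msub: "complex_submanifold (m + 1) C" using M(3) by (simp add: C_def proj_submanifold_def)
    have "\<exists>j q s. q \<in> Q \<and> j \<noteq> i a \<and> setc (i a) 0 q + s *s axis j 1 \<in> V a \<and> \<Psi> a (setc (i a) 0 q + s *s axis j 1) \<in> C"
    proof (rule submanifold_meets_curve[where F = F, OF _ Msub _ vC ch(1)[OF aX] a(2) ch(4,5,6,7)[OF aX] _ Q(2)])
      \<comment> \<open>Failure of codimension two means \<open>m + 3 \<ge> CARD('n)\<close>: the
        cone, of dimension \<open>m + 1\<close>, has codimension at most one in the cone over the
        hypersurface.\<close>
      show "CARD('n) \<ge> 2" "CARD('n) \<le> m + 1 + 2" using card M(4) by auto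
      show "F x = 0" if "x \<in> C" for x using CX that by blast
    qed
    then obtain j q s where *: "q \<in> Q" "line a j q s \<in> V a" "\<Psi> a (line a j q s) \<in> C"
      unfolding line_def by blast
    have "H *v \<Psi> a (line a j q s) \<noteq> 0"
      using H CX[OF *(3)] by (metis matrix_left_invertible_ker invertible_def)
    then have "H \<in> E a j q" using * CX[OF *(3)] unfolding E_def D_def by blast
    then show "H \<in> (\<Union>t\<in>P \<times> (UNIV \<times> Q). E (fst t) (fst (snd t)) (snd (snd t)))"
      using a(1) *(1) by (intro UN_I[of "(a, j, q)"]) auto
  qed
  ultimately show ?thesis by (rule negligible_subset)
qed

section \<open>A point with nondegenerate Hessian\<close>

text \<open>Linear in the first argument, so that pairing a holomorphic disc with a fixed vector is
  holomorphic.\<close>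

definition herm :: "complex^'n \<Rightarrow> complex^'n \<Rightarrow> complex" where
  "herm x y = (\<Sum>i\<in>UNIV. x $ i * cnj (y $ i))"

lemma Re_herm: "Re (herm x y) = x \<bullet> y"
  by (simp add: herm_def inner_vec_def inner_complex_def)

lemma herm_self: "herm x x = of_real ((norm x)\<^sup>2)"
proof -
  have "herm x x = of_real (\<Sum>i\<in>UNIV. (cmod (x $ i))\<^sup>2)"
    by (simp only: herm_def of_real_sum complex_norm_square)
  also have "(\<Sum>i\<in>UNIV. (cmod (x $ i))\<^sup>2) = (norm x)\<^sup>2"
    by (simp add: power2_norm_eq_inner inner_vec_def)
  finally show ?thesis .
qed

lemma herm_diff_left: "herm (x - y) z = herm x z - herm y z"
  by (simp add: herm_def left_diff_distrib sum_subtractf)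

lemma herm_smult_left: "herm (c *s x) y = c * herm x y"
  by (simp add: herm_def sum_distrib_left mult.assoc)

lemma herm_smult_right: "herm x (c *s y) = cnj c * herm x y"
  by (simp add: herm_def sum_distrib_left mult_ac)

lemma norm_add_herm_orthogonal:
  assumes "herm y x = 0" shows "(norm (x + y))\<^sup>2 = (norm x)\<^sup>2 + (norm y)\<^sup>2"
proof -
  have "y \<bullet> x = 0" using assms Re_herm[of y x] by simp
  then show ?thesis by (simp add: power2_norm_eq_inner inner_add inner_commute)
qed

definition hess :: "(complex^'n \<Rightarrow> complex) \<Rightarrow> complex^'n \<Rightarrow> complex^'n \<Rightarrow> complex^'n" where
  "hess F p w = (\<chi> i. \<Sum>j\<in>UNIV. pd j (pd i F) p * w $ j)"

lemma hess_diff: "hess F p (v - w) = hess F p v - hess F p w"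
  by (simp add: hess_def vec_eq_iff algebra_simps sum_subtractf)

lemma hess_smult: "hess F p (c *s w) = c *s hess F p w"
  by (simp add: hess_def vec_eq_iff sum_distrib_left mult_ac)

lemma pd_has_derivative_hess:
  assumes "hol_on F UNIV"
  shows "(pd i F has_derivative (\<lambda>w. hess F p w $ i)) (at p)"
  using hol_on_has_derivative[OF hol_on_pd[OF assms open_UNIV] UNIV_I, of i p] by (simp add: hess_def)

lemma euler_identity:
  assumes F: "homogeneous_polynomial d F"
  shows "(\<Sum>i\<in>UNIV. p $ i * pd i F p) = of_nat d * F p"
proof -
  have "((\<lambda>s. F (s *s p)) has_field_derivative (\<Sum>a\<in>UNIV. pd a F (1 *s p) * p $ a)) (at 1)"
    by (rule hol_on_chain_1[OF homogeneous_polynomial_hol_on[OF F, of UNIV]])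
       (auto intro!: derivative_eq_intros)
  moreover have "((\<lambda>s. F (s *s p)) has_field_derivative (of_nat d * F p)) (at 1)"
    unfolding homogeneous_polynomial_scale[OF F] by (auto intro!: derivative_eq_intros)
  ultimately have "(\<Sum>a\<in>UNIV. pd a F (1 *s p) * p $ a) = of_nat d * F p" by (rule DERIV_unique)
  then show ?thesis by (simp add: mult.commute)
qed

text \<open>Euler's identity for the gradient, which is homogeneous of degree
  \<open>d - 1\<close>.\<close>

lemma hess_self:
  assumes F: "homogeneous_polynomial d F" and d: "d \<ge> 1" and p: "p \<noteq> 0"
  shows "hess F p p = of_nat (d - 1) *s grad F p"
proof -
  have "hess F p p $ i = of_nat (d - 1) * pd i F p" for i
  proof -
    have "((\<lambda>s. pd i F (s *s p)) has_field_derivative (\<Sum>a\<in>UNIV. pd a (pd i F) (1 *s p) * p $ a)) (at 1)"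
      by (rule hol_on_chain_1[OF hol_on_pd[OF homogeneous_polynomial_hol_on[OF F] open_UNIV]])
         (auto intro!: derivative_eq_intros)
    moreover have "((\<lambda>s. pd i F (s *s p)) has_field_derivative (of_nat (d - 1) * pd i F p)) (at 1)"
    proof (rule has_field_derivative_transform_within_open[where S = "- {0}"])
      show "((\<lambda>s. s ^ (d - 1) * pd i F p) has_field_derivative (of_nat (d - 1) * pd i F p)) (at (1 :: complex))"
        by (auto intro!: derivative_eq_intros)
      fix s :: complex assume "s \<in> - {0}"
      then show "s ^ (d - 1) * pd i F p = pd i F (s *s p)"
        using grad_scale[OF F d, of s p] p by (simp add: vec_eq_iff)
    qed (auto simp: open_Compl)
    ultimately have "(\<Sum>a\<in>UNIV. pd a (pd i F) (1 *s p) * p $ a) = of_nat (d - 1) * pd i F p"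
      by (rule DERIV_unique)
    then show ?thesis by (simp add: hess_def)
  qed
  then show ?thesis by (simp add: vec_eq_iff)
qed

text \<open>Euler's identity differentiated in the direction \<open>w\<close>.\<close>

lemma sum_hess:
  assumes F: "homogeneous_polynomial d F"
  shows "(\<Sum>i\<in>UNIV. p $ i * hess F p w $ i) = (of_nat d - 1) * (\<Sum>i\<in>UNIV. pd i F p * w $ i)"
proof -
  have hol: "hol_on F UNIV" by (rule homogeneous_polynomial_hol_on[OF F])
  have 1: "((\<lambda>s. F (p + s *s w)) has_field_derivative (\<Sum>a\<in>UNIV. pd a F p * w $ a)) (at 0)"
    using hol_on_line[OF hol, of p 0 w] by simp
  have 2: "((\<lambda>s. pd i F (p + s *s w)) has_field_derivative hess F p w $ i) (at 0)" for i
    using hol_on_line[OF hol_on_pd[OF hol open_UNIV], of p 0 w i] by (simp add: hess_def)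
  have 3: "((\<lambda>s. (p + s *s w) $ i) has_field_derivative w $ i) (at 0)" for i
    by (auto intro!: derivative_eq_intros)
  have "((\<lambda>s. \<Sum>i\<in>UNIV. (p + s *s w) $ i * pd i F (p + s *s w)) has_field_derivative
      (\<Sum>i\<in>UNIV. (p + 0 *s w) $ i * hess F p w $ i + w $ i * pd i F (p + 0 *s w))) (at 0)"
    by (intro DERIV_sum DERIV_mult' 2 3)
  moreover have "((\<lambda>s. \<Sum>i\<in>UNIV. (p + s *s w) $ i * pd i F (p + s *s w)) has_field_derivative
      of_nat d * (\<Sum>a\<in>UNIV. pd a F p * w $ a)) (at 0)"
    unfolding euler_identity[OF F] by (rule DERIV_cmult[OF 1])
  ultimately have "(\<Sum>i\<in>UNIV. (p + 0 *s w) $ i * hess F p w $ i + w $ i * pd i F (p + 0 *s w)) =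
     of_nat d * (\<Sum>a\<in>UNIV. pd a F p * w $ a)" by (rule DERIV_unique)
  then show ?thesis by (simp add: sum.distrib algebra_simps)
qed

section \<open>Zeros, the maximum principle and discs in a hypersurface\<close>

lemma exists_zero:
  fixes F :: "complex^'n \<Rightarrow> complex"
  assumes F: "homogeneous_polynomial d F" and d: "d \<ge> 1" and card: "CARD('n) \<ge> 2"
  shows "\<exists>v. v \<noteq> 0 \<and> F v = 0"
proof -
  obtain J :: "'n set" where "card J = 2"
    using card obtain_subset_with_card_n[of 2 "UNIV :: 'n set"] by metis
  then obtain a b :: 'n where ab: "a \<noteq> b" by (auto simp: card_Suc_eq numeral_eq_Suc)
  let ?m = "cmod (F (axis b 1))"
  show ?thesis
  proof (cases "F (axis b 1) = 0")
    case True
    then show ?thesis by (intro exI[of _ "axis b 1"]) (simp add: axis_eq_0_iff)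
  next
    case False
    \<comment> \<open>On this affine line \<open>F (axis b 1)\<close> is the coefficient of
      \<open>s ^ d\<close>, so \<open>P\<close> tends to infinity and has a zero by Liouville's
      theorem.\<close>
    define P where "P s = F (axis a 1 + s *s axis b 1)" for s
    have "P holomorphic_on UNIV"
      unfolding P_def holomorphic_on_open[OF open_UNIV]
      using hol_on_line[OF homogeneous_polynomial_hol_on[OF F, of UNIV] UNIV_I] by blast
    moreover have "eventually (\<lambda>s. cmod (P s) \<ge> B) at_infinity" for B
    proof -
      have "((\<lambda>s. inverse s *s axis a (1::complex) + axis b 1) \<longlongrightarrow> 0 *s axis a 1 + axis b 1) at_infinity"
        unfolding vector_scalar_mult_def
        by (intro tendsto_add tendsto_vec_lambda tendsto_mult tendsto_inverse_0 tendsto_const)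
      then have "((\<lambda>s. F (inverse s *s axis a 1 + axis b 1)) \<longlongrightarrow> F (0 *s axis a 1 + axis b 1)) at_infinity"
        using hol_on_continuous[OF homogeneous_polynomial_hol_on[OF F, of UNIV]]
        by (intro isCont_tendsto_compose[of _ F]) (auto simp: continuous_on_eq_continuous_at)
      then have "((\<lambda>s. cmod (F (inverse s *s axis a 1 + axis b 1))) \<longlongrightarrow> ?m) at_infinity"
        by (intro tendsto_norm) simp
      then have 1: "eventually (\<lambda>s. cmod (F (inverse s *s axis a 1 + axis b 1)) > ?m / 2) at_infinity"
        by (rule order_tendstoD) (use False in simp)
      have 2: "eventually (\<lambda>s :: complex. cmod s \<ge> max 1 (2 * \<bar>B\<bar> / ?m)) at_infinity"
        unfolding eventually_at_infinity by blast
      show ?thesis using 1 2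
      proof eventually_elim
        case (elim s)
        then have s: "s \<noteq> 0" "cmod s \<ge> 1" "cmod s \<ge> 2 * \<bar>B\<bar> / ?m" by auto
        have e: "axis a 1 + s *s axis b 1 = s *s (inverse s *s axis a 1 + axis b 1)"
          using s(1) by (simp add: vec_eq_iff algebra_simps)
        have P: "P s = s ^ d * F (inverse s *s axis a 1 + axis b 1)"
          unfolding P_def by (subst e) (rule homogeneous_polynomial_scale[OF F])
        have "2 * \<bar>B\<bar> / ?m \<le> cmod s ^ d"
          using s(3) self_le_power[OF s(2), of d] d by linarith
        then have "2 * \<bar>B\<bar> / ?m * (?m / 2) \<le> cmod s ^ d * cmod (F (inverse s *s axis a 1 + axis b 1))"
          using elim(1) by (intro mult_mono) auto
        then show "B \<le> cmod (P s)" using False unfolding P norm_mult norm_power by simp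
      qed
    qed
    ultimately obtain s where "P s = 0" using Liouville_weak_inverse by blast
    moreover have "axis a 1 + s *s axis b 1 \<noteq> (0 :: complex^'n)"
      using ab by (auto simp: vec_eq_iff axis_def)
    ultimately show ?thesis unfolding P_def by blast
  qed
qed

text \<open>The maximum principle for \<open>1 / f\<close>: if the modulus of \<open>f\<close>
  exceeded 1 on the whole circle, that of \<open>1 / f\<close> would be below 1 at the centre, where
  it equals 1.\<close>

lemma exists_small_modulus:
  fixes f :: "complex \<Rightarrow> complex"
  assumes f: "f holomorphic_on ball 0 R" and nz: "\<And>z. z \<in> ball 0 R \<Longrightarrow> f z \<noteq> 0" and f0: "f 0 = 1"
    and r: "0 < r" "r < R"
  shows "\<exists>z. cmod z = r \<and> cmod (f z) \<le> 1"
proof (rule ccontr)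
  assume contr: "\<not> ?thesis"
  have gt: "cmod (f z) > 1" if "cmod z = r" for z
  proof (rule ccontr)
    assume "\<not> cmod (f z) > 1"
    then have "cmod (f z) \<le> 1" by simp
    with contr that show False by blast
  qed
  have sub: "cball 0 r \<subseteq> ball 0 R" using r by auto
  have cont: "continuous_on (cball 0 r) f"
    by (rule continuous_on_subset[OF holomorphic_on_imp_continuous_on[OF f] sub])
  have ne: "sphere (0::complex) r \<noteq> {}" using r by auto
  have "continuous_on (sphere 0 r) (\<lambda>z. cmod (f z))"
    by (intro continuous_intros continuous_on_subset[OF cont]) auto
  from continuous_attains_inf[OF compact_sphere ne this]
  obtain z0 where z0: "cmod z0 = r" "\<And>z. cmod z = r \<Longrightarrow> cmod (f z0) \<le> cmod (f z)" by auto
  have "cmod (1 / f 0) \<le> 1 / cmod (f z0)"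
  proof (rule maximum_modulus_frontier[of "\<lambda>z. 1 / f z" "cball 0 r"])
    show "(\<lambda>z. 1 / f z) holomorphic_on interior (cball 0 r)"
      using r by (intro holomorphic_intros holomorphic_on_subset[OF f]) (auto simp: nz)
    show "continuous_on (closure (cball 0 r)) (\<lambda>z. 1 / f z)"
      using r by (intro continuous_intros) (auto simp: nz cont)
    fix z :: complex assume "z \<in> frontier (cball 0 r)"
    then have z: "cmod z = r" using r by (simp add: frontier_cball)
    have "cmod (f z0) > 0" using gt[OF z0(1)] by linarith
    then show "cmod (1 / f z) \<le> 1 / cmod (f z0)"
      using z0(2)[OF z] by (simp add: norm_divide frac_le)
  qed (use r in auto)
  moreover have "1 / cmod (f z0) < 1" using gt[OF z0(1)] by (subst divide_less_eq_1_pos) auto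
  ultimately show False using f0 by simp
qed

lemma hol_on_compose_holomorphic:
  assumes "hol_on g T" "open S" "\<And>a. (\<lambda>s. \<gamma> s $ a) holomorphic_on S" "\<And>s. s \<in> S \<Longrightarrow> \<gamma> s \<in> T"
  shows "(\<lambda>s. g (\<gamma> s)) holomorphic_on S"
  unfolding holomorphic_on_open[OF assms(2)]
proof
  fix s assume s: "s \<in> S"
  have "((\<lambda>s. \<gamma> s $ a) has_field_derivative deriv (\<lambda>s. \<gamma> s $ a) s) (at s)" for a
    by (rule holomorphic_derivI[OF assms(3) assms(2) s])
  from hol_on_chain_1[OF assms(1) this assms(4)[OF s]]
  show "\<exists>f'. ((\<lambda>s. g (\<gamma> s)) has_field_derivative f') (at s)" by blast
qed

text \<open>A line in the straightening chart, pulled back. All coordinates except the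
  \<open>i\<close>-th are affine in \<open>s\<close>; the derivative of the \<open>i\<close>-th is
  then forced by \<open>F (\<gamma> s) = 0\<close> and the tangency of \<open>w\<close>.\<close>

lemma curve_in_hypersurface:
  fixes F :: "complex^'n \<Rightarrow> complex"
  assumes hol: "hol_on F UNIV" and p: "F p = 0" "pd i F p \<noteq> 0" and w: "(\<Sum>j\<in>UNIV. pd j F p * w $ j) = 0"
  shows "\<exists>\<epsilon> \<gamma>. \<epsilon> > 0 \<and> \<gamma> 0 = p \<and> (\<forall>c. (\<lambda>s. \<gamma> s $ c) holomorphic_on ball 0 \<epsilon>) \<and>
    (\<forall>s\<in>ball 0 \<epsilon>. F (\<gamma> s) = 0) \<and> (\<forall>c. ((\<lambda>s. \<gamma> s $ c) has_field_derivative w $ c) (at 0))"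
proof -
  obtain U V \<Psi> where U: "open U" "p \<in> U" "U \<subseteq> UNIV" "open V"
      "homeomorphism U V (\<lambda>x. setc i (F x) x) \<Psi>"
      "holomorphic_map_on (\<lambda>x. setc i (F x) x) U" "holomorphic_map_on \<Psi> V"
    by (rule level_set_chart[OF hol open_UNIV UNIV_I p(2)]) (rule that)
  let ?\<Phi> = "\<lambda>x. setc i (F x) x"
  define l where "l s = ?\<Phi> p + s *s setc i 0 w" for s
  have lV: "open (l -` V)"
    unfolding l_def by (rule open_vimage[OF U(4)]) (intro continuous_intros)
  have l0: "l 0 = ?\<Phi> p" by (simp add: l_def vec_eq_iff)
  then have "0 \<in> l -` V" using homeomorphism_image1[OF U(5)] U(2) by auto
  then obtain \<epsilon> where \<epsilon>: "\<epsilon> > 0" "ball 0 \<epsilon> \<subseteq> l -` V"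
    using lV open_contains_ball by blast
  define \<gamma> where "\<gamma> s = \<Psi> (l s)" for s
  have \<gamma>0: "\<gamma> 0 = p" unfolding \<gamma>_def l0 by (rule homeomorphism_apply1[OF U(5,2)])
  have \<Phi>\<gamma>: "?\<Phi> (\<gamma> s) = l s" if "s \<in> ball 0 \<epsilon>" for s
    unfolding \<gamma>_def by (rule homeomorphism_apply2[OF U(5)]) (use \<epsilon> that in blast)
  have zero: "F (\<gamma> s) = 0" if "s \<in> ball 0 \<epsilon>" for s
  proof -
    have "F (\<gamma> s) = ?\<Phi> (\<gamma> s) $ i" by simp
    also have "\<dots> = 0" unfolding \<Phi>\<gamma>[OF that] by (simp add: l_def p(1))
    finally show ?thesis .
  qed
  have other: "\<gamma> s $ c = p $ c + s * w $ c" if "s \<in> ball 0 \<epsilon>" "c \<noteq> i" for s c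
  proof -
    have "\<gamma> s $ c = ?\<Phi> (\<gamma> s) $ c" using that(2) by simp
    also have "\<dots> = p $ c + s * w $ c" unfolding \<Phi>\<gamma>[OF that(1)] using that(2) by (simp add: l_def)
    finally show ?thesis .
  qed
  have hol\<gamma>: "(\<lambda>s. \<gamma> s $ c) holomorphic_on ball 0 \<epsilon>" for c
    unfolding \<gamma>_def
  proof (rule hol_on_compose_holomorphic[of "\<lambda>x. \<Psi> x $ c" V])
    show "hol_on (\<lambda>x. \<Psi> x $ c) V" using U(7) by (simp add: holomorphic_map_on_iff)
    show "(\<lambda>s. l s $ a) holomorphic_on ball 0 \<epsilon>" for a
      unfolding l_def vector_add_component vector_smult_component by (intro holomorphic_intros)
  qed (use \<epsilon> in auto)
  have der: "((\<lambda>s. \<gamma> s $ c) has_field_derivative deriv (\<lambda>s. \<gamma> s $ c) 0) (at 0)" for c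
    by (rule holomorphic_derivI[OF hol\<gamma>]) (use \<epsilon> in auto)
  have deq: "deriv (\<lambda>s. \<gamma> s $ c) 0 = w $ c" if "c \<noteq> i" for c
  proof (rule DERIV_unique[OF der])
    have "((\<lambda>s. p $ c + s * w $ c) has_field_derivative w $ c) (at 0)"
      by (auto intro!: derivative_eq_intros)
    then show "((\<lambda>s. \<gamma> s $ c) has_field_derivative w $ c) (at 0)"
      by (rule has_field_derivative_transform_within_open[of _ _ _ "ball 0 \<epsilon>"]) (use \<epsilon> other that in auto)
  qed
  have "deriv (\<lambda>s. \<gamma> s $ i) 0 = w $ i"
  proof -
    have "((\<lambda>s. F (\<gamma> s)) has_field_derivative (\<Sum>a\<in>UNIV. pd a F (\<gamma> 0) * deriv (\<lambda>s. \<gamma> s $ a) 0)) (at 0)"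
      by (rule hol_on_chain_1[OF hol der UNIV_I])
    moreover have "((\<lambda>s. F (\<gamma> s)) has_field_derivative 0) (at 0)"
      by (rule has_field_derivative_transform_within_open[OF DERIV_const, of "ball 0 \<epsilon>"])
         (use \<epsilon> zero in auto)
    ultimately have "(\<Sum>a\<in>UNIV. pd a F p * deriv (\<lambda>s. \<gamma> s $ a) 0) = 0"
      using DERIV_unique \<gamma>0 by metis
    then have "(\<Sum>a\<in>UNIV. pd a F p * deriv (\<lambda>s. \<gamma> s $ a) 0) - (\<Sum>a\<in>UNIV. pd a F p * w $ a) = 0"
      using w by simp
    then have "(\<Sum>a\<in>UNIV. pd a F p * (deriv (\<lambda>s. \<gamma> s $ a) 0 - w $ a)) = 0"
      by (simp add: right_diff_distrib sum_subtractf)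
    moreover have "(\<Sum>a\<in>UNIV. pd a F p * (deriv (\<lambda>s. \<gamma> s $ a) 0 - w $ a)) =
        pd i F p * (deriv (\<lambda>s. \<gamma> s $ i) 0 - w $ i)"
      by (subst sum.remove[of _ i]) (auto simp: deq intro!: sum.neutral)
    ultimately show ?thesis using p(2) by simp
  qed
  then have "deriv (\<lambda>s. \<gamma> s $ c) 0 = w $ c" for c using deq by (cases "c = i") auto
  then have "\<forall>c. ((\<lambda>s. \<gamma> s $ c) has_field_derivative w $ c) (at 0)" using der by metis
  then show ?thesis using \<epsilon>(1) \<gamma>0 hol\<gamma> zero by (intro exI[of _ \<epsilon>] exI[of _ \<gamma>]) simp
qed

lemma exists_nonzero_ball:
  fixes f :: "complex \<Rightarrow> complex"
  assumes "continuous_on (ball 0 \<epsilon>) f" "f 0 \<noteq> 0" "\<epsilon> > 0"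
  shows "\<exists>R>0. R \<le> \<epsilon> \<and> (\<forall>s\<in>ball 0 R. f s \<noteq> 0)"
proof -
  have "open (ball 0 \<epsilon> \<inter> f -` (- {0}))"
    by (rule continuous_open_preimage[OF assms(1)]) (auto simp: open_Compl)
  moreover have "0 \<in> ball 0 \<epsilon> \<inter> f -` (- {0})" using assms by simp
  ultimately obtain R where R: "R > 0" "ball 0 R \<subseteq> ball 0 \<epsilon> \<inter> f -` (- {0})"
    using open_contains_ball by blast
  then have "\<forall>s\<in>ball 0 (min R \<epsilon>). f s \<noteq> 0" by auto
  then show ?thesis using R(1) assms(3) by (intro exI[of _ "min R \<epsilon>"]) auto
qed

text \<open>On a disc \<open>q\<close> in the hypersurface, derived from the kernel direction, the
  gradient is \<open>m s *s \<xi> + e s\<close> with \<open>e s\<close> orthogonal to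
  \<open>\<xi>\<close> and of order o(s). The maximum principle gives arbitrarily small
  \<open>s\<close> with \<open>m s\<close> of modulus at most 1, where minimality forces
  \<open>a * norm (q s - p) \<le> norm (e s)\<close>; but the left side is of exact order
  \<open>cmod s\<close>.\<close>

lemma minimal_gradient_hess_nondegenerate:
  fixes F :: "complex^'n \<Rightarrow> complex"
  assumes F: "smooth_hypersurface_eq d F" and d: "d \<ge> 2"
    and p: "norm p = 1" "F p = 0"
    and min: "\<And>v. v \<noteq> 0 \<Longrightarrow> F v = 0 \<Longrightarrow> norm (grad F p) * norm v ^ (d - 1) \<le> norm (grad F v)"
    and w: "hess F p w = 0"
  shows "w = 0"
proof (rule ccontr)
  assume w0: "w \<noteq> 0"
  have Fp: "homogeneous_polynomial d F" using F by (simp add: smooth_hypersurface_eq_def)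
  have hol: "hol_on F UNIV" by (rule homogeneous_polynomial_hol_on[OF Fp])
  have pne: "p \<noteq> 0" using p(1) by auto
  have gne: "grad F p \<noteq> 0" by (rule grad_nonzero[OF F pne p(2)])
  then obtain i where i: "pd i F p \<noteq> 0" by (auto simp: vec_eq_iff)
  \<comment> \<open>Pairing \<open>hess F p w = 0\<close> with \<open>p\<close> shows that
    \<open>w\<close> is tangent to the hypersurface, as \<open>d - 1\<close> is nonzero.\<close>
  have dw: "(\<Sum>j\<in>UNIV. pd j F p * w $ j) = 0"
  proof -
    have "(of_nat d - 1) * (\<Sum>j\<in>UNIV. pd j F p * w $ j) = 0"
      using sum_hess[OF Fp, of p w] w by simp
    moreover have "of_nat d - (1 :: complex) \<noteq> 0" using d by (simp add: of_nat_eq_1_iff)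
    ultimately show ?thesis by simp
  qed
  obtain \<epsilon> and \<gamma> :: "complex \<Rightarrow> complex^'n" where \<gamma>: "\<epsilon> > 0" "\<gamma> 0 = p" "\<forall>c. (\<lambda>s. \<gamma> s $ c) holomorphic_on ball 0 \<epsilon>"
    "\<forall>s\<in>ball 0 \<epsilon>. F (\<gamma> s) = 0" "\<forall>c. ((\<lambda>s. \<gamma> s $ c) has_field_derivative w $ c) (at 0)"
    using curve_in_hypersurface[OF hol p(2) i dw] by (elim exE conjE) (rule that)
  define \<xi> where "\<xi> = grad F p"
  define a where "a = norm \<xi>"
  have a: "a > 0" using gne by (simp add: a_def \<xi>_def)
  define h where "h s = herm (\<gamma> s) p" for s
  have hhol: "h holomorphic_on ball 0 \<epsilon>"
    unfolding h_def herm_def using \<gamma>(3) by (intro holomorphic_intros) auto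
  have h0: "h 0 = 1" by (simp add: h_def \<gamma>(2) herm_self p(1))
  obtain R1 where R1: "R1 > 0" "R1 \<le> \<epsilon>" "\<forall>s\<in>ball 0 R1. h s \<noteq> 0"
    using exists_nonzero_ball[OF holomorphic_on_imp_continuous_on[OF hhol]] h0 \<gamma>(1) by auto
  \<comment> \<open>This scaling makes \<open>q s - p\<close> orthogonal to \<open>p\<close>, so
    that Pythagoras computes \<open>norm (q s)\<close>.\<close>
  define q where "q s = inverse (h s) *s \<gamma> s" for s
  have sub1: "ball (0::complex) R1 \<subseteq> ball 0 \<epsilon>" using R1 by auto
  have qhol: "(\<lambda>s. q s $ c) holomorphic_on ball 0 R1" for c
    unfolding q_def vector_smult_component using R1(3) \<gamma>(3)
    by (intro holomorphic_intros holomorphic_on_subset[OF hhol sub1] holomorphic_on_subset[OF _ sub1]) auto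
  have q0: "q 0 = p" by (simp add: q_def h0 \<gamma>(2))
  have Fq: "F (q s) = 0" if "s \<in> ball 0 R1" for s
    using \<gamma>(4) sub1 that by (auto simp: q_def homogeneous_polynomial_scale[OF Fp])
  have qp: "herm (q s - p) p = 0" if "s \<in> ball 0 R1" for s
    using R1(3) that by (simp add: herm_diff_left herm_self p(1) q_def herm_smult_left flip: h_def)
  have normq: "(norm (q s))\<^sup>2 = 1 + (norm (q s - p))\<^sup>2" if "s \<in> ball 0 R1" for s
    using norm_add_herm_orthogonal[OF qp[OF that]] p(1) by simp
  define \<eta> where "\<eta> = herm w p"
  define w' where "w' = w - \<eta> *s p"
  have hd: "(h has_field_derivative \<eta>) (at 0)"
    unfolding h_def herm_def \<eta>_def using \<gamma>(5) by (intro DERIV_sum DERIV_cmult_right) auto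
  have qd: "((\<lambda>s. q s $ c) has_field_derivative w' $ c) (at 0)" for c
  proof -
    have "((\<lambda>s. \<gamma> s $ c / h s) has_field_derivative (w $ c * h 0 - \<gamma> 0 $ c * \<eta>) / (h 0 * h 0)) (at 0)"
      by (rule DERIV_divide[OF _ hd]) (use \<gamma>(5) h0 in auto)
    then show ?thesis by (simp add: q_def w'_def h0 \<gamma>(2) divide_inverse mult_ac)
  qed
  have hw': "hess F p w' = (- \<eta> * of_nat (d - 1)) *s \<xi>"
    using d pne by (simp add: w'_def hess_diff hess_smult w hess_self[OF Fp] \<xi>_def vector_smult_assoc vec_eq_iff)
      (simp add: algebra_simps)
  \<comment> \<open>Otherwise \<open>w\<close> would be a multiple of \<open>p\<close>, which the
    Hessian sends to a nonzero multiple of the gradient.\<close>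
  have w'0: "w' \<noteq> 0"
  proof
    assume w'z: "w' = 0"
    then have "hess F p w' = 0" by (simp add: hess_def vec_eq_iff)
    then have "(- \<eta> * of_nat (d - 1)) *s \<xi> = 0" using hw' by simp
    then have "\<eta> = 0" using gne d by (auto simp: \<xi>_def vec_eq_iff)
    then show False using w'z w0 by (simp add: w'_def)
  qed
  define G where "G s = grad F (q s)" for s
  have Ghol: "(\<lambda>s. G s $ c) holomorphic_on ball 0 R1" for c
    unfolding G_def grad_nth
    by (rule hol_on_compose_holomorphic[OF hol_on_pd[OF hol open_UNIV] open_ball qhol UNIV_I])
  have G0: "G 0 = \<xi>" by (simp add: G_def q0 \<xi>_def)
  have Gd: "((\<lambda>s. G s $ c) has_field_derivative (- \<eta> * of_nat (d - 1)) * \<xi> $ c) (at 0)" for c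
  proof -
    have "((\<lambda>s. pd c F (q s)) has_field_derivative (\<Sum>a\<in>UNIV. pd a (pd c F) (q 0) * w' $ a)) (at 0)"
      by (rule hol_on_chain_1[OF hol_on_pd[OF hol open_UNIV] qd UNIV_I])
    moreover have "(\<Sum>a\<in>UNIV. pd a (pd c F) (q 0) * w' $ a) = hess F p w' $ c"
      by (simp add: hess_def q0)
    ultimately show ?thesis by (simp add: G_def hw')
  qed
  define m where "m s = herm (G s) \<xi> / of_real (a\<^sup>2)" for s
  have mhol: "m holomorphic_on ball 0 R1"
    unfolding m_def herm_def using a by (intro holomorphic_intros Ghol) auto
  have m0: "m 0 = 1" using a by (simp add: m_def G0 herm_self a_def)
  obtain R where R: "R > 0" "R \<le> R1" "\<forall>s\<in>ball 0 R. m s \<noteq> 0"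
    using exists_nonzero_ball[OF holomorphic_on_imp_continuous_on[OF mhol]] m0 R1(1) by auto
  define e where "e s = G s - m s *s \<xi>" for s
  have he: "herm (e s) (m s *s \<xi>) = 0" for s
    using a by (simp add: e_def herm_smult_right herm_diff_left herm_smult_left herm_self m_def a_def)
  have normG: "(norm (G s))\<^sup>2 = (cmod (m s))\<^sup>2 * a\<^sup>2 + (norm (e s))\<^sup>2" for s
    using norm_add_herm_orthogonal[OF he[of s]] by (simp add: e_def a_def power_mult_distrib)
  have md: "(m has_field_derivative - \<eta> * of_nat (d - 1)) (at 0)"
  proof -
    have "(m has_field_derivative (\<Sum>c\<in>UNIV. (- \<eta> * of_nat (d - 1)) * \<xi> $ c * cnj (\<xi> $ c)) / of_real (a\<^sup>2)) (at 0)"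
      unfolding m_def herm_def by (intro DERIV_cdivide DERIV_sum DERIV_cmult_right Gd)
    moreover have "(\<Sum>c\<in>UNIV. (- \<eta> * of_nat (d - 1)) * \<xi> $ c * cnj (\<xi> $ c)) = (- \<eta> * of_nat (d - 1)) * herm \<xi> \<xi>"
      by (simp only: herm_def sum_distrib_left mult.assoc)
    moreover have "herm \<xi> \<xi> = of_real (a\<^sup>2)" by (simp only: herm_self a_def)
    ultimately show ?thesis using a by simp
  qed
  have ed: "(e has_derivative (\<lambda>s. 0)) (at 0)"
  proof (rule has_derivative_vecI)
    fix c
    have "((\<lambda>s. G s $ c - m s * \<xi> $ c) has_field_derivative
       (- \<eta> * of_nat (d - 1)) * \<xi> $ c - (- \<eta> * of_nat (d - 1)) * \<xi> $ c) (at 0)"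
      by (intro DERIV_diff Gd DERIV_cmult_right md)
    then show "((\<lambda>s. e s $ c) has_derivative (\<lambda>w. 0 $ c)) (at 0)"
      by (simp add: e_def has_field_derivative_def lambda_zero)
  qed
  have qder: "(q has_derivative (\<lambda>s. s *s w')) (at 0)"
  proof (rule has_derivative_vecI)
    fix c show "((\<lambda>s. q s $ c) has_derivative (\<lambda>s. (s *s w') $ c)) (at 0)"
      using qd[of c] by (simp add: has_field_derivative_def mult_commute_abs)
  qed
  define W where "W = norm w'"
  have W: "W > 0" using w'0 by (simp add: W_def)
  have e0: "e 0 = 0" by (simp add: e_def G0 m0)
  \<comment> \<open>The factors 1/4 here and 1/2 below leave a gap: at radius \<open>r\<close> they
    give \<open>norm (e s) \<le> a * W * r / 4\<close> but
    \<open>a * norm (q s - p) \<ge> a * W * r / 2\<close>.\<close>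
  from ed[unfolded has_derivative_at_alt, THEN conjunct2, rule_format, of "a * W / 4"]
  obtain \<delta>1 where \<delta>1: "\<delta>1 > 0" "\<And>s. cmod s < \<delta>1 \<Longrightarrow> norm (e s) \<le> a * W / 4 * cmod s"
    using a W e0 by auto
  from qder[unfolded has_derivative_at_alt, THEN conjunct2, rule_format, of "W / 2"]
  obtain \<delta>2 where \<delta>2: "\<delta>2 > 0" "\<And>s. cmod s < \<delta>2 \<Longrightarrow> norm (q s - p - s *s w') \<le> W / 2 * cmod s"
    using W q0 by auto
  define r where "r = min (min \<delta>1 \<delta>2) R / 2"
  have r: "r > 0" "r < \<delta>1" "r < \<delta>2" "r < R" using \<delta>1(1) \<delta>2(1) R(1) by (auto simp: r_def)
  have "m holomorphic_on ball 0 R"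
    by (rule holomorphic_on_subset[OF mhol]) (use R in auto)
  from exists_small_modulus[OF this _ m0 r(1,4)] R(3)
  obtain s where s: "cmod s = r" "cmod (m s) \<le> 1" by auto
  have sR: "s \<in> ball 0 R1" using s r R by auto
  have "W * r = norm (s *s w')" by (simp add: W_def s(1) mult.commute)
  also have "\<dots> \<le> norm (q s - p) + norm (q s - p - s *s w')"
    using norm_triangle_ineq4[of "q s - p" "q s - p - s *s w'"] by simp
  also have "\<dots> \<le> norm (q s - p) + W / 2 * r" using \<delta>2(2)[of s] s(1) r by simp
  finally have vlow: "W / 2 * r \<le> norm (q s - p)" by simp
  have n1: "norm (q s) \<ge> 1"
  proof -
    have "1\<^sup>2 \<le> (norm (q s))\<^sup>2" using normq[OF sR] by simp
    then show ?thesis by (rule power2_le_imp_le) simp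
  qed
  have qs0: "q s \<noteq> 0" using n1 by auto
  have "a * norm (q s) \<le> a * norm (q s) ^ (d - 1)"
    using a n1 d self_le_power[OF n1, of "d - 1"] by simp
  also have "\<dots> \<le> norm (G s)" using min[OF qs0 Fq[OF sR]] by (simp add: a_def \<xi>_def G_def)
  finally have "(a * norm (q s))\<^sup>2 \<le> (norm (G s))\<^sup>2" using a by (intro power_mono) auto
  then have "a\<^sup>2 * (1 + (norm (q s - p))\<^sup>2) \<le> (cmod (m s))\<^sup>2 * a\<^sup>2 + (norm (e s))\<^sup>2"
    by (simp add: power_mult_distrib normq[OF sR] normG)
  moreover have "(cmod (m s))\<^sup>2 * a\<^sup>2 \<le> 1 * a\<^sup>2"
    using s(2) by (intro mult_right_mono) (auto simp: power_le_one)
  moreover have "(norm (e s))\<^sup>2 \<le> (a * W / 4 * r)\<^sup>2"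
    using \<delta>1(2)[of s] s(1) r by (intro power_mono) auto
  moreover have "a\<^sup>2 * (W / 2 * r)\<^sup>2 \<le> a\<^sup>2 * (norm (q s - p))\<^sup>2"
    using vlow W r by (intro mult_left_mono power_mono) auto
  ultimately have "a\<^sup>2 * (W / 2 * r)\<^sup>2 \<le> (a * W / 4 * r)\<^sup>2" by (simp add: algebra_simps)
  moreover have "(a * W / 4 * r)\<^sup>2 = (a * W * r)\<^sup>2 / 16" "a\<^sup>2 * (W / 2 * r)\<^sup>2 = (a * W * r)\<^sup>2 / 4"
    by (simp_all add: power_mult_distrib power_divide)
  moreover have "(a * W * r)\<^sup>2 > 0" using a W r by simp
  ultimately show False by linarith
qed

text \<open>The minimum is taken over the compact set of unit vectors on the cone over the
  hypersurface; homogeneity extends the inequality to vectors of any norm.\<close>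

lemma exists_hess_nondegenerate:
  fixes F :: "complex^'n \<Rightarrow> complex"
  assumes F: "smooth_hypersurface_eq d F" and d: "d \<ge> 2" and card: "CARD('n) \<ge> 2"
  shows "\<exists>p. p \<noteq> 0 \<and> F p = 0 \<and> (\<forall>w. hess F p w = 0 \<longrightarrow> w = 0)"
proof -
  have Fp: "homogeneous_polynomial d F" using F by (simp add: smooth_hypersurface_eq_def)
  have hol: "hol_on F UNIV" by (rule homogeneous_polynomial_hol_on[OF Fp])
  define K where "K = {v. norm v = 1 \<and> F v = 0}"
  define unit where "unit v = inverse (of_real (norm v)) *s v" for v :: "complex^'n"
  have unit: "unit v \<in> K" if "v \<noteq> 0" "F v = 0" for v
    using that by (simp add: K_def unit_def homogeneous_polynomial_scale[OF Fp] norm_inverse)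
  obtain v where "v \<noteq> 0" "F v = 0" using exists_zero[OF Fp _ card] d by auto
  then have Kne: "K \<noteq> {}" using unit by blast
  have "closed (F -` {0})"
    using continuous_closed_vimage[of "{0}" F] hol_on_continuous[OF hol] by (simp add: continuous_on_eq_continuous_at)
  moreover have "K = sphere 0 1 \<inter> F -` {0}" by (auto simp: K_def)
  ultimately have "compact K" using compact_Int_closed[OF compact_sphere] by metis
  moreover have "continuous_on K (\<lambda>v. norm (grad F v))"
    unfolding grad_def
    by (intro continuous_on_norm continuous_on_vec_lambda continuous_on_subset[OF continuous_on_pd[OF hol open_UNIV]]) auto
  ultimately obtain p where p: "p \<in> K" "\<And>v. v \<in> K \<Longrightarrow> norm (grad F p) \<le> norm (grad F v)"
    using continuous_attains_inf[OF _ Kne] by blast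
  have "norm (grad F p) * norm v ^ (d - 1) \<le> norm (grad F v)" if v: "v \<noteq> 0" "F v = 0" for v
  proof -
    have "grad F (unit v) = inverse (of_real (norm v)) ^ (d - 1) *s grad F v"
      unfolding unit_def using v d by (intro grad_scale[OF Fp]) auto
    then have "norm (grad F p) \<le> inverse (norm v) ^ (d - 1) * norm (grad F v)"
      using p(2)[OF unit[OF v]] by (simp add: norm_power norm_inverse)
    then show ?thesis using v by (simp add: field_simps)
  qed
  then have "hess F p w = 0 \<Longrightarrow> w = 0" for w
    using minimal_gradient_hess_nondegenerate[OF F d, of p w] p(1) by (simp add: K_def)
  moreover have "p \<noteq> 0" "F p = 0" using p(1) by (auto simp: K_def)
  ultimately show ?thesis by blast
qed

section \<open>Stable tangencies\<close>

definition cdot :: "complex^'n \<Rightarrow> complex^'n \<Rightarrow> complex" where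
  "cdot x y = (\<Sum>i\<in>UNIV. x $ i * y $ i)"

lemma cdot_add_right: "cdot x (y + z) = cdot x y + cdot x z"
  and cdot_diff_right: "cdot x (y - z) = cdot x y - cdot x z"
  and cdot_diff_left: "cdot (y - z) x = cdot y x - cdot z x"
  by (simp_all add: cdot_def algebra_simps sum.distrib sum_subtractf)

lemma cdot_smult_right: "cdot x (c *s y) = c * cdot x y"
  by (simp_all add: cdot_def sum_distrib_left mult_ac)

lemma cdot_commute: "cdot x y = cdot y x"
  by (simp add: cdot_def mult.commute)

lemma cdot_axis: "cdot x (axis i c) = x $ i * c"
proof -
  have "cdot x (axis i c) = (\<Sum>a\<in>UNIV. if a = i then x $ i * c else 0)"
    unfolding cdot_def by (rule sum.cong) (auto simp: axis_def)
  then show ?thesis by simp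
qed

lemma cdot_transpose: "cdot (transpose M *v y) x = cdot y (M *v x)"
proof -
  have "cdot (transpose M *v y) x = (\<Sum>i\<in>UNIV. \<Sum>j\<in>UNIV. M $ j $ i * y $ j * x $ i)"
    by (simp add: cdot_def matrix_vector_mult_def transpose_def sum_distrib_right)
  also have "\<dots> = (\<Sum>j\<in>UNIV. \<Sum>i\<in>UNIV. M $ j $ i * y $ j * x $ i)" by (rule sum.swap)
  also have "\<dots> = cdot y (M *v x)"
    by (simp add: cdot_def matrix_vector_mult_def sum_distrib_left mult_ac)
  finally show ?thesis .
qed

lemma invertible_iff_ker: "invertible (M :: complex^'n^'n) \<longleftrightarrow> (\<forall>x. M *v x = 0 \<longrightarrow> x = 0)"
  by (simp add: invertible_left_inverse matrix_left_invertible_ker)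

definition transvection :: "complex^'n \<Rightarrow> complex^'n \<Rightarrow> complex^'n^'n" where
  "transvection z \<phi> = (\<chi> a b. (if a = b then 1 else 0) + z $ a * \<phi> $ b)"

lemma transvection_mult: "transvection z \<phi> *v x = x + cdot \<phi> x *s z"
proof -
  have "(\<Sum>b\<in>UNIV. ((if a = b then 1 else 0) + z $ a * \<phi> $ b) * x $ b) = x $ a + cdot \<phi> x * z $ a" for a
  proof -
    have "(\<Sum>b\<in>UNIV. ((if a = b then 1 else 0) + z $ a * \<phi> $ b) * x $ b) =
        (\<Sum>b\<in>UNIV. (if a = b then x $ b else 0) + z $ a * (\<phi> $ b * x $ b))"
      by (rule sum.cong) (auto simp: algebra_simps)
    then show ?thesis by (simp add: sum.distrib cdot_def sum_distrib_left mult.commute)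
  qed
  then show ?thesis by (simp add: vec_eq_iff matrix_vector_mult_def transvection_def)
qed

lemma transpose_transvection: "transpose (transvection z \<phi>) = transvection \<phi> z"
  by (auto simp: transpose_def transvection_def vec_eq_iff)

lemma invertible_transvection:
  assumes "1 + cdot \<phi> z \<noteq> 0" shows "invertible (transvection z \<phi>)"
  unfolding invertible_iff_ker transvection_mult
proof (intro allI impI)
  fix x assume x: "x + cdot \<phi> x *s z = 0"
  have "cdot \<phi> (x + cdot \<phi> x *s z) = cdot \<phi> x * (1 + cdot \<phi> z)"
    by (simp add: cdot_add_right cdot_smult_right algebra_simps)
  then have "cdot \<phi> x * (1 + cdot \<phi> z) = 0" unfolding x by (simp add: cdot_def)
  then have "cdot \<phi> x = 0" using assms by simp
  then show "x = 0" using x by simp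
qed

lemma exists_dual_vector:
  assumes "x \<noteq> 0" "y \<noteq> (0 :: complex^'n)"
  shows "\<exists>z. cdot x z = 1 \<and> cdot y z \<noteq> 0"
proof -
  obtain i j where ij: "x $ i \<noteq> 0" "y $ j \<noteq> 0" using assms by (auto simp: vec_eq_iff)
  consider "y $ i \<noteq> 0" | "x $ j \<noteq> 0" | "y $ i = 0" "x $ j = 0" by blast
  then show ?thesis
  proof cases
    case 1
    then show ?thesis using ij by (intro exI[of _ "axis i (1 / x $ i)"]) (simp add: cdot_axis)
  next
    case 2
    then show ?thesis using ij by (intro exI[of _ "axis j (1 / x $ j)"]) (simp add: cdot_axis)
  next
    case 3
    then show ?thesis using ij
      by (intro exI[of _ "axis i (1 / x $ i) + axis j 1"]) (simp add: cdot_axis cdot_add_right)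
  qed
qed

text \<open>A first transvection moves \<open>p\<close> to \<open>q\<close>; a second one fixes \<open>p\<close> and corrects the covector.\<close>

lemma exists_matrix_flag:
  fixes p q \<alpha> \<xi> :: "complex^'n"
  assumes ne: "p \<noteq> 0" "q \<noteq> 0" "\<alpha> \<noteq> 0" "\<xi> \<noteq> 0" and "cdot \<xi> p = 0" "cdot \<alpha> q = 0"
  shows "\<exists>g. invertible g \<and> g *v p = q \<and> transpose g *v \<alpha> = \<xi>"
proof -
  \<comment> \<open>With this choice \<open>1 + cdot \<phi> (q - p) = cdot \<phi> q\<close> is
    nonzero, which is the invertibility condition for the transvection.\<close>
  obtain \<phi> where \<phi>: "cdot p \<phi> = 1" "cdot q \<phi> \<noteq> 0" using exists_dual_vector[OF ne(1,2)] by blast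
  define T where "T = transvection (q - p) \<phi>"
  have T: "invertible T"
    unfolding T_def by (rule invertible_transvection)
      (use \<phi> in \<open>simp add: cdot_diff_right cdot_commute[of \<phi>]\<close>)
  have Tp: "T *v p = q" using \<phi> by (simp add: T_def transvection_mult cdot_commute[of \<phi>])
  define \<xi>0 where "\<xi>0 = transpose T *v \<alpha>"
  have "invertible (transpose T)" using T by (metis invertible_det_nz det_transpose)
  then have "\<xi>0 \<noteq> 0" using ne(3) by (auto simp: \<xi>0_def invertible_iff_ker)
  then obtain z where z: "cdot \<xi>0 z = 1" "cdot \<xi> z \<noteq> 0" using exists_dual_vector ne(4) by blast
  \<comment> \<open>Both \<open>\<xi>\<close> and \<open>\<xi>0\<close> annihilate \<open>p\<close>,
    so \<open>h\<close> fixes it. The first condition on \<open>z\<close> makes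
    \<open>transpose h\<close> send \<open>\<xi>0\<close> to \<open>\<xi>\<close>, the two together
    make \<open>h\<close> invertible.\<close>
  define h where "h = transvection z (\<xi> - \<xi>0)"
  have h: "invertible h"
    unfolding h_def by (rule invertible_transvection) (use z in \<open>simp add: cdot_diff_left\<close>)
  have "cdot \<xi>0 p = 0" unfolding \<xi>0_def cdot_transpose Tp by (rule assms(6))
  then have hp: "h *v p = p" using assms(5) by (simp add: h_def transvection_mult cdot_diff_left)
  have ht: "transpose h *v \<xi>0 = \<xi>"
    using z by (simp add: h_def transpose_transvection transvection_mult cdot_commute[of z])
  show ?thesis
  proof (intro exI[of _ "T ** h"] conjI)
    show "invertible (T ** h)" by (rule invertible_mult[OF T h])
    show "(T ** h) *v p = q" by (simp add: hp Tp flip: matrix_vector_mul_assoc)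
    show "transpose (T ** h) *v \<alpha> = \<xi>"
      by (simp only: matrix_transpose_mul ht matrix_vector_mul_assoc[symmetric] \<xi>0_def[symmetric])
  qed
qed

section \<open>The linearised tangency equation\<close>

definition dform :: "(complex^'n \<Rightarrow> complex^'n) \<Rightarrow> complex^'n \<Rightarrow> complex^'n \<Rightarrow> complex^'n" where
  "dform A u w = (\<chi> a. \<Sum>b\<in>UNIV. pd b (\<lambda>v. A v $ a) u * w $ b)"

lemma linear_dform: "linear (dform A u)"
  by (rule linearI) (auto simp: dform_def vec_eq_iff algebra_simps sum.distrib scaleR_sum_right)

lemma linear_hess: "linear (hess F p)"
  by (rule linearI) (auto simp: hess_def vec_eq_iff algebra_simps sum.distrib scaleR_sum_right)

text \<open>The equation \<open>F v = 0\<close> is not needed in the system: it follows from Euler's identity when \<open>c \<noteq> 0\<close>.\<close>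

lemma pullback_tangency_stable:
  fixes A :: "complex^'n \<Rightarrow> complex^'n" and F :: "complex^'n \<Rightarrow> complex"
  assumes A: "\<And>a. hol_on (\<lambda>v. A v $ a) (- {0})" and F: "hol_on F UNIV"
    and sol: "H0 *v v0 \<noteq> 0" "pullback_form H0 A v0 = c0 *s grad F v0"
    and inj: "\<forall>x c. transpose H0 *v dform A (H0 *v v0) (H0 *v x) - c *s grad F v0 - c0 *s hess F v0 x = 0
        \<longrightarrow> x $ j = 0 \<longrightarrow> x = 0 \<and> c = 0"
    and W: "open W" "(H0, v0, c0) \<in> W"
  shows "\<exists>U N. open U \<and> U \<subseteq> W \<and> open N \<and> H0 \<in> N \<and> (\<forall>H\<in>N. \<exists>v c. (H, v, c) \<in> U \<and> v $ j = v0 $ j \<and>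
    pullback_form H A v = c *s grad F v \<and>
    (\<forall>v' c'. (H, v', c') \<in> U \<and> v' $ j = v0 $ j \<and> pullback_form H A v' = c' *s grad F v' \<longrightarrow> v' = v))"
proof -
  define mv where "mv x = fst x *v fst (snd x)" for x :: "(complex^'n^'n) \<times> (complex^'n) \<times> complex"
  \<comment> \<open>Keeping the matrix as a component and fixing the scale of \<open>v\<close> by
    its \<open>j\<close>-th coordinate gives a map between spaces of equal dimension; its local
    inverse yields \<open>v\<close> and \<open>c\<close> as functions of the matrix.\<close>
  define \<Theta> where "\<Theta> x = (fst x, pullback_form (fst x) A (fst (snd x)) - snd (snd x) *s grad F (fst (snd x)), fst (snd x) $ j)"
    for x :: "(complex^'n^'n) \<times> (complex^'n) \<times> complex"
  define dmv where "dmv x h = fst h *v fst (snd x) + fst x *v fst (snd h)" for x h :: "(complex^'n^'n) \<times> (complex^'n) \<times> complex"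
  define L where "L x h = (fst h, transpose (fst h) *v A (mv x) + transpose (fst x) *v dform A (mv x) (dmv x h)
      - (snd (snd h) *s grad F (fst (snd x)) + snd (snd x) *s hess F (fst (snd x)) (fst (snd h))), fst (snd h) $ j)"
    for x h :: "(complex^'n^'n) \<times> (complex^'n) \<times> complex"
  have mat: "((\<lambda>x :: (complex^'n^'n) \<times> (complex^'n) \<times> complex. fst x $ a $ b) has_derivative (\<lambda>h. fst h $ a $ b)) (at x)" for a b x
    by (intro bounded_linear_imp_has_derivative bounded_linear_compose[OF bounded_linear_vec_nth]
          bounded_linear_fst)
  have vec: "((\<lambda>x :: (complex^'n^'n) \<times> (complex^'n) \<times> complex. fst (snd x) $ a) has_derivative (\<lambda>h. fst (snd h) $ a)) (at x)" for a x
    by (intro bounded_linear_imp_has_derivative bounded_linear_compose[OF bounded_linear_vec_nth]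
          bounded_linear_compose[OF bounded_linear_fst] bounded_linear_snd)
  have vecd: "((\<lambda>x :: (complex^'n^'n) \<times> (complex^'n) \<times> complex. fst (snd x)) has_derivative (\<lambda>h. fst (snd h))) (at x)" for x
    by (intro bounded_linear_imp_has_derivative bounded_linear_compose[OF bounded_linear_fst] bounded_linear_snd)
  have sca: "((\<lambda>x :: (complex^'n^'n) \<times> (complex^'n) \<times> complex. snd (snd x)) has_derivative (\<lambda>h. snd (snd h))) (at x)" for x
    by (intro bounded_linear_imp_has_derivative bounded_linear_compose[OF bounded_linear_snd] bounded_linear_snd)
  have dmv: "(mv has_derivative dmv x) (at x)" for x
  proof (rule has_derivative_vecI)
    fix a
    have "((\<lambda>x. \<Sum>b\<in>UNIV. fst x $ a $ b * fst (snd x) $ b) has_derivative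
      (\<lambda>h. \<Sum>b\<in>UNIV. fst x $ a $ b * fst (snd h) $ b + fst h $ a $ b * fst (snd x) $ b)) (at x)"
      by (intro has_derivative_sum has_derivative_mult mat vec)
    then show "((\<lambda>x. mv x $ a) has_derivative (\<lambda>h. dmv x h $ a)) (at x)"
      by (simp add: mv_def dmv_def matrix_vector_mult_def sum.distrib add.commute)
  qed
  have mvcont: "continuous_on S mv" for S
    by (intro continuous_at_imp_continuous_on ballI) (rule has_derivative_continuous[OF dmv])
  define \<Omega> where "\<Omega> = mv -` (- {0}) \<inter> W"
  have \<Omega>: "open \<Omega>" unfolding \<Omega>_def by (rule open_Int[OF open_vimage[OF open_punctured mvcont] W(1)])
  have x0: "(H0, v0, c0) \<in> \<Omega>" using sol(1) W(2) by (simp add: \<Omega>_def mv_def)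
  have der\<Theta>: "(\<Theta> has_derivative L x) (at x)" if x: "x \<in> \<Omega>" for x
  proof -
    have Ad: "((\<lambda>x. A (mv x) $ a) has_derivative (\<lambda>h. dform A (mv x) (dmv x h) $ a)) (at x)" for a
    proof -
      have "mv x \<in> - {0}" using x by (simp add: \<Omega>_def)
      from has_derivative_compose[OF dmv hol_on_has_derivative[OF A this]]
      show ?thesis by (simp add: dform_def)
    qed
    have pdd: "((\<lambda>x. pd b F (fst (snd x))) has_derivative (\<lambda>h. hess F (fst (snd x)) (fst (snd h)) $ b)) (at x)" for b
      by (rule has_derivative_compose[OF vecd pd_has_derivative_hess[OF F]])
    have "((\<lambda>x. pullback_form (fst x) A (fst (snd x)) - snd (snd x) *s grad F (fst (snd x))) has_derivative
      (\<lambda>h. transpose (fst h) *v A (mv x) + transpose (fst x) *v dform A (mv x) (dmv x h)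
      - (snd (snd h) *s grad F (fst (snd x)) + snd (snd x) *s hess F (fst (snd x)) (fst (snd h))))) (at x)"
    proof (rule has_derivative_vecI)
      fix b
      have "((\<lambda>x. (\<Sum>a\<in>UNIV. fst x $ a $ b * A (mv x) $ a) - snd (snd x) * pd b F (fst (snd x))) has_derivative
        (\<lambda>h. (\<Sum>a\<in>UNIV. fst x $ a $ b * dform A (mv x) (dmv x h) $ a + fst h $ a $ b * A (mv x) $ a) -
          (snd (snd x) * hess F (fst (snd x)) (fst (snd h)) $ b + snd (snd h) * pd b F (fst (snd x))))) (at x)"
        by (intro has_derivative_diff has_derivative_sum has_derivative_mult mat Ad sca pdd)
      then show "((\<lambda>x. (pullback_form (fst x) A (fst (snd x)) - snd (snd x) *s grad F (fst (snd x))) $ b) has_derivative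
        (\<lambda>h. (transpose (fst h) *v A (mv x) + transpose (fst x) *v dform A (mv x) (dmv x h)
        - (snd (snd h) *s grad F (fst (snd x)) + snd (snd x) *s hess F (fst (snd x)) (fst (snd h)))) $ b)) (at x)"
        by (simp add: pullback_form_def matrix_vector_mult_def transpose_def mv_def sum.distrib add.commute)
    qed
    from has_derivative_Pair[OF bounded_linear_imp_has_derivative[OF bounded_linear_fst] has_derivative_Pair[OF this vec]]
    show ?thesis unfolding \<Theta>_def L_def .
  qed
  have linL: "linear (L x)" if "x \<in> \<Omega>" for x using der\<Theta>[OF that] has_derivative_linear by blast
  define L' where "L' x = Blinfun (L x)" for x
  have L': "blinfun_apply (L' x) = L x" if "x \<in> \<Omega>" for x
    unfolding L'_def by (rule apply_Blinfun_finite[OF linL[OF that]])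
  have cont: "continuous_on \<Omega> L'"
  proof (rule continuous_on_blinfun_componentwise)
    fix h :: "(complex^'n^'n) \<times> (complex^'n) \<times> complex"
    have Acont: "continuous_on \<Omega> (\<lambda>x. A (mv x) $ a)" for a
      by (rule continuous_on_compose2[OF hol_on_continuous[OF A] mvcont]) (auto simp: \<Omega>_def)
    have pAcont: "continuous_on \<Omega> (\<lambda>x. pd b (\<lambda>v. A v $ a) (mv x))" for a b
      by (rule continuous_on_compose2[OF continuous_on_pd[OF A open_punctured] mvcont]) (auto simp: \<Omega>_def)
    have vcont: "continuous_on \<Omega> (\<lambda>x. fst (snd x))" by (intro continuous_intros)
    have pFcont: "continuous_on \<Omega> (\<lambda>x. pd b F (fst (snd x)))" for b
      by (rule continuous_on_compose2[OF continuous_on_pd[OF F open_UNIV] vcont]) auto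
    have ppFcont: "continuous_on \<Omega> (\<lambda>x. pd a (pd b F) (fst (snd x)))" for a b
      by (rule continuous_on_compose2[OF continuous_on_pd[OF hol_on_pd[OF F open_UNIV] open_UNIV] vcont]) auto
    have mc: "continuous_on \<Omega> (\<lambda>x. fst x $ a $ b)" for a b
      by (intro continuous_at_imp_continuous_on ballI) (rule has_derivative_continuous[OF mat])
    have vc: "continuous_on \<Omega> (\<lambda>x. fst (snd x) $ a)" for a
      by (intro continuous_at_imp_continuous_on ballI) (rule has_derivative_continuous[OF vec])
    have sc: "continuous_on \<Omega> (\<lambda>x. snd (snd x))" by (intro continuous_intros)
    have dc: "continuous_on \<Omega> (\<lambda>x. dmv x h $ a)" for a
      unfolding dmv_def matrix_vector_mult_def vector_add_component vec_lambda_beta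
      by (intro continuous_on_add continuous_on_sum continuous_on_mult continuous_on_const mc vc)
    have "continuous_on \<Omega> (\<lambda>x. L x h)"
      unfolding L_def
    proof (intro continuous_on_Pair continuous_on_const)
      have "continuous_on \<Omega> (\<lambda>x. \<chi> b. (\<Sum>a\<in>UNIV. fst h $ a $ b * A (mv x) $ a)
          + (\<Sum>a\<in>UNIV. fst x $ a $ b * (\<Sum>e\<in>UNIV. pd e (\<lambda>v. A v $ a) (mv x) * dmv x h $ e))
          - (snd (snd h) * pd b F (fst (snd x)) + snd (snd x) * (\<Sum>a\<in>UNIV. pd a (pd b F) (fst (snd x)) * fst (snd h) $ a)))"
        by (intro continuous_on_vec_lambda continuous_on_add continuous_on_diff continuous_on_sum continuous_on_mult
              continuous_on_const mc dc sc Acont pAcont pFcont ppFcont)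
      moreover have "(\<chi> b. (\<Sum>a\<in>UNIV. fst h $ a $ b * A (mv x) $ a)
          + (\<Sum>a\<in>UNIV. fst x $ a $ b * (\<Sum>e\<in>UNIV. pd e (\<lambda>v. A v $ a) (mv x) * dmv x h $ e))
          - (snd (snd h) * pd b F (fst (snd x)) + snd (snd x) * (\<Sum>a\<in>UNIV. pd a (pd b F) (fst (snd x)) * fst (snd h) $ a)))
        = transpose (fst h) *v A (mv x) + transpose (fst x) *v dform A (mv x) (dmv x h)
      - (snd (snd h) *s grad F (fst (snd x)) + snd (snd x) *s hess F (fst (snd x)) (fst (snd h)))" for x
        by (simp add: vec_eq_iff matrix_vector_mult_def transpose_def dform_def hess_def)
      ultimately show "continuous_on \<Omega> (\<lambda>x. transpose (fst h) *v A (mv x) + transpose (fst x) *v dform A (mv x) (dmv x h)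
      - (snd (snd h) *s grad F (fst (snd x)) + snd (snd x) *s hess F (fst (snd x)) (fst (snd h))))" by simp
    qed
    then show "continuous_on \<Omega> (\<lambda>x. blinfun_apply (L' x) h)"
      by (rule continuous_on_eq) (simp add: L')
  qed
  let ?x0 = "(H0, v0, c0)"
  have "inj (L ?x0)"
    unfolding linear_injective_0[OF linL[OF x0]]
  proof (intro allI impI)
    fix h assume Lh: "L ?x0 h = 0"
    have h: "fst h = 0" "transpose (fst h) *v A (mv ?x0) + transpose H0 *v dform A (mv ?x0) (dmv ?x0 h)
      - (snd (snd h) *s grad F v0 + c0 *s hess F v0 (fst (snd h))) = 0" "fst (snd h) $ j = 0"
      using Lh unfolding L_def zero_prod_def prod.inject fst_conv snd_conv by blast+
    have t0: "transpose (0 :: complex^'n^'n) = 0" by (simp add: transpose_def vec_eq_iff)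
    have "transpose H0 *v dform A (H0 *v v0) (H0 *v fst (snd h)) - snd (snd h) *s grad F v0 - c0 *s hess F v0 (fst (snd h)) = 0"
      using h(2) unfolding h(1) t0 by (simp add: mv_def dmv_def h(1) algebra_simps del: transpose_matrix_vector)
    from inj[rule_format, OF this h(3)] show "h = 0" using h(1) by (simp add: prod_eq_iff)
  qed
  then obtain R where R: "linear R" "R \<circ> L ?x0 = id"
    using linear_injective_left_inverse[OF linL[OF x0]] by blast
  have inv: "Blinfun R o\<^sub>L L' ?x0 = id_blinfun"
  proof (rule blinfun_eqI)
    fix h show "blinfun_apply (Blinfun R o\<^sub>L L' ?x0) h = blinfun_apply id_blinfun h"
      using fun_cong[OF R(2), of h] by (simp add: L'[OF x0] apply_Blinfun_finite[OF R(1)])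
  qed
  have derL': "(\<Theta> has_derivative blinfun_apply (L' x)) (at x)" if "x \<in> \<Omega>" for x
    using der\<Theta>[OF that] by (simp add: L'[OF that])
  obtain U V G G' where U: "open U" "U \<subseteq> \<Omega>" "?x0 \<in> U" "open V" "\<Theta> ?x0 \<in> V" "homeomorphism U V \<Theta> G"
    "\<And>y. y \<in> V \<Longrightarrow> (G has_derivative (G' y)) (at y)"
    "\<And>y. y \<in> V \<Longrightarrow> G' y = Hilbert_Choice.inv (blinfun_apply (L' (G y)))"
    "\<And>y. y \<in> V \<Longrightarrow> bij (blinfun_apply (L' (G y)))"
    by (rule inverse_function_theorem[OF \<Omega> _ cont x0 inv], erule derL', rule that)
  \<comment> \<open>The matrices for which the value \<open>(H, 0, v0 $ j)\<close> of a normalised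
    solution lies in the image of \<open>U\<close>; injectivity of \<open>\<Theta>\<close> on
    \<open>U\<close> then gives uniqueness.\<close>
  define N where "N = (\<lambda>H. (H, 0 :: complex^'n, v0 $ j)) -` V"
  have "open N" unfolding N_def by (rule open_vimage[OF U(4)]) (intro continuous_intros)
  moreover have "H0 \<in> N" using U(5) sol(2) by (simp add: N_def \<Theta>_def)
  moreover have "\<exists>v c. (H, v, c) \<in> U \<and> v $ j = v0 $ j \<and> pullback_form H A v = c *s grad F v \<and>
    (\<forall>v' c'. (H, v', c') \<in> U \<and> v' $ j = v0 $ j \<and> pullback_form H A v' = c' *s grad F v' \<longrightarrow> v' = v)" if H: "H \<in> N" for H
  proof -
    have yV: "(H, 0, v0 $ j) \<in> V" using H by (simp add: N_def)
    obtain H' v c where G: "G (H, 0, v0 $ j) = (H', v, c)" by (metis prod_cases3)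
    have gU: "(H', v, c) \<in> U" using homeomorphism_image2[OF U(6)] yV G by (metis imageI)
    have "\<Theta> (H', v, c) = (H, 0, v0 $ j)" using homeomorphism_apply2[OF U(6) yV] G by simp
    then have *: "H' = H" "pullback_form H A v = c *s grad F v" "v $ j = v0 $ j" by (auto simp: \<Theta>_def)
    have "v' = v" if "(H, v', c') \<in> U" "v' $ j = v0 $ j" "pullback_form H A v' = c' *s grad F v'" for v' c'
    proof -
      have "\<Theta> (H, v', c') = (H, 0, v0 $ j)" using that(2,3) by (simp add: \<Theta>_def)
      then have "(H, v', c') = G (H, 0, v0 $ j)" using homeomorphism_apply1[OF U(6) that(1)] by simp
      then show ?thesis using G by simp
    qed
    then show ?thesis using gU * by blast
  qed
  ultimately show ?thesis
    using U(1,2) by (intro exI[of _ U] exI[of _ N]) (auto simp: \<Omega>_def)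
qed

lemma cdot_form_at: "form_at A v w = cdot (A v) w"
  by (simp add: form_at_def cdot_def)

text \<open>The identity \<open>form_at A v v = 0\<close> differentiated in the direction
  \<open>y\<close>.\<close>

lemma sum_dform:
  fixes A :: "complex^'n \<Rightarrow> complex^'n"
  assumes A: "twisted_form k A" and q: "q \<noteq> 0"
  shows "cdot q (dform A q y) = - cdot (A q) y"
proof -
  have hol: "hol_on (\<lambda>v. A v $ a) (- {0})" for a
    using A by (simp add: twisted_form_def holomorphic_map_on_iff)
  have 1: "((\<lambda>s. A (q + s *s y) $ a) has_field_derivative dform A q y $ a) (at 0)" for a
    using hol_on_line[OF hol, of q 0 y a] q by (simp add: dform_def)
  have 2: "((\<lambda>s. (q + s *s y) $ a) has_field_derivative y $ a) (at 0)" for a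
    by (auto intro!: derivative_eq_intros)
  have 3: "((\<lambda>s. \<Sum>a\<in>UNIV. (q + s *s y) $ a * A (q + s *s y) $ a) has_field_derivative
      (\<Sum>a\<in>UNIV. (q + 0 *s y) $ a * dform A q y $ a + y $ a * A (q + 0 *s y) $ a)) (at 0)"
    by (intro DERIV_sum DERIV_mult' 1 2)
  let ?T = "(\<lambda>s. q + s *s y) -` (- {0})"
  have T: "open ?T" by (rule open_vimage[OF open_punctured]) (intro continuous_intros)
  have "((\<lambda>s. \<Sum>a\<in>UNIV. (q + s *s y) $ a * A (q + s *s y) $ a) has_field_derivative 0) (at 0)"
  proof (rule has_field_derivative_transform_within_open[OF DERIV_const T])
    show "0 \<in> ?T" using q by simp
    fix s assume "s \<in> ?T"
    then have "form_at A (q + s *s y) (q + s *s y) = 0" using A by (simp add: twisted_form_def)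
    then show "0 = (\<Sum>a\<in>UNIV. (q + s *s y) $ a * A (q + s *s y) $ a)"
      by (simp add: form_at_def mult.commute)
  qed
  from DERIV_unique[OF 3 this] have "cdot q (dform A q y) + cdot y (A q) = 0"
    by (simp add: cdot_def sum.distrib)
  then show ?thesis by (simp add: cdot_commute[of y] eq_neg_iff_add_eq_0)
qed

text \<open>Contracting \<open>g\<^sup>*A\<close> towards \<open>p\<close> makes it close to a pencil of hyperplanes near \<open>p\<close>, and tangency
  with a pencil is nondegenerate where the Hessian is.\<close>

lemma exists_nondegenerate_tangency:
  fixes A :: "complex^'n \<Rightarrow> complex^'n" and F :: "complex^'n \<Rightarrow> complex"
  assumes A: "twisted_form k A" and q: "q \<noteq> 0" "A q \<noteq> 0"
    and F: "smooth_hypersurface_eq d F" and d: "d \<ge> 2"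
    and p: "p \<noteq> 0" "F p = 0" and hess: "\<forall>w. hess F p w = 0 \<longrightarrow> w = 0" and j: "p $ j \<noteq> 0"
  shows "\<exists>H c. invertible H \<and> c \<noteq> 0 \<and> pullback_form H A p = c *s grad F p \<and>
    (\<forall>x e. transpose H *v dform A (H *v p) (H *v x) - e *s grad F p - c *s hess F p x = 0 \<longrightarrow>
        x $ j = 0 \<longrightarrow> x = 0 \<and> e = 0)"
proof -
  have Fp: "homogeneous_polynomial d F" using F by (simp add: smooth_hypersurface_eq_def)
  define \<xi> where "\<xi> = grad F p"
  have \<xi>0: "\<xi> \<noteq> 0" unfolding \<xi>_def by (rule grad_nonzero[OF F p])
  have \<xi>p: "cdot \<xi> p = 0"
    using euler_identity[OF Fp, of p] p(2) by (simp add: cdot_def \<xi>_def mult.commute)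
  have "cdot (A q) q = 0" using A q(1) by (simp add: twisted_form_def cdot_form_at)
  from exists_matrix_flag[OF p(1) q \<xi>0 \<xi>p this]
  obtain g where g: "invertible g" "g *v p = q" "transpose g *v A q = \<xi>" by blast
  define N where "N x = transpose g *v dform A q (g *v x)" for x
  have lN: "linear N"
    unfolding N_def using linear_compose[OF linear_compose[OF matrix_vector_mul_linear[of g] linear_dform[of A q]]
      matrix_vector_mul_linear[of "transpose g"]] by (simp add: o_def)
  obtain C where C: "C > 0" "\<And>x. norm (N x) \<le> C * norm x"
    using linear_bounded_pos[OF lN] by blast
  \<comment> \<open>The linearised system for a pencil, with \<open>N\<close> dropped. For a kernel
    element \<open>(x, e)\<close>, the relation \<open>hess F p p = (d - 1) \<xi>\<close> puts
    \<open>(d - 1) x + e p\<close> in the kernel of the Hessian; it is zero, and its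
    \<open>j\<close>-th coordinate gives \<open>e = 0\<close>.\<close>
  define L where "L x = (hess F p (fst x) + snd x *s \<xi>, fst x $ j)" for x :: "(complex^'n) \<times> complex"
  have hself: "hess F p p = of_nat (d - 1) *s \<xi>"
    unfolding \<xi>_def by (rule hess_self[OF Fp _ p(1)]) (use d in simp)
  have lL: "linear L"
    by (rule linearI) (auto simp: L_def linear_add[OF linear_hess] linear_scale[OF linear_hess] vec_eq_iff algebra_simps)
  have "inj L"
    unfolding linear_injective_0[OF lL]
  proof (intro allI impI)
    fix x assume "L x = 0"
    then have x: "hess F p (fst x) + snd x *s \<xi> = 0" "fst x $ j = 0" by (simp_all add: L_def zero_prod_def)
    have "hess F p (of_nat (d - 1) *s fst x + snd x *s p) = of_nat (d - 1) *s (hess F p (fst x) + snd x *s \<xi>)"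
      by (simp add: linear_add[OF linear_hess] hess_smult hself vec_eq_iff algebra_simps)
    then have "of_nat (d - 1) *s fst x + snd x *s p = 0" using x(1) hess by simp
    then have eq: "of_nat (d - 1) * fst x $ a + snd x * p $ a = 0" for a
      by (metis vector_add_component vector_smult_component zero_index)
    from eq[of j] have s0: "snd x = 0" using x(2) j by simp
    have "fst x $ a = 0" for a using eq[of a] s0 d by simp
    then have "fst x = 0" by (simp add: vec_eq_iff)
    then show "x = 0" using s0 by (simp add: prod_eq_iff)
  qed
  from linear_inj_bounded_below_pos[OF lL this]
  obtain B where B: "B > 0" "\<And>x. B * norm x \<le> norm (L x)" by blast
  \<comment> \<open>Half of the critical ratio \<open>B / C\<close>: the lower bound of
    \<open>L\<close> has to dominate the perturbation by \<open>t\<close> times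
    \<open>N\<close>.\<close>
  define t where "t = B / (2 * C)"
  have t: "t > 0" "t * C < B" using B(1) C(1) by (simp_all add: t_def field_simps)
  define \<tau> where "\<tau> = complex_of_real t"
  have \<tau>0: "\<tau> \<noteq> 0" using t by (simp add: \<tau>_def)
  \<comment> \<open>\<open>T\<close> fixes \<open>p\<close> and is multiplication by \<tau> on the
    hyperplane \<open>x $ j = 0\<close>.\<close>
  define T :: "complex^'n^'n" where
    "T = (\<chi> a b. (if a = b then \<tau> else 0) + (if b = j then (1 - \<tau>) / p $ j * p $ a else 0))"
  have Tv: "T *v x = \<tau> *s x + ((1 - \<tau>) / p $ j * x $ j) *s p" for x
  proof -
    have "(\<Sum>b\<in>UNIV. T $ a $ b * x $ b) = \<tau> * x $ a + (1 - \<tau>) / p $ j * x $ j * p $ a" for a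
    proof -
      have "(\<Sum>b\<in>UNIV. T $ a $ b * x $ b) = (\<Sum>b\<in>UNIV. (if b = a then \<tau> * x $ a else 0)
         + (if b = j then (1 - \<tau>) / p $ j * x $ j * p $ a else 0))"
        by (rule sum.cong) (auto simp: T_def algebra_simps)
      then show ?thesis by (simp add: sum.distrib)
    qed
    then show ?thesis by (simp add: vec_eq_iff matrix_vector_mult_def)
  qed
  have Tt: "transpose T *v y = \<tau> *s y + axis j ((1 - \<tau>) / p $ j * cdot p y)" for y
  proof -
    have "(\<Sum>a\<in>UNIV. T $ a $ b * y $ a) = \<tau> * y $ b + (if b = j then (1 - \<tau>) / p $ j * cdot p y else 0)" for b
    proof -
      have "(\<Sum>a\<in>UNIV. T $ a $ b * y $ a) = (\<Sum>a\<in>UNIV. (if a = b then \<tau> * y $ b else 0)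
         + (if b = j then (1 - \<tau>) / p $ j * (p $ a * y $ a) else 0))"
        by (rule sum.cong) (auto simp: T_def algebra_simps)
      then show ?thesis by (simp add: sum.distrib cdot_def sum_distrib_left)
    qed
    then show ?thesis
      by (simp add: vec_eq_iff matrix_vector_mult_def transpose_def axis_def del: transpose_matrix_vector)
  qed
  have Tp: "T *v p = p"
  proof -
    have "(1 - \<tau>) / p $ j * p $ j = 1 - \<tau>" using j by simp
    then have "T *v p = \<tau> *s p + (1 - \<tau>) *s p" by (simp only: Tv)
    then show ?thesis by (simp add: vec_eq_iff algebra_simps)
  qed
  have T: "invertible T"
    unfolding invertible_iff_ker
  proof (intro allI impI)
    fix x assume x: "T *v x = 0"
    have "(1 - \<tau>) / p $ j * x $ j * p $ j = (1 - \<tau>) * x $ j" using j by simp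
    then have "(T *v x) $ j = \<tau> * x $ j + (1 - \<tau>) * x $ j"
      by (simp only: Tv vector_add_component vector_smult_component)
    then have "(T *v x) $ j = x $ j" by (simp add: algebra_simps)
    then have "x $ j = 0" using x by simp
    then show "x = 0" using x \<tau>0 by (simp add: Tv)
  qed
  define H where "H = g ** T"
  have H: "invertible H" unfolding H_def by (rule invertible_mult[OF g(1) T])
  have Hp: "H *v p = q" unfolding H_def matrix_vector_mul_assoc[symmetric] Tp by (rule g(2))
  have Ht: "transpose H *v y = transpose T *v (transpose g *v y)" for y
    by (simp only: H_def matrix_transpose_mul matrix_vector_mul_assoc)
  have pull: "pullback_form H A p = \<tau> *s grad F p"
    unfolding pullback_form_def Hp Ht g(3) Tt using \<xi>p by (simp add: cdot_commute[of p] \<xi>_def vec_eq_iff axis_def)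
  have "x = 0 \<and> e = 0" if eq: "transpose H *v dform A (H *v p) (H *v x) - e *s grad F p - \<tau> *s hess F p x = 0" and xj: "x $ j = 0" for x e
  proof -
    have Tx: "T *v x = \<tau> *s x" using xj by (simp add: Tv)
    have Hx: "H *v x = \<tau> *s (g *v x)"
      unfolding H_def matrix_vector_mul_assoc[symmetric] Tx by (simp add: vector_scalar_commute)
    have "dform A q (\<tau> *s y) = \<tau> *s dform A q y" for y
      by (simp add: dform_def vec_eq_iff sum_distrib_left mult_ac)
    then have "transpose H *v dform A (H *v p) (H *v x) = transpose T *v (\<tau> *s N x)"
      unfolding Hp Hx Ht N_def by (simp add: vector_scalar_commute del: transpose_matrix_vector)
    then have eq1: "transpose T *v (\<tau> *s N x) - e *s \<xi> - \<tau> *s hess F p x = 0"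
      using eq by (simp add: \<xi>_def del: transpose_matrix_vector)
    \<comment> \<open>Pairing the whole equation with \<open>p\<close> will leave
      \<open>\<tau> * of_nat d * cdot \<xi> x = 0\<close>. So \<open>x\<close> is tangent to the
      hypersurface, \<open>cdot p (N x)\<close> vanishes, and \<open>transpose T\<close> merely
      multiplies \<open>N x\<close> by \<tau>.\<close>
    have pN: "cdot p (N x) = - cdot \<xi> x"
    proof -
      have "cdot p (N x) = cdot (transpose g *v dform A q (g *v x)) p" by (simp add: N_def cdot_commute)
      also have "\<dots> = cdot (dform A q (g *v x)) q" unfolding cdot_transpose g(2) ..
      also have "\<dots> = - cdot (A q) (g *v x)" using sum_dform[OF A q(1)] by (simp add: cdot_commute)
      also have "cdot (A q) (g *v x) = cdot \<xi> x" unfolding cdot_transpose[symmetric] g(3) ..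
      finally show ?thesis .
    qed
    have f1: "cdot p (transpose T *v (\<tau> *s N x)) = \<tau> * cdot p (N x)"
      unfolding cdot_commute[of p "transpose T *v _"] cdot_transpose Tp
      by (simp only: cdot_commute[of _ p] cdot_smult_right)
    have f2: "cdot p (hess F p x) = (of_nat d - 1) * cdot \<xi> x"
      using sum_hess[OF Fp, of p x] by (simp add: cdot_def \<xi>_def)
    have "cdot p (transpose T *v (\<tau> *s N x) - e *s \<xi> - \<tau> *s hess F p x)
        = \<tau> * (- cdot \<xi> x) - e * 0 - \<tau> * ((of_nat d - 1) * cdot \<xi> x)"
      by (simp only: cdot_diff_right cdot_smult_right f1 f2 pN cdot_commute[of p \<xi>] \<xi>p)
    also have "\<dots> = - \<tau> * of_nat d * cdot \<xi> x" by (simp add: algebra_simps)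
    finally have "cdot p (transpose T *v (\<tau> *s N x) - e *s \<xi> - \<tau> *s hess F p x) = - \<tau> * of_nat d * cdot \<xi> x" .
    then have "\<tau> * of_nat d * cdot \<xi> x = 0" unfolding eq1 by (simp add: cdot_def)
    then have \<xi>x: "cdot \<xi> x = 0" using \<tau>0 d by simp
    have "transpose T *v (\<tau> *s N x) = \<tau> *s (\<tau> *s N x)"
      unfolding Tt using pN \<xi>x by (simp add: cdot_smult_right vec_eq_iff axis_def)
    then have eq2: "\<tau> *s (\<tau> *s N x) - e *s \<xi> - \<tau> *s hess F p x = 0" using eq1 by simp
    \<comment> \<open>After division by \<tau> the pencil system stands on the left and the
      perturbation keeps a factor \<tau>.\<close>
    have "hess F p x + (e / \<tau>) *s \<xi> = \<tau> *s N x"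
    proof -
      have "\<tau> * (\<tau> * N x $ a) - e * \<xi> $ a - \<tau> * hess F p x $ a = 0" for a
        using arg_cong[OF eq2, of "\<lambda>v. v $ a"]
        by (simp only: vector_minus_component vector_smult_component zero_index)
      moreover have "\<tau> * (hess F p x $ a + (e / \<tau>) * \<xi> $ a) = \<tau> * hess F p x $ a + e * \<xi> $ a" for a
        using \<tau>0 by (simp add: distrib_left)
      ultimately have "\<tau> * (hess F p x $ a + (e / \<tau>) * \<xi> $ a) = \<tau> * (\<tau> * N x $ a)" for a
        by (simp add: algebra_simps)
      then have "hess F p x $ a + (e / \<tau>) * \<xi> $ a = \<tau> * N x $ a" for a
        using \<tau>0 by (simp only: mult_cancel_left simp_thms)
      then show ?thesis by (simp add: vec_eq_iff)
    qed
    then have Lx: "L (x, e / \<tau>) = (\<tau> *s N x, 0)" using xj by (simp add: L_def)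
    have "norm x \<le> norm (x, e / \<tau>)" by (rule norm_fst_le)
    then have "C * norm x \<le> C * norm (x, e / \<tau>)" using C(1) by simp
    then have "norm (N x) \<le> C * norm (x, e / \<tau>)" using C(2)[of x] by linarith
    then have "t * norm (N x) \<le> t * (C * norm (x, e / \<tau>))" using t(1) by simp
    moreover have "norm (L (x, e / \<tau>)) = t * norm (N x)"
      unfolding Lx using t(1) by (simp add: norm_Pair \<tau>_def)
    ultimately have "B * norm (x, e / \<tau>) \<le> t * C * norm (x, e / \<tau>)" using B(2)[of "(x, e / \<tau>)"] by simp
    then have "norm (x, e / \<tau>) = 0"
      using t(2) by (simp only: mult_le_cancel_right) (meson norm_ge_zero not_le order_antisym)
    then show ?thesis using \<tau>0 by (simp add: zero_prod_def)
  qed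
  then show ?thesis using H \<tau>0 pull by (intro exI[of _ H] exI[of _ \<tau>]) blast
qed

text \<open>Uniqueness in the slice gives isolation in projective space: a nearby tangent point is
  represented by a vector with the \<open>j\<close>-th coordinate of \<open>v\<close>, and its
  multiplier is a quotient of \<open>i\<close>-th coordinates, continuous in the point, so the pair
  falls into \<open>U\<close>.\<close>

lemma isolated_restr_sing:
  fixes A :: "complex^'n \<Rightarrow> complex^'n" and F :: "complex^'n \<Rightarrow> complex"
  assumes A: "twisted_form k A" and F: "smooth_hypersurface_eq d F" and d: "d \<ge> 1" and H: "invertible H"
    and U: "open U" "(v, c) \<in> U" "\<And>v c. (v, c) \<in> U \<Longrightarrow> c \<noteq> 0 \<and> pd i F v \<noteq> 0"
    and v: "v $ j \<noteq> 0" "pullback_form H A v = c *s grad F v"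
    and uniq: "\<And>v' c'. (v', c') \<in> U \<Longrightarrow> v' $ j = v $ j \<Longrightarrow> pullback_form H A v' = c' *s grad F v' \<Longrightarrow> v' = v"
  shows "proj_point v isolated_in restr_sing_set (pullback_form H A) F"
    and "proj_point v \<notin> sing_set (pullback_form H A)"
proof -
  let ?B = "pullback_form H A"
  have Fp: "homogeneous_polynomial d F" using F by (simp add: smooth_hypersurface_eq_def)
  have Fhol: "hol_on F UNIV" by (rule homogeneous_polynomial_hol_on[OF Fp])
  have v0: "v \<noteq> 0" using v(1) by auto
  have ci: "c \<noteq> 0" "pd i F v \<noteq> 0" using U by blast+
  have Hne: "H *v u \<noteq> 0" if "u \<noteq> 0" for u using H that by (auto simp: invertible_iff_ker)
  have scale: "?B (e *s u) = (e powi (k - 1)) *s ?B u" if "e \<noteq> 0" "u \<noteq> 0" for e u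
    by (rule pullback_form_scale[OF A H that])
  \<comment> \<open>The form annihilates the radial vector, so by Euler's identity the multiplier
    equation implies \<open>c * (of_nat d * F v) = 0\<close>.\<close>
  have "cdot (?B v) v = 0"
    using A Hne[OF v0] by (simp add: cdot_form_at[symmetric] form_at_pullback twisted_form_def)
  then have "c * (of_nat d * F v) = 0"
    unfolding v(2) euler_identity[OF Fp, symmetric] by (simp add: cdot_def sum_distrib_left mult_ac)
  then have Fv: "F v = 0" using ci d by simp
  have mem: "proj_point v \<in> restr_sing_set ?B F"
    using restr_sing_set_iff[OF F d A H v0] Fv v(2) by blast
  define s where "s u = (v $ j / u $ j) *s u" for u :: "complex^'n"
  define O1 where "O1 = {u :: complex^'n. u $ j \<noteq> 0}"
  have O1: "open O1"
  proof -
    have "O1 = (\<lambda>u. u $ j) -` (- {0})" by (auto simp: O1_def)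
    then show ?thesis by (simp add: open_vimage open_Compl continuous_intros)
  qed
  have scont: "continuous_on O1 s"
    unfolding s_def by (intro continuous_intros) (auto simp: O1_def)
  have snz: "s u \<noteq> 0" if "u \<in> O1" for u
  proof -
    have "s u $ j = v $ j" using that by (simp add: s_def O1_def)
    then show ?thesis using v(1) by auto
  qed
  have pcont: "continuous_on O1 (\<lambda>u. pd i F (s u))"
    by (rule continuous_on_compose2[OF continuous_on_pd[OF Fhol open_UNIV] scont]) auto
  define O2 where "O2 = O1 \<inter> (\<lambda>u. pd i F (s u)) -` (- {0})"
  have O2: "open O2"
    unfolding O2_def by (rule continuous_open_preimage[OF pcont O1]) (simp add: open_Compl)
  have O21: "O2 \<subseteq> O1" by (auto simp: O2_def)
  have Acont: "continuous_on (- {0}) A"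
  proof -
    have "continuous_on (- {0}) (\<lambda>v. \<chi> a. A v $ a)"
      using A by (intro continuous_on_vec_lambda hol_on_continuous) (simp add: twisted_form_def holomorphic_map_on_iff)
    then show ?thesis by simp
  qed
  have mvc: "continuous_on S (\<lambda>u. M *v u)" for S and M :: "complex^'n^'n"
    by (rule linear_continuous_on[OF linear_conv_bounded_linear[THEN iffD1, OF matrix_vector_mul_linear]])
  have "continuous_on (- {0}) (\<lambda>v. A (H *v v))"
    by (rule continuous_on_compose2[OF Acont mvc], rule image_subsetI) (simp add: Hne)
  then have "continuous_on (- {0}) ?B"
    unfolding pullback_form_def
    by (rule continuous_on_compose2[OF mvc[of UNIV]]) (rule subset_UNIV)
  then have Bs: "continuous_on O1 (\<lambda>u. ?B (s u))"
    by (rule continuous_on_compose2[OF _ scont]) (auto simp: snz)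
  have "continuous_on O1 (\<lambda>u. ?B (s u) $ i)" by (intro continuous_intros Bs)
  then have rcont: "continuous_on O2 (\<lambda>u. (s u, ?B (s u) $ i / pd i F (s u)))"
    by (intro continuous_on_Pair continuous_on_divide continuous_on_subset[OF scont O21]
          continuous_on_subset[OF pcont O21] continuous_on_subset[OF _ O21]) (auto simp: O2_def)
  define C where "C = O2 \<inter> (\<lambda>u. (s u, ?B (s u) $ i / pd i F (s u))) -` U"
  have C: "open C" unfolding C_def by (rule continuous_open_preimage[OF rcont O2 U(1)])
  have C0: "0 \<notin> C" by (simp add: C_def O2_def O1_def)
  have Cinv: "e *s u \<in> C" if "u \<in> C" "e \<noteq> 0" for e u
  proof -
    have "s (e *s u) = s u" using that by (simp add: s_def vector_smult_assoc)
    then show ?thesis using that by (simp add: C_def O2_def O1_def)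
  qed
  define T where "T = {proj_point u | u. u \<in> C}"
  have "proj_cone T = C" unfolding T_def by (rule proj_cone_of_cone[OF _ C0]) (rule Cinv)
  then have "open T" using C by (simp add: open_proj_def)
  moreover have "T \<inter> restr_sing_set ?B F = {proj_point v}"
  proof
    have sv: "s v = v" using v(1) by (simp add: s_def)
    have "?B v $ i / pd i F v = c" using v(2) ci by simp
    then have "v \<in> C" using sv v(1) ci U(2) by (simp add: C_def O2_def O1_def)
    then show "{proj_point v} \<subseteq> T \<inter> restr_sing_set ?B F" using mem unfolding T_def by blast
    show "T \<inter> restr_sing_set ?B F \<subseteq> {proj_point v}"
    proof
      fix x assume x: "x \<in> T \<inter> restr_sing_set ?B F"
      then obtain u where u: "x = proj_point u" "u \<in> C" unfolding T_def by blast
      have u1: "u \<in> O1" and uU: "(s u, ?B (s u) $ i / pd i F (s u)) \<in> U" using u(2) by (auto simp: C_def O2_def)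
      have unz: "u \<noteq> 0" using u1 by (auto simp: O1_def)
      have xs: "x = proj_point (s u)"
        unfolding u(1) using proj_point_eq_iff[OF unz snz[OF u1]] by (auto simp: s_def)
      then obtain c' where c': "?B (s u) = c' *s grad F (s u)"
        using x restr_sing_set_iff[OF F d A H snz[OF u1]] by blast
      have "?B (s u) $ i / pd i F (s u) = c'" using c' U(3)[OF uU] by simp
      then have "(s u, c') \<in> U" using uU by simp
      moreover have "s u $ j = v $ j" using u1 by (simp add: s_def O1_def)
      ultimately have "s u = v" using uniq c' by blast
      then show "x \<in> {proj_point v}" using xs by simp
    qed
  qed
  ultimately show "proj_point v isolated_in restr_sing_set ?B F"
    using mem unfolding isolated_in_def by blast
  show "proj_point v \<notin> sing_set ?B"
  proof
    assume "proj_point v \<in> sing_set ?B"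
    then obtain u where u: "proj_point v = proj_point u" "u \<noteq> 0" "?B u = 0" by (auto simp: sing_set_def)
    then obtain e where e: "v = e *s u" using proj_point_eq_iff[of u v] v0 by auto
    then have "e \<noteq> 0" using v0 by auto
    then have "?B v = 0" unfolding e using scale u by simp
    then have "c * pd i F v = 0" using v(2) by (metis grad_nth vector_smult_component zero_index)
    then show False using ci by simp
  qed
qed

lemma open_invertible: "open {H :: complex^'n^'n. invertible H}"
proof -
  have "continuous_on UNIV (\<lambda>H :: complex^'n^'n. det H)"
    unfolding det_def by (intro continuous_intros)
  moreover have "{H :: complex^'n^'n. invertible H} = det -` (- {0})"
    by (auto simp: invertible_det_nz)
  ultimately show ?thesis by (simp add: open_vimage open_Compl)
qed

theorem theorem4p3:
  fixes \<omega> :: "complex^'n \<Rightarrow> complex^'n"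
    and F :: "complex^'n \<Rightarrow> complex"
    and n d :: nat and k :: int
  assumes "CARD('n) = n + 1" and "n > 2"
    and "foliation_form k \<omega>"
    and "smooth_hypersurface_eq d F" and "d \<ge> 2"
    and "transverse_to \<omega> F"
  shows "\<exists>H::complex^'n^'n. invertible H \<and>
           transverse_to (pullback_form H \<omega>) F \<and>
           (\<exists>p. p isolated_in restr_sing_set (pullback_form H \<omega>) F \<and>
                p \<notin> sing_set (pullback_form H \<omega>))"
proof -
  have card: "CARD('n) \<ge> 4" using assms(1,2) by simp
  have A: "twisted_form k \<omega>" and codim: "codim_at_least 2 (CARD('n) - 1) (sing_set \<omega>)"
    using assms(3) by (auto simp: foliation_form_def)
  obtain q where q: "q \<noteq> 0" "\<omega> q \<noteq> 0" using assms(3) by (auto simp: foliation_form_def)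
  have F: "smooth_hypersurface_eq d F" and d: "d \<ge> 2" "d \<ge> 1" using assms(4,5) by auto
  have Fp: "homogeneous_polynomial d F" using F by (simp add: smooth_hypersurface_eq_def)
  have Fhol: "hol_on F UNIV" by (rule homogeneous_polynomial_hol_on[OF Fp])
  have Ahol: "hol_on (\<lambda>v. \<omega> v $ a) (- {0})" for a
    using A by (simp add: twisted_form_def holomorphic_map_on_iff)
  obtain p where p: "p \<noteq> 0" "F p = 0" "\<forall>w. hess F p w = 0 \<longrightarrow> w = 0"
    using exists_hess_nondegenerate[OF F d(1)] card by auto
  obtain j where j: "p $ j \<noteq> 0" using p(1) by (auto simp: vec_eq_iff)
  obtain i where i: "pd i F p \<noteq> 0" using grad_nonzero[OF F p(1,2)] by (auto simp: vec_eq_iff)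
  obtain H0 c0 where H0: "invertible H0" "c0 \<noteq> 0" "pullback_form H0 \<omega> p = c0 *s grad F p"
    and inj: "\<forall>x e. transpose H0 *v dform \<omega> (H0 *v p) (H0 *v x) - e *s grad F p - c0 *s hess F p x = 0 \<longrightarrow>
        x $ j = 0 \<longrightarrow> x = 0 \<and> e = 0"
    using exists_nondegenerate_tangency[OF A q F d(1) p j] by (elim exE conjE) (rule that)
  \<comment> \<open>A nonzero multiplier puts the tangency on the hypersurface and off the singular
    set; a nonzero \<open>pd i F\<close> lets the multiplier be read off as a quotient.\<close>
  define W where "W = {x :: (complex^'n^'n) \<times> (complex^'n) \<times> complex. snd (snd x) \<noteq> 0 \<and> pd i F (fst (snd x)) \<noteq> 0}"
  have "W = (\<lambda>x. snd (snd x)) -` (- {0}) \<inter> (\<lambda>x. pd i F (fst (snd x))) -` (- {0})"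
    by (auto simp: W_def)
  moreover have "continuous_on UNIV (\<lambda>x :: (complex^'n^'n) \<times> (complex^'n) \<times> complex. pd i F (fst (snd x)))"
    by (rule continuous_on_compose2[OF continuous_on_pd[OF Fhol open_UNIV]]) (auto intro!: continuous_intros)
  ultimately have W: "open W" by (simp add: open_Int open_vimage open_Compl continuous_intros)
  have W0: "(H0, p, c0) \<in> W" using H0(2) i by (simp add: W_def)
  have Hp: "H0 *v p \<noteq> 0" using H0(1) p(1) by (auto simp: invertible_iff_ker)
  obtain U N where U: "open U" "U \<subseteq> W" and N: "open N" "H0 \<in> N" and sol: "\<forall>H\<in>N. \<exists>v c. (H, v, c) \<in> U \<and> v $ j = p $ j \<and>
    pullback_form H \<omega> v = c *s grad F v \<and>
    (\<forall>v' c'. (H, v', c') \<in> U \<and> v' $ j = p $ j \<and> pullback_form H \<omega> v' = c' *s grad F v' \<longrightarrow> v' = v)"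
    using pullback_tangency_stable[OF Ahol Fhol Hp H0(3) inj W W0]
    by (elim exE conjE) (rule that, assumption+)
  have "open (N \<inter> {H. invertible H})" "N \<inter> {H. invertible H} \<noteq> {}"
    using N H0(1) open_invertible by auto
  then have "\<not> negligible (N \<inter> {H. invertible H})" by (rule open_not_negligible)
  then have "\<not> N \<inter> {H. invertible H} \<subseteq> {H. invertible H \<and> \<not> transverse_to (pullback_form H \<omega>) F}"
    using negligible_subset[OF negligible_nontransverse[OF A codim card q F d(2)]] by blast
  then obtain H where H: "H \<in> N" "invertible H" "transverse_to (pullback_form H \<omega>) F" by blast
  from bspec[OF sol H(1)] obtain v c where v: "(H, v, c) \<in> U" "v $ j = p $ j" "pullback_form H \<omega> v = c *s grad F v"
    and uniq: "\<forall>v' c'. (H, v', c') \<in> U \<and> v' $ j = p $ j \<and> pullback_form H \<omega> v' = c' *s grad F v' \<longrightarrow> v' = v"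
    by (elim exE conjE) (rule that)
  have UH: "open (Pair H -` U)" by (rule open_vimage[OF U(1)]) (intro continuous_intros)
  have vj: "v $ j \<noteq> 0" using v(2) j by simp
  have mem: "(v, c) \<in> Pair H -` U" using v(1) by simp
  have UW: "c' \<noteq> 0 \<and> pd i F v' \<noteq> 0" if "(v', c') \<in> Pair H -` U" for v' c'
    using that U(2) by (auto simp: W_def)
  have un: "v' = v" if "(v', c') \<in> Pair H -` U" "v' $ j = v $ j" "pullback_form H \<omega> v' = c' *s grad F v'" for v' c'
    by (rule uniq[rule_format, of v' c']) (use that v(2) in simp)
  have "proj_point v isolated_in restr_sing_set (pullback_form H \<omega>) F"
    "proj_point v \<notin> sing_set (pullback_form H \<omega>)"
    by (rule isolated_restr_sing[OF A F d(2) H(2) UH mem UW vj v(3) un], assumption+)+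
  then show ?thesis using H(2,3) by blast
qed

end
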